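(* Let $1<p<\infty$ and let $d\mu=w\,dx$ be a locally doubling measure on $\mathbb{R}$ supporting a local $p$-Poincaré inequality. Let $v$ be quasiharmonic on $(\mathbb{R},\mu)$ or on the open subset $\Omega=(0,\infty)$ of $(\mathbb{R},\mu)$. Then $v$ has finite energy (on $\mathbb{R}$ or on $\Omega$, respectively) if and only if it is bounded.
   Context: $1<p<\infty$; $X=(\mathbb{R},\mu)$ is the real line with the Euclidean metric and a positive complete Borel measure $\mu$ with $0<\mu(B)<\infty$ for all balls (bounded open intervals) $B$; here $w$ is a weight (nonnegative locally integrable function), and under the assumptions $w>0$ a.e. For a ball $B=B(x,r)$, $\lambda B=B(x,\lambda r)$, $r_B=r$. Upper gradients. Curves are nonconstant, compact and rectifiable, parameterized by arc length $ds$. A property holds for $p$-almost every curve if for the family $\Gamma$ of curves for which it fails there is a Borel function $0\le\rho\in L^p(X)$ with $\int_\gamma\rho\,ds=\infty$ for all $\gamma\in\Gamma$. A measurable $g:X\to[0,\infty]$ is a $p$-weak upper gradient of $u:X\to[-\infty,\infty]$ if for $p$-almost every curve $\gamma:[0,l_\gamma]\to X$, $|u(\gamma(0))-u(\gamma(l_\gamma))|\le\int_\gamma g\,ds$ (left-hand side $\infty$ if a term is $\pm\infty$). If $u$ has a $p$-weak upper gradient in $L^p_{\rm loc}$, then $g_u$ denotes the minimal one (a.e. smallest). For measurable $u$, $\|u\|_{N^{1,p}(X)}^p=\int_X|u|^p\,d\mu+\inf_g\int_Xg^p\,d\mu$, infimum over $p$-weak upper gradients $g$ of $u$, and $N^{1,p}(X)=\{u:\|u\|_{N^{1,p}(X)}<\infty\}$;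 $N^{1,p}(E)$ is defined by regarding a measurable set $E$ as a metric measure space in its own right. Local assumptions. $\mu$ is locally doubling if for every $x_0$ there are $r_0>0$, $C>0$ (depending on $x_0$) with $\mu(2B)\le C\mu(B)$ for all balls $B\subset B(x_0,r_0)$. $\mu$ supports a local $p$-Poincaré inequality if for every $x_0$ there are $r_0>0$, $C>0$, $\lambda\ge1$ (depending on $x_0$) such that for all balls $B\subset B(x_0,r_0)$, all integrable $u$ on $\lambda B$ and all $p$-weak upper gradients $g$ of $u$, $\frac1{\mu(B)}\int_B|u-u_B|\,d\mu\le Cr_B\bigl(\frac1{\mu(\lambda B)}\int_{\lambda B}g^p\,d\mu\bigr)^{1/p}$, where $u_B=\frac1{\mu(B)}\int_Bu\,d\mu$. Quasiharmonic functions. For open $\Omega\subset X$, let $\mathcal{G}_{\rm dist}(\Omega)$ be the collection of bounded open $G\subset\Omega$ with $\operatorname{dist}(G,X\setminus\Omega)>0$ (by convention $\operatorname{dist}(G,\emptyset)>0$). Let $N^{1,p}_0(G)$ be the restrictions to $G$ of $\varphi\in N^{1,p}(X)$ with $\varphi=0$ in $X\setminus G$ (identified with zero extensions). $N^{1,p}_{\rm loc,dist}(\Omega)$ is the set of $u:\Omega\to[-\infty,\infty]$ with $u\in N^{1,p}(G)$ for all $G\in\mathcal{G}_{\rm dist}(\Omega)$, and $N^{1,p}_{0,\rm dist}(\Omega)$ is the closure, in the $N^{1,p}(X)$-norm, of the functions belonging to $N^{1,p}_0(G)$ for some $G\in\mathcal{G}_{\rm dist}(\Omega)$. A function $u\in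 N^{1,p}_{\rm loc,dist}(\Omega)$ is a quasiminimizer in $\Omega$ if there is $Q\ge1$ with $\int_{\{\varphi\ne0\}}g_u^p\,d\mu\le Q\int_{\{\varphi\ne0\}}g_{u+\varphi}^p\,d\mu$ for all $\varphi\in N^{1,p}_{0,\rm dist}(\Omega)$. A continuous (real-valued) quasiminimizer is called quasiharmonic. It has finite energy on $\Omega$ if $\int_\Omega g_u^p\,d\mu<\infty$. *)

theory Defs
  imports "HOL-Analysis.Analysis"
begin

section \<open>Extended-valued arithmetic\<close>

text \<open>The power \<open>a\<^sup>p\<close> of \<open>a \<in> [0,\<infinity>]\<close>; it is only used for \<open>p > 0\<close>.\<close>

definition epowr :: "ennreal \<Rightarrow> real \<Rightarrow> ennreal" where
  "epowr a p = (if a = top then top else ennreal (enn2real a powr p))"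

text \<open>\<open>|x - y|\<close> for extended reals, with value \<open>\<infinity>\<close> as soon as one of the terms is infinite.\<close>

definition ext_dist :: "ereal \<Rightarrow> ereal \<Rightarrow> ennreal" where
  "ext_dist x y = (if \<bar>x\<bar> = \<infinity> \<or> \<bar>y\<bar> = \<infinity> then top else e2ennreal \<bar>x - y\<bar>)"

section \<open>Curves\<close>

text \<open>
  A measurable set \<open>E\<close> of reals, regarded as a metric measure space in its own right, is represented
  by a measure \<open>M\<close> with \<open>space M = E\<close>, namely \<open>restrict_space \<mu> E\<close>; the metric is the Euclidean one.
  Functions on \<open>E\<close> are total functions whose values outside \<open>E\<close> are irrelevant.
\<close>

definition curve_length :: "(real \<Rightarrow> real) \<Rightarrow> real \<Rightarrow> real \<Rightarrow> ennreal" where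
  "curve_length \<gamma> a b =
     Sup {ennreal (\<Sum>i<n. dist (\<gamma> (t i)) (\<gamma> (t (Suc i)))) | (n::nat) (t::nat \<Rightarrow> real).
            mono_on {..n} t \<and> t ` {..n} \<subseteq> {a..b}}"

text \<open>
  A nonconstant compact rectifiable curve in \<open>E\<close>, parameterized by arc length, is a pair of its
  length \<open>l\<close> and a map \<open>\<gamma> : [0,l] \<rightarrow> E\<close>; being nonconstant amounts to \<open>l > 0\<close>.
\<close>

definition arc_length_curve :: "real set \<Rightarrow> real \<Rightarrow> (real \<Rightarrow> real) \<Rightarrow> bool" where
  "arc_length_curve E l \<gamma> \<longleftrightarrow>
     0 < l \<and> continuous_on {0..l} \<gamma> \<and> \<gamma> ` {0..l} \<subseteq> E \<and>
     (\<forall>t\<in>{0..l}. curve_length \<gamma> 0 t = ennreal t)"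

definition curve_integral :: "(real \<Rightarrow> ennreal) \<Rightarrow> real \<Rightarrow> (real \<Rightarrow> real) \<Rightarrow> ennreal" where
  "curve_integral \<rho> l \<gamma> = (\<integral>\<^sup>+ t\<in>{0..l}. \<rho> (\<gamma> t) \<partial>lebesgue)"

definition Lp_integral :: "real measure \<Rightarrow> real \<Rightarrow> (real \<Rightarrow> ennreal) \<Rightarrow> ennreal" where
  "Lp_integral M p g = (\<integral>\<^sup>+ x. epowr (g x) p \<partial>M)"

text \<open>Property \<open>P\<close> holds for \<open>p\<close>-almost every curve in the space \<open>M\<close>.\<close>

definition p_ae_curve ::
    "real measure \<Rightarrow> real \<Rightarrow> (real \<Rightarrow> (real \<Rightarrow> real) \<Rightarrow> bool) \<Rightarrow> bool" where
  "p_ae_curve M p P \<longleftrightarrow>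
     (\<exists>\<rho> \<in> borel_measurable (restrict_space borel (space M)).
        Lp_integral M p \<rho> < top \<and>
        (\<forall>l \<gamma>. arc_length_curve (space M) l \<gamma> \<and> \<not> P l \<gamma> \<longrightarrow> curve_integral \<rho> l \<gamma> = top))"

section \<open>Weak upper gradients and Newtonian spaces\<close>

definition weak_upper_gradient ::
    "real measure \<Rightarrow> real \<Rightarrow> (real \<Rightarrow> ereal) \<Rightarrow> (real \<Rightarrow> ennreal) \<Rightarrow> bool" where
  "weak_upper_gradient M p u g \<longleftrightarrow>
     g \<in> borel_measurable M \<and>
     p_ae_curve M p (\<lambda>l \<gamma>. ext_dist (u (\<gamma> 0)) (u (\<gamma> l)) \<le> curve_integral g l \<gamma>)"

definition Lp_loc :: "real measure \<Rightarrow> real \<Rightarrow> (real \<Rightarrow> ennreal) set" where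
  "Lp_loc M p =
     {g \<in> borel_measurable M.
        \<forall>x\<in>space M. \<exists>r>0. Lp_integral (restrict_space M (ball x r \<inter> space M)) p g < top}"

definition is_minimal_weak_upper_gradient ::
    "real measure \<Rightarrow> real \<Rightarrow> (real \<Rightarrow> ereal) \<Rightarrow> (real \<Rightarrow> ennreal) \<Rightarrow> bool" where
  "is_minimal_weak_upper_gradient M p u g \<longleftrightarrow>
     weak_upper_gradient M p u g \<and> g \<in> Lp_loc M p \<and>
     (\<forall>h. weak_upper_gradient M p u h \<and> h \<in> Lp_loc M p \<longrightarrow> (AE x in M. g x \<le> h x))"

text \<open>
  The minimal weak upper gradient \<open>g\<^sub>u\<close> is unique only up to null sets; the choice of the
  representative does not affect integrals.  It is meaningful whenever \<open>u\<close> has a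
  \<open>p\<close>-weak upper gradient in \<open>Lp_loc M p\<close>.
\<close>

definition min_weak_upper_gradient ::
    "real measure \<Rightarrow> real \<Rightarrow> (real \<Rightarrow> ereal) \<Rightarrow> real \<Rightarrow> ennreal" where
  "min_weak_upper_gradient M p u = (SOME g. is_minimal_weak_upper_gradient M p u g)"

definition newtonian_norm :: "real measure \<Rightarrow> real \<Rightarrow> (real \<Rightarrow> ereal) \<Rightarrow> ennreal" where
  "newtonian_norm M p u =
     epowr (Lp_integral M p (\<lambda>x. e2ennreal \<bar>u x\<bar>) +
            (INF g\<in>{g. weak_upper_gradient M p u g}. Lp_integral M p g)) (1 / p)"

definition newtonian :: "real measure \<Rightarrow> real \<Rightarrow> (real \<Rightarrow> ereal) set" where
  "newtonian M p = {u \<in> borel_measurable M. newtonian_norm M p u < top}"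

section \<open>Local assumptions on the measure\<close>

text \<open>
  The complete Borel measure \<open>d\<mu> = w dx\<close>.  The completion makes the definition correct also for
  weights vanishing on a set of positive Lebesgue measure.
\<close>

definition weighted_measure :: "(real \<Rightarrow> real) \<Rightarrow> real measure" where
  "weighted_measure w = completion (density lebesgue (\<lambda>x. ennreal (w x)))"

definition weight :: "(real \<Rightarrow> real) \<Rightarrow> bool" where
  "weight w \<longleftrightarrow> (\<forall>x. 0 \<le> w x) \<and> (\<forall>K. compact K \<longrightarrow> set_integrable lebesgue K w)"

definition positive_finite_on_balls :: "real measure \<Rightarrow> bool" where
  "positive_finite_on_balls \<mu> \<longleftrightarrow>
     (\<forall>x r. 0 < r \<longrightarrow> 0 < emeasure \<mu> (ball x r) \<and> emeasure \<mu> (ball x r) < top)"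

definition locally_doubling :: "real measure \<Rightarrow> bool" where
  "locally_doubling \<mu> \<longleftrightarrow>
     (\<forall>x0. \<exists>r0>0. \<exists>C>0. \<forall>x r. 0 < r \<and> ball x r \<subseteq> ball x0 r0 \<longrightarrow>
        emeasure \<mu> (ball x (2 * r)) \<le> ennreal C * emeasure \<mu> (ball x r))"

definition ball_average :: "real measure \<Rightarrow> (real \<Rightarrow> ereal) \<Rightarrow> real set \<Rightarrow> real" where
  "ball_average \<mu> u B = (LINT x:B|\<mu>. real_of_ereal (u x)) / measure \<mu> B"

text \<open>
  The function \<open>u\<close> and its weak upper gradients \<open>g\<close> live on the space \<open>\<Lambda>B\<close>.  An integrable
  \<open>u\<close> is finite a.e., so that \<open>real_of_ereal\<close> in the average loses nothing.
\<close>

definition local_poincare :: "real measure \<Rightarrow> real \<Rightarrow> bool" where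
  "local_poincare \<mu> p \<longleftrightarrow>
     (\<forall>x0. \<exists>r0>0. \<exists>C>0. \<exists>\<Lambda>\<ge>1. \<forall>x r. 0 < r \<and> ball x r \<subseteq> ball x0 r0 \<longrightarrow>
        (let B = ball x r; B' = ball x (\<Lambda> * r); M = restrict_space \<mu> B' in
          \<forall>u g. u \<in> borel_measurable M \<and> (\<integral>\<^sup>+ y. e2ennreal \<bar>u y\<bar> \<partial>M) < top \<and>
                weak_upper_gradient M p u g \<longrightarrow>
            (\<integral>\<^sup>+ y\<in>B. ext_dist (u y) (ereal (ball_average \<mu> u B)) \<partial>\<mu>) / emeasure \<mu> B
            \<le> ennreal (C * r) * epowr (Lp_integral M p g / emeasure \<mu> B') (1 / p)))"

section \<open>Quasiharmonic functions\<close>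

text \<open>
  Here \<open>setdist\<close> is \<open>0\<close> if one of the sets is empty, whereas the distance to the empty set
  has to count as positive.
\<close>

definition G_dist :: "real set \<Rightarrow> real set set" where
  "G_dist \<Omega> = {G. open G \<and> bounded G \<and> G \<subseteq> \<Omega> \<and>
                   (G = {} \<or> - \<Omega> = {} \<or> 0 < setdist G (- \<Omega>))}"

definition newtonian_loc_dist :: "real measure \<Rightarrow> real \<Rightarrow> real set \<Rightarrow> (real \<Rightarrow> ereal) set" where
  "newtonian_loc_dist \<mu> p \<Omega> = {u. \<forall>G\<in>G_dist \<Omega>. u \<in> newtonian (restrict_space \<mu> G) p}"

text \<open>Functions with zero boundary values are identified with their zero extensions.\<close>

definition newtonian_zero :: "real measure \<Rightarrow> real \<Rightarrow> real set \<Rightarrow> (real \<Rightarrow> ereal) set" where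
  "newtonian_zero \<mu> p G = {\<phi> \<in> newtonian \<mu> p. \<forall>x. x \<notin> G \<longrightarrow> \<phi> x = 0}"

definition newtonian_zero_dist :: "real measure \<Rightarrow> real \<Rightarrow> real set \<Rightarrow> (real \<Rightarrow> ereal) set" where
  "newtonian_zero_dist \<mu> p \<Omega> =
     {\<phi> \<in> newtonian \<mu> p. \<forall>\<epsilon>>0. \<exists>\<psi> \<in> (\<Union>G\<in>G_dist \<Omega>. newtonian_zero \<mu> p G).
        newtonian_norm \<mu> p (\<lambda>x. \<phi> x - \<psi> x) < ennreal \<epsilon>}"

text \<open>
  The minimal weak upper gradients are those on the space \<open>\<Omega>\<close>.  Functions in a Newtonian space
  are infinite only on a set of zero capacity, so that the value of \<open>\<infinity> - \<infinity>\<close> in sums and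
  differences is immaterial.
\<close>

definition quasiminimizer :: "real measure \<Rightarrow> real \<Rightarrow> real set \<Rightarrow> (real \<Rightarrow> ereal) \<Rightarrow> bool" where
  "quasiminimizer \<mu> p \<Omega> u \<longleftrightarrow>
     u \<in> newtonian_loc_dist \<mu> p \<Omega> \<and>
     (let M = restrict_space \<mu> \<Omega> in
      \<exists>Q\<ge>1. \<forall>\<phi>\<in>newtonian_zero_dist \<mu> p \<Omega>.
        (\<integral>\<^sup>+ x\<in>{x. \<phi> x \<noteq> 0}. epowr (min_weak_upper_gradient M p u x) p \<partial>M)
        \<le> ennreal Q *
           (\<integral>\<^sup>+ x\<in>{x. \<phi> x \<noteq> 0}. epowr (min_weak_upper_gradient M p (\<lambda>y. u y + \<phi> y) x) p \<partial>M))"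

definition quasiharmonic :: "real measure \<Rightarrow> real \<Rightarrow> real set \<Rightarrow> (real \<Rightarrow> real) \<Rightarrow> bool" where
  "quasiharmonic \<mu> p \<Omega> v \<longleftrightarrow>
     continuous_on \<Omega> v \<and> quasiminimizer \<mu> p \<Omega> (\<lambda>x. ereal (v x))"

definition finite_energy :: "real measure \<Rightarrow> real \<Rightarrow> real set \<Rightarrow> (real \<Rightarrow> real) \<Rightarrow> bool" where
  "finite_energy \<mu> p \<Omega> v \<longleftrightarrow>
     (let M = restrict_space \<mu> \<Omega> in
      Lp_integral M p (min_weak_upper_gradient M p (\<lambda>x. ereal (v x))) < top)"

end

theory Submission
  imports Defs "HOL-Probability.Distribution_Functions"
begin

text \<open>
  Let \<open>\<sigma> = w\<^sup>-\<^sup>1\<^sup>/\<^sup>(\<^sup>p\<^sup>-\<^sup>1\<^sup>)\<close> be the dual weight and \<open>S(c,d)\<close> its integral over \<open>[c,d]\<close>.  Everything rests on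
  two estimates for the energy \<open>E(c,d)\<close>, the integral of \<open>|v'|\<^sup>p w\<close> over \<open>[c,d]\<close>.  Hoelder's
  inequality bounds the increment of \<open>v\<close> by the energy,
  \<open>|v(d) - v(c)|\<^sup>p \<le> E(c,d) S(c,d)\<^sup>p\<^sup>-\<^sup>1\<close>; it is used in the additive form of
  \<open>increment_le_energy_add_dual\<close>.  Equality holds for the primitives of multiples of \<open>\<sigma>\<close>, which are
  the \<open>p\<close>-harmonic functions of one variable, and comparing \<open>v\<close> with the one that has
  the same values at \<open>c\<close> and \<open>d\<close> turns the quasiminimizing property into the reverse estimate
  \<open>E(c,d) \<le> Q |v(d) - v(c)|\<^sup>p S(c,d)\<^sup>1\<^sup>-\<^sup>p\<close> of \<open>quasiminimizer_energy_bound\<close>.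

  Exhaust the domain by intervals \<open>[a\<^sub>n,b\<^sub>n]\<close>.  If \<open>v\<close> is bounded, the reverse estimate bounds
  \<open>E(a\<^sub>n,b\<^sub>n)\<close>, because \<open>S(a\<^sub>n,b\<^sub>n)\<close> stays away from \<open>0\<close>.  Let now the energy be finite.  If
  \<open>S(a\<^sub>n,b\<^sub>n)\<close> is bounded, Hoelder's inequality bounds the oscillation of \<open>v\<close>.  Otherwise
  Hoelder's inequality on the part of \<open>[a\<^sub>n,b\<^sub>n]\<close> outside a large fixed \<open>[a\<^sub>N,b\<^sub>N]\<close>, which carries little
  energy, shows that \<open>|v(b\<^sub>n) - v(a\<^sub>n)|\<^sup>p\<close> grows more slowly than \<open>S(a\<^sub>n,b\<^sub>n)\<^sup>p\<^sup>-\<^sup>1\<close>.  The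
  reverse estimate then makes the energy vanish, so that \<open>v\<close> is constant.

  These estimates make sense because the dual weight is locally integrable: this is what the
  Poincare inequality says for primitives of regularizations of \<open>\<sigma>\<close>
  (\<open>poincare_dual_weight_bound\<close>).  Consequently every segment carries
  positive modulus, weak upper gradients may be tested on segments, and a Newtonian function on an
  interval is a primitive of some \<open>f\<close> whose absolute value is its minimal weak upper gradient
  (\<open>is_minimal_weak_upper_gradient_of_primitive\<close>).  The derivative \<open>f\<close> is obtained from the
  Radon-Nikodym theorem, not by differentiation.
\<close>

section \<open>Comparison of measures on the line\<close>

lemma ex_sum_measure:
  fixes M N :: "real measure"
  assumes [measurable_cong]: "sets M = sets borel" "sets N = sets borel"
  obtains L :: "real measure" where "sets L = sets borel"
    and "\<And>A. A \<in> sets borel \<Longrightarrow> emeasure L A = emeasure M A + emeasure N A"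
proof -
  define L where "L = measure_of UNIV (sets borel) (\<lambda>A. emeasure M A + emeasure N A)"
  have sL: "sets L = sets borel"
    unfolding L_def by (metis sets.sigma_sets_eq sets_measure_of space_borel top_greatest Pow_UNIV)
  have "emeasure L A = emeasure M A + emeasure N A" if A: "A \<in> sets borel" for A
  proof (rule emeasure_measure_of[OF L_def])
    show "sets borel \<subseteq> Pow UNIV" by simp
    show "A \<in> sets L" using A sL by simp
    show "positive (sets L) (\<lambda>A. emeasure M A + emeasure N A)"
      by (simp add: positive_def)
    show "countably_additive (sets L) (\<lambda>A. emeasure M A + emeasure N A)"
    proof (rule countably_additiveI)
      fix A :: "nat \<Rightarrow> real set"
      assume A: "range A \<subseteq> sets L" "disjoint_family A"
      then have "range A \<subseteq> sets M" "range A \<subseteq> sets N" using sL assms by auto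
      then show "(\<Sum>i. emeasure M (A i) + emeasure N (A i)) = emeasure M (\<Union> (range A)) + emeasure N (\<Union> (range A))"
        using A(2) by (simp add: suminf_add[symmetric] suminf_emeasure)
    qed
  qed
  with sL show thesis by (rule that)
qed

text \<open>The difference of the two distribution functions is nondecreasing and right-continuous, so it has
  a Stieltjes measure, and adding that measure to \<open>M\<close> gives \<open>N\<close>.\<close>

lemma emeasure_le_of_Ioc_le:
  fixes M N :: "real measure"
  assumes M: "finite_borel_measure M" and N: "finite_borel_measure N"
    and le: "\<And>x y. x < y \<Longrightarrow> emeasure M {x<..y} \<le> emeasure N {x<..y}"
    and A: "A \<in> sets borel"
  shows "emeasure M A \<le> emeasure N A"
proof -
  interpret M: finite_borel_measure M by fact
  interpret N: finite_borel_measure N by fact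
  define F where "F x = cdf N x - cdf M x" for x
  have Fd: "F y - F x = measure N {x<..y} - measure M {x<..y}" if "x < y" for x y
    using M.cdf_diff_eq[OF that] N.cdf_diff_eq[OF that] by (simp add: F_def)
  have le': "measure M {x<..y} \<le> measure N {x<..y}" if "x < y" for x y
    using le[OF that] by (simp add: M.emeasure_eq_measure N.emeasure_eq_measure)
  have mono: "F x \<le> F y" if "x \<le> y" for x y
    using that Fd[of x y] le'[of x y] by (cases "x = y") auto
  have rc: "continuous (at_right a) F" for a
    unfolding F_def by (intro continuous_intros M.cdf_is_right_cont N.cdf_is_right_cont)
  obtain L where sL: "sets L = sets borel"
    and eL: "\<And>A. A \<in> sets borel \<Longrightarrow> emeasure L A = emeasure M A + emeasure (interval_measure F) A"
    using ex_sum_measure[of M "interval_measure F"] M.M_is_borel by auto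
  have Ioc: "emeasure L {x<..y} = emeasure N {x<..y}" for x y
  proof (cases "x < y")
    case True
    then show ?thesis
      using le'[OF True] by (simp add: eL emeasure_interval_measure_Ioc[OF _ mono rc] Fd[OF True]
            M.emeasure_eq_measure N.emeasure_eq_measure flip: ennreal_plus)
  qed auto
  have "L = N"
  proof (rule measure_eqI_generator_eq_countable)
    let ?E = "range (\<lambda>(a, b). {a<..b::real})"
    show "Int_stable ?E"
      by (auto simp: Int_stable_def)
    show "?E \<subseteq> Pow UNIV" "sets L = sigma_sets UNIV ?E" "sets N = sigma_sets UNIV ?E"
      unfolding sL N.M_is_borel borel_sigma_sets_Ioc by auto
    show "range (\<lambda>n. {- real n<..real n}) \<subseteq> ?E" by auto
    show "\<Union> (range (\<lambda>n. {- real n<..real n})) = UNIV" by (rule UN_Ioc_eq_UNIV)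
    show "emeasure L a \<noteq> \<infinity>" if "a \<in> range (\<lambda>n. {- real n<..real n})" for a
      using that Ioc by (auto simp: N.emeasure_eq_measure)
  qed (auto simp: Ioc)
  then show ?thesis
    using eL[OF A] by simp
qed

section \<open>Locally absolutely continuous functions\<close>

text \<open>With \<open>P\<close> the primitive of \<open>g\<close>, both \<open>P + u\<close> and \<open>P - u\<close> are nondecreasing.  So the Stieltjes
  measure of \<open>u + P\<close> lies below the measure with density \<open>2 g\<close>; it has a density \<open>k \<le> 2 g\<close>
  by the Radon-Nikodym theorem, and \<open>f = k - g\<close>.\<close>

lemma integrable_interval_gradient_derivative:
  fixes u :: "real \<Rightarrow> real" and g :: "real \<Rightarrow> ennreal"
  assumes [measurable]: "g \<in> borel_measurable borel"
    and fin: "(\<integral>\<^sup>+ x. g x \<partial>lborel) < top"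
    and grad: "\<And>c d. c < d \<Longrightarrow> ennreal \<bar>u d - u c\<bar> \<le> (\<integral>\<^sup>+ x\<in>{c<..d}. g x \<partial>lborel)"
  obtains f :: "real \<Rightarrow> real" where "f \<in> borel_measurable borel" "integrable lborel f"
    "AE x in lborel. ennreal \<bar>f x\<bar> \<le> g x"
    "\<And>c d. c < d \<Longrightarrow> u d - u c = (LBINT x:{c<..d}. f x)"
proof -
  define N where "N = density lborel g"
  have "finite_measure N"
    by (rule finite_measureI) (use fin in \<open>simp add: N_def emeasure_density\<close>)
  then interpret N: finite_borel_measure N
    by (simp add: finite_borel_measure_def finite_borel_measure_axioms_def N_def)
  have g_fin: "AE x in lborel. g x \<noteq> top"
    using nn_integral_PInf_AE[of g lborel] fin by auto
  have Nint: "(LBINT x:A. enn2real (g x)) = measure N A" if [measurable]: "A \<in> sets borel" for A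
  proof -
    have "measure N A = enn2real (\<integral>\<^sup>+ x\<in>A. g x \<partial>lborel)"
      by (simp add: measure_def N_def emeasure_density)
    also have "(\<integral>\<^sup>+ x\<in>A. g x \<partial>lborel) = (\<integral>\<^sup>+ x. ennreal (indicator A x * enn2real (g x)) \<partial>lborel)"
      using g_fin by (intro nn_integral_cong_AE) (auto split: split_indicator simp: less_top)
    also have "enn2real \<dots> = (LBINT x:A. enn2real (g x))"
      unfolding set_lebesgue_integral_def
      by (subst integral_eq_nn_integral) auto
    finally show ?thesis by simp
  qed
  define P where "P = cdf N"
  have PD: "P d - P c = measure N {c<..d}" if "c < d" for c d
    using N.cdf_diff_eq[OF that] by (simp add: P_def)
  have uP: "\<bar>u d - u c\<bar> \<le> P d - P c" if "c < d" for c d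
  proof -
    have "ennreal \<bar>u d - u c\<bar> \<le> emeasure N {c<..d}"
      using grad[OF that] by (simp add: N_def emeasure_density)
    then show ?thesis by (simp add: N.emeasure_eq_measure PD[OF that])
  qed
  define U where "U x = u x + P x" for x
  have mono: "U x \<le> U y" if "x \<le> y" for x y
    using that uP[of x y] by (cases "x = y") (auto simp: U_def)
  have rc: "continuous (at_right a) U" for a
  proof -
    have Pc: "(P \<longlongrightarrow> P a) (at_right a)"
      using N.cdf_is_right_cont[of a] by (simp add: continuous_within P_def)
    have "((\<lambda>x. u x - u a) \<longlongrightarrow> 0) (at_right a)"
    proof (rule Lim_null_comparison)
      show "\<forall>\<^sub>F x in at_right a. norm (u x - u a) \<le> P x - P a"
        using uP by (auto simp: eventually_at_filter)
      show "((\<lambda>x. P x - P a) \<longlongrightarrow> 0) (at_right a)"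
        using tendsto_diff[OF Pc tendsto_const[of "P a"]] by simp
    qed
    then have "(u \<longlongrightarrow> u a) (at_right a)" by (simp add: LIM_zero_cancel)
    then show ?thesis
      unfolding continuous_within U_def by (intro tendsto_add Pc)
  qed
  define K where "K = interval_measure U"
  have sK[simp, measurable_cong]: "sets K = sets borel" by (simp add: K_def)
  have KD: "emeasure K {c<..d} = ennreal (U d - U c)" if "c < d" for c d
    using that by (simp add: K_def emeasure_interval_measure_Ioc[OF _ mono rc])
  define N2 where "N2 = density lborel (\<lambda>x. 2 * g x)"
  have eN2: "emeasure N2 A = 2 * emeasure N A" if "A \<in> sets borel" for A
    using that by (simp add: N2_def N_def emeasure_density nn_integral_cmult mult.assoc)
  have "finite_measure N2"
    using eN2[of UNIV] N.emeasure_eq_measure[of UNIV]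
    by (intro finite_measureI) (simp add: N2_def ennreal_mult_eq_top_iff) 
  then interpret N2: finite_borel_measure N2
    by (simp add: finite_borel_measure_def finite_borel_measure_axioms_def N2_def)
  have KN: "emeasure K {c<..d} \<le> emeasure N2 {c<..d}" if "c < d" for c d
  proof -
    have "U d - U c \<le> 2 * measure N {c<..d}"
      using uP[OF that] PD[OF that] by (simp add: U_def)
    then show ?thesis
      by (simp add: KD[OF that] eN2 N.emeasure_eq_measure ennreal_mult'[symmetric] ennreal_numeral[symmetric]
          del: ennreal_numeral)
  qed
  have Kfin: "finite_measure K"
  proof (rule finite_measureI)
    have "emeasure K UNIV = (SUP n. emeasure K {- real n<..real n})"
      unfolding UN_Ioc_eq_UNIV[symmetric]
      by (rule SUP_emeasure_incseq[symmetric]) (auto simp: incseq_def)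
    also have "\<dots> \<le> emeasure N2 UNIV"
    proof (rule SUP_least)
      fix n show "emeasure K {- real n<..real n} \<le> emeasure N2 UNIV"
      proof (cases "n = 0")
        case False
        then have "emeasure K {- real n<..real n} \<le> emeasure N2 {- real n<..real n}" by (intro KN) auto
        also have "\<dots> \<le> emeasure N2 UNIV" by (rule emeasure_mono) (auto simp: N2_def)
        finally show ?thesis .
      qed auto
    qed
    finally show "emeasure K (space K) \<noteq> \<infinity>"
      using N2.emeasure_eq_measure[of UNIV] by (auto simp: K_def top_unique)
  qed
  then interpret K: finite_borel_measure K
    by (simp add: finite_borel_measure_def finite_borel_measure_axioms_def)
  have K_le: "emeasure K A \<le> emeasure N2 A" if "A \<in> sets borel" for A
    by (rule emeasure_le_of_Ioc_le[OF K.finite_borel_measure_axioms N2.finite_borel_measure_axioms KN that])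
  have "absolutely_continuous lborel K"
    unfolding absolutely_continuous_def
  proof
    fix A :: "real set" assume A: "A \<in> null_sets lborel"
    then have "emeasure N2 A = 0"
      using absolutely_continuousI_density[of "\<lambda>x. 2 * g x" lborel]
      by (auto simp: absolutely_continuous_def N2_def)
    with K_le[of A] A show "A \<in> null_sets K" by (auto simp: null_sets_def)
  qed
  then obtain k where [measurable]: "k \<in> borel_measurable lborel" and k: "density lborel k = K"
    using sigma_finite_measure.Radon_Nikodym[OF sigma_finite_lborel, of K] by auto
  have [measurable]: "k \<in> borel_measurable borel" using \<open>k \<in> borel_measurable lborel\<close> by simp
  have kfin: "(\<integral>\<^sup>+ x. k x \<partial>lborel) < top"
    using K.emeasure_eq_measure[of UNIV] unfolding k[symmetric] by (simp add: emeasure_density)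
  have k_fin: "AE x in lborel. k x \<noteq> top"
    using nn_integral_PInf_AE[of k lborel] kfin by auto
  have k_le: "AE x in lborel. k x \<le> 2 * g x"
  proof -
    define A where "A = {x. 2 * g x < k x}"
    have [measurable]: "A \<in> sets borel" unfolding A_def by measurable
    have "(\<integral>\<^sup>+ x\<in>A. (k x - 2 * g x) \<partial>lborel) = (\<integral>\<^sup>+ x. k x * indicator A x - 2 * g x * indicator A x \<partial>lborel)"
      by (intro nn_integral_cong) (auto split: split_indicator)
    also have "\<dots> = (\<integral>\<^sup>+ x\<in>A. k x \<partial>lborel) - (\<integral>\<^sup>+ x\<in>A. 2 * g x \<partial>lborel)"
      using N2.emeasure_eq_measure[of A]
      by (intro nn_integral_diff) (auto simp: A_def N2_def emeasure_density split: split_indicator)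
    also have "(\<integral>\<^sup>+ x\<in>A. k x \<partial>lborel) = emeasure K A" by (simp add: k[symmetric] emeasure_density)
    also have "(\<integral>\<^sup>+ x\<in>A. 2 * g x \<partial>lborel) = emeasure N2 A" by (simp add: N2_def emeasure_density)
    also have "emeasure K A - emeasure N2 A = 0"
      using K_le[of A] K.emeasure_eq_measure[of A] by (auto simp: diff_eq_0_iff_ennreal top_unique) 
    finally have "AE x in lborel. (k x - 2 * g x) * indicator A x = 0"
      by (subst (asm) nn_integral_0_iff_AE) auto
    with k_fin show ?thesis
    proof eventually_elim
      case (elim x)
      then show ?case 
        by (cases "x \<in> A") (auto simp: A_def not_less diff_eq_0_iff_ennreal less_top)
    qed
  qed
  have Kint: "(LBINT x:A. enn2real (k x)) = measure K A" if [measurable]: "A \<in> sets borel" for A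
  proof -
    have "measure K A = enn2real (\<integral>\<^sup>+ x\<in>A. k x \<partial>lborel)"
      by (simp add: measure_def k[symmetric] emeasure_density)
    also have "(\<integral>\<^sup>+ x\<in>A. k x \<partial>lborel) = (\<integral>\<^sup>+ x. ennreal (indicator A x * enn2real (k x)) \<partial>lborel)"
      using k_fin by (intro nn_integral_cong_AE) (auto split: split_indicator simp: less_top)
    also have "enn2real \<dots> = (LBINT x:A. enn2real (k x))"
      unfolding set_lebesgue_integral_def
      by (subst integral_eq_nn_integral) auto
    finally show ?thesis by simp
  qed
  have ig: "integrable lborel (\<lambda>x. enn2real (g x))"
    by (rule integrableI_nonneg, simp, simp, subst nn_integral_cong_AE[where v = g])
      (use g_fin fin in \<open>auto simp: less_top\<close>)
  have ik: "integrable lborel (\<lambda>x. enn2real (k x))"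
    by (rule integrableI_nonneg, simp, simp, subst nn_integral_cong_AE[where v = k])
      (use k_fin kfin in \<open>auto simp: less_top\<close>)
  define f where "f x = enn2real (k x) - enn2real (g x)" for x
  show thesis
  proof (rule that[of f])
    show "f \<in> borel_measurable borel" unfolding f_def by measurable
    show "integrable lborel f" unfolding f_def by (intro Bochner_Integration.integrable_diff ik ig)
    show "AE x in lborel. ennreal \<bar>f x\<bar> \<le> g x"
      using k_le k_fin g_fin
    proof eventually_elim
      case (elim x)
      obtain a where a: "g x = ennreal a" "a \<ge> 0" using elim by (cases "g x") auto
      obtain b where b: "k x = ennreal b" "b \<ge> 0" using elim by (cases "k x") auto
      have "b \<le> 2 * a" using elim a b 
        by (simp add: ennreal_mult'[symmetric] ennreal_numeral[symmetric] del: ennreal_numeral)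
      then have "\<bar>b - a\<bar> \<le> a" using b by simp
      then show ?case using a b by (simp add: f_def)
    qed
    show "u d - u c = (LBINT x:{c<..d}. f x)" if "c < d" for c d
    proof -
      have "(LBINT x:{c<..d}. f x) = (LBINT x:{c<..d}. enn2real (k x)) - (LBINT x:{c<..d}. enn2real (g x))"
        unfolding f_def
        using integrable_mult_indicator[OF _ ik, of "{c<..d}"] integrable_mult_indicator[OF _ ig, of "{c<..d}"]
        by (intro set_integral_diff) (auto simp: set_integrable_def)
      also have "\<dots> = measure K {c<..d} - measure N {c<..d}" by (simp add: Nint Kint)
      also have "measure K {c<..d} = U d - U c"
        using KD[OF that] mono[of c d] that by (simp add: measure_def)
      finally show ?thesis by (simp add: PD[OF that, symmetric] U_def)
    qed
  qed
qed

text \<open>This says that \<open>u\<close> is locally absolutely continuous on \<open>I\<close> with derivative \<open>f\<close>, in the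
  integrated form in which \<open>f\<close> is obtained and used.\<close>

definition primitive_on :: "real set \<Rightarrow> (real \<Rightarrow> real) \<Rightarrow> (real \<Rightarrow> real) \<Rightarrow> bool" where
  "primitive_on I u f \<longleftrightarrow> f \<in> borel_measurable borel \<and>
     (\<forall>a b. a < b \<and> {a..b} \<subseteq> I \<longrightarrow>
        set_integrable lborel {a..b} f \<and> u b - u a = (LBINT x:{a..b}. f x))"

text \<open>The upper gradient inequality on segments.  For a locally integrable dual weight it is equivalent
  to the inequality on almost every curve.\<close>

definition interval_gradient :: "real set \<Rightarrow> (real \<Rightarrow> real) \<Rightarrow> (real \<Rightarrow> ennreal) \<Rightarrow> bool" where
  "interval_gradient I u g \<longleftrightarrow>
     (\<forall>a b. a < b \<and> {a..b} \<subseteq> I \<longrightarrow> ennreal \<bar>u b - u a\<bar> \<le> (\<integral>\<^sup>+ x\<in>{a..b}. g x \<partial>lebesgue))"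

lemma primitive_onD:
  assumes "primitive_on I u f" "a \<le> b" "{a..b} \<subseteq> I"
  shows "set_integrable lborel {a..b} f" "u b - u a = (LBINT x:{a..b}. f x)"
proof -
  have "set_integrable lborel {a..a} f"
    unfolding set_integrable_def
  proof (rule integrable_cong_AE_imp)
    show "integrable lborel (\<lambda>_. 0 :: real)" by simp
    show "(\<lambda>x. indicator {a..a} x *\<^sub>R f x) \<in> borel_measurable lborel"
    proof -
      have [measurable]: "f \<in> borel_measurable borel" using assms(1) by (simp add: primitive_on_def)
      show ?thesis by measurable
    qed
    show "AE x in lborel. 0 = indicator {a..a} x *\<^sub>R f x"
      using AE_lborel_singleton[of a] by eventually_elim auto
  qed
  moreover have "(LBINT x:{a..a}. f x) = 0"
    using interval_integral_Icc[of a a f] by simp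
  ultimately show "set_integrable lborel {a..b} f" "u b - u a = (LBINT x:{a..b}. f x)"
    using assms by (cases "a = b"; auto simp: primitive_on_def)+
qed

lemma primitive_on_subset: "primitive_on I u f \<Longrightarrow> J \<subseteq> I \<Longrightarrow> primitive_on J u f"
  unfolding primitive_on_def by blast

lemma primitive_on_add:
  assumes "primitive_on I u f" "primitive_on I v k"
  shows "primitive_on I (\<lambda>x. u x + v x) (\<lambda>x. f x + k x)"
  using assms unfolding primitive_on_def by (auto simp: set_integral_add algebra_simps)

lemma primitive_on_diff:
  assumes "primitive_on I u f" "primitive_on I u k"
  shows "primitive_on I (\<lambda>x. 0) (\<lambda>x. f x - k x)"
  using assms unfolding primitive_on_def by (auto simp: set_integral_diff algebra_simps)

lemma primitive_on_cong_AE: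
  assumes "primitive_on I u f" and [measurable]: "k \<in> borel_measurable borel"
    and "AE x in lborel. x \<in> I \<longrightarrow> f x = k x"
  shows "primitive_on I u k"
  unfolding primitive_on_def
proof (intro conjI allI impI)
  fix a b :: real assume ab: "a < b \<and> {a..b} \<subseteq> I"
  have [measurable]: "f \<in> borel_measurable borel" using assms(1) by (simp add: primitive_on_def)
  have ae: "AE x in lborel. x \<in> {a..b} \<longrightarrow> f x = k x"
    using assms(3) ab by (auto elim!: eventually_mono)
  have "set_integrable lborel {a..b} f" "u b - u a = (LBINT x:{a..b}. f x)"
    using assms(1) ab by (auto simp: primitive_on_def)
  moreover have "set_integrable lborel {a..b} f \<longleftrightarrow> set_integrable lborel {a..b} k"
    by (rule set_integrable_cong_AE) (use ae in auto)
  moreover have "(LBINT x:{a..b}. f x) = (LBINT x:{a..b}. k x)"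
    by (rule set_lebesgue_integral_cong_AE) (use ae in auto)
  ultimately show "set_integrable lborel {a..b} k" "u b - u a = (LBINT x:{a..b}. k x)" by auto
qed simp

lemma primitive_on_gradient:
  assumes "primitive_on I u f"
  shows "interval_gradient I u (\<lambda>x. ennreal \<bar>f x\<bar>)"
  unfolding interval_gradient_def
proof (intro allI impI)
  fix a b :: real assume ab: "a < b \<and> {a..b} \<subseteq> I"
  have [measurable]: "f \<in> borel_measurable borel" using assms by (simp add: primitive_on_def)
  have i: "integrable lborel (\<lambda>x. indicator {a..b} x *\<^sub>R f x)" and e: "u b - u a = (LBINT x:{a..b}. f x)"
    using assms ab by (auto simp: primitive_on_def set_integrable_def)
  have "ennreal \<bar>u b - u a\<bar> \<le> (\<integral>\<^sup>+ x. ennreal (norm (indicator {a..b} x *\<^sub>R f x)) \<partial>lborel)"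
    unfolding e set_lebesgue_integral_def using integral_norm_bound_ennreal[OF i] by simp
  also have "\<dots> = (\<integral>\<^sup>+ x\<in>{a..b}. ennreal \<bar>f x\<bar> \<partial>lebesgue)"
    unfolding nn_integral_completion by (intro nn_integral_cong) (auto split: split_indicator)
  finally show "ennreal \<bar>u b - u a\<bar> \<le> (\<integral>\<^sup>+ x\<in>{a..b}. ennreal \<bar>f x\<bar> \<partial>lebesgue)" .
qed

lemma primitive_on_continuous:
  assumes "primitive_on {a..b} u f"
  shows "continuous_on {a..b} u"
proof (cases "a \<le> b")
  case True
  have i: "set_integrable lborel {a..b} f" using primitive_onD[OF assms True] by simp
  have "continuous_on {a..b} (\<lambda>x. u a + integral {a..x} f)"
    by (intro continuous_intros indefinite_integral_continuous_1 set_borel_integral_eq_integral(1)[OF i])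
  moreover have "u x = u a + integral {a..x} f" if "x \<in> {a..b}" for x
  proof -
    have "{a..x} \<subseteq> {a..b}" using that by auto
    then have j: "set_integrable lborel {a..x} f" "u x - u a = (LBINT y:{a..x}. f y)"
      using that primitive_onD[OF assms, of a x] by auto
    then show ?thesis using set_borel_integral_eq_integral(2)[OF j(1)] by simp
  qed
  ultimately show ?thesis by (metis (no_types, lifting) continuous_on_cong)
qed auto

lemma primitive_on_integral:
  assumes k: "integrable lborel (k :: real \<Rightarrow> real)" and [measurable]: "k \<in> borel_measurable borel"
  shows "primitive_on UNIV (\<lambda>x. LBINT y:{..x}. k y) k"
  unfolding primitive_on_def
proof (intro conjI allI impI)
  have i: "set_integrable lborel A k" if "A \<in> sets borel" for A
    using k that by (auto simp: set_integrable_def integrable_mult_indicator simp del: real_scaleR_def)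
  fix a b :: real assume ab: "a < b \<and> {a..b} \<subseteq> UNIV"
  show "set_integrable lborel {a..b} k" by (rule i) simp
  have "{..b} = {..a} \<union> {a<..b}" using ab by auto
  then have "(LBINT y:{..b}. k y) = (LBINT y:{..a}. k y) + (LBINT y:{a<..b}. k y)"
    by (simp only:) (intro set_integral_Un i, auto)
  moreover have "(LBINT y:{a<..b}. k y) = (LBINT y:{a..b}. k y)"
    using ab interval_integral_Icc[of a b k] interval_integral_Ioc[of a b k] by simp
  ultimately show "(LBINT y:{..b}. k y) - (LBINT y:{..a}. k y) = (LBINT y:{a..b}. k y)" by simp
qed simp

lemma nn_integral_Ioc_eq_Icc:
  "(\<integral>\<^sup>+ x\<in>{c<..d::real}. g x \<partial>lebesgue) = (\<integral>\<^sup>+ x\<in>{c..d}. g x \<partial>lebesgue)"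
  unfolding nn_integral_completion
  by (rule nn_integral_cong_AE)
    (use AE_lborel_singleton[of c] in \<open>auto elim!: eventually_mono split: split_indicator\<close>)

text \<open>The positive and the negative part of \<open>f - k\<close> on \<open>[a,b]\<close> are densities of measures that agree
  on all half-lines.\<close>

lemma AE_primitive_unique:
  assumes "primitive_on {a..b} u f" "primitive_on {a..b} u k"
  shows "AE x in lborel. x \<in> {a..b} \<longrightarrow> f x = k x"
proof (cases "a < b")
  case False
  then show ?thesis using AE_lborel_singleton[of a] by (auto elim!: eventually_mono)
next
  case True
  define h where "h x = indicator {a..b} x * (f x - k x)" for x
  have p: "primitive_on {a..b} (\<lambda>x. 0) (\<lambda>x. f x - k x)" using primitive_on_diff[OF assms] .
  have [measurable]: "f \<in> borel_measurable borel" "k \<in> borel_measurable borel"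
    using assms by (auto simp: primitive_on_def)
  have [measurable]: "h \<in> borel_measurable borel" unfolding h_def by measurable
  have ih: "integrable lborel h"
    using primitive_onD(1)[OF p, of a b] True by (simp add: h_def[abs_def] set_integrable_def)
  have 0: "(LBINT y:{x<..}. h y) = 0" for x
  proof -
    have "(LBINT y:{x<..}. h y) = (LBINT y:{max a x..b}. f y - k y)"
      unfolding set_lebesgue_integral_def
    proof (rule integral_cong_AE)
      show "AE y in lborel. indicator {x<..} y *\<^sub>R h y = indicator {max a x..b} y *\<^sub>R (f y - k y)"
        using AE_lborel_singleton[of x] by eventually_elim (auto simp: h_def indicator_def)
    qed measurable
    also have "\<dots> = 0"
    proof (cases "max a x \<le> b")
      case True
      have "{max a x..b} \<subseteq> {a..b}" by auto
      then show ?thesis using primitive_onD(2)[OF p True] by simp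
    qed (simp add: set_lebesgue_integral_def)
    finally show ?thesis .
  qed
  define Mp where "Mp = density lborel (\<lambda>x. ennreal (h x))"
  define Mm where "Mm = density lborel (\<lambda>x. ennreal (- h x))"
  have fin: "(\<integral>\<^sup>+ x. ennreal (h x) \<partial>lborel) < top" "(\<integral>\<^sup>+ x. ennreal (- h x) \<partial>lborel) < top"
    using ih real_integrable_def[of lborel h] by (auto simp: less_top)
  have e: "(\<integral>\<^sup>+ y\<in>{x<..}. ennreal (h y) \<partial>lborel) = (\<integral>\<^sup>+ y. ennreal (indicator {x<..} y * h y) \<partial>lborel)"
    "(\<integral>\<^sup>+ y\<in>{x<..}. ennreal (- h y) \<partial>lborel) = (\<integral>\<^sup>+ y. ennreal (- (indicator {x<..} y * h y)) \<partial>lborel)" for x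
    by (auto intro!: nn_integral_cong split: split_indicator)
  have "Mp = Mm"
  proof (rule measure_eqI_lessThan)
    show "emeasure Mp {x<..} < \<infinity>" for x
    proof -
      have "emeasure Mp {x<..} \<le> (\<integral>\<^sup>+ x. ennreal (h x) \<partial>lborel)"
        unfolding Mp_def by (subst emeasure_density) (auto intro!: nn_integral_mono split: split_indicator)
      then show ?thesis using fin by (auto intro: order.strict_trans1)
    qed
    show "emeasure Mp {x<..} = emeasure Mm {x<..}" for x
    proof -
      have i: "integrable lborel (\<lambda>y. indicator {x<..} y * h y)"
        using integrable_mult_indicator[OF _ ih, of "{x<..}"] by simp
      define P where "P = (\<integral>\<^sup>+ y. ennreal (indicator {x<..} y * h y) \<partial>lborel)"
      define Q where "Q = (\<integral>\<^sup>+ y. ennreal (- (indicator {x<..} y * h y)) \<partial>lborel)"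
      have "enn2real P - enn2real Q = 0"
        using real_lebesgue_integral_def[OF i] 0[of x]
        by (simp add: set_lebesgue_integral_def P_def Q_def)
      moreover have "P \<noteq> top" "Q \<noteq> top"
        using i unfolding P_def Q_def by (auto simp: real_integrable_def)
      ultimately have "P = Q" by (cases P; cases Q) auto
      then show ?thesis
        unfolding Mp_def Mm_def P_def Q_def by (simp add: emeasure_density e)
    qed
  qed (auto simp: Mp_def Mm_def)
  then have "AE x in lborel. ennreal (h x) = ennreal (- h x)"
    unfolding Mp_def Mm_def by (subst (asm) finite_density_unique) (use fin in auto)
  then show ?thesis
  proof eventually_elim
    case (elim x)
    then have "h x = 0" by (cases "h x" "0::real" rule: linorder_cases) (auto simp: ennreal_neg ennreal_eq_0_iff)
    then show ?case by (auto simp: h_def)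
  qed
qed

text \<open>This follows from \<open>integrable_interval_gradient_derivative\<close> when \<open>u\<close> is extended by constants
  beyond \<open>a\<close> and \<open>b\<close>.\<close>

lemma interval_gradient_derivative:
  assumes g: "(\<lambda>x. g x * indicator {a..b} x) \<in> borel_measurable lebesgue"
    and fin: "(\<integral>\<^sup>+ x\<in>{a..b}. g x \<partial>lebesgue) < top"
    and grad: "interval_gradient {a..b} u g"
  obtains f where "primitive_on {a..b} u f" "AE x in lborel. x \<in> {a..b} \<longrightarrow> ennreal \<bar>f x\<bar> \<le> g x"
proof -
  obtain g' where [measurable]: "g' \<in> borel_measurable lborel"
    and g': "AE x in lborel. g x * indicator {a..b} x = g' x"
    using completion_ex_borel_measurable[OF g] by auto
  have gg': "(\<integral>\<^sup>+ x\<in>A. g x * indicator {a..b} x \<partial>lborel) = (\<integral>\<^sup>+ x\<in>A. g' x \<partial>lborel)" for A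
    by (rule nn_integral_cong_AE) (use g' in \<open>auto elim!: eventually_mono\<close>)
  define cl where "cl x = max a (min b x)" for x
  obtain f where f: "f \<in> borel_measurable borel" "integrable lborel f"
    "AE x in lborel. ennreal \<bar>f x\<bar> \<le> g' x"
    "\<And>c d. c < d \<Longrightarrow> u (cl d) - u (cl c) = (LBINT x:{c<..d}. f x)"
  proof (rule integrable_interval_gradient_derivative[of g' "\<lambda>x. u (cl x)"])
    show "g' \<in> borel_measurable borel" by simp
    have "(\<integral>\<^sup>+ x. g' x \<partial>lborel) = (\<integral>\<^sup>+ x\<in>{a..b}. g x \<partial>lebesgue)"
      using gg'[of UNIV] by (simp add: nn_integral_completion)
    then show "(\<integral>\<^sup>+ x. g' x \<partial>lborel) < top" using fin by simp
    show "ennreal \<bar>u (cl d) - u (cl c)\<bar> \<le> (\<integral>\<^sup>+ x\<in>{c<..d}. g' x \<partial>lborel)" if "c < d" for c d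
    proof (cases "cl c < cl d")
      case True
      have sub: "{cl c..cl d} \<subseteq> {a..b}" "{cl c<..cl d} \<subseteq> {c<..d}"
        using True by (auto simp: cl_def)
      have "ennreal \<bar>u (cl d) - u (cl c)\<bar> \<le> (\<integral>\<^sup>+ x\<in>{cl c<..cl d}. g x \<partial>lebesgue)"
        using grad True sub(1) unfolding interval_gradient_def nn_integral_Ioc_eq_Icc by blast
      also have "\<dots> = (\<integral>\<^sup>+ x\<in>{cl c<..cl d}. g x \<partial>lborel)" by (rule nn_integral_completion)
      also have "\<dots> \<le> (\<integral>\<^sup>+ x\<in>{c<..d}. g x * indicator {a..b} x \<partial>lborel)"
        using sub by (intro nn_integral_mono) (auto split: split_indicator)
      also have "\<dots> = (\<integral>\<^sup>+ x\<in>{c<..d}. g' x \<partial>lborel)" by (rule gg')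
      finally show ?thesis .
    next
      case False
      then have "cl c = cl d" using that by (auto simp: cl_def)
      then show ?thesis by simp
    qed
  qed blast
  show thesis
  proof (rule that[of f])
    show "primitive_on {a..b} u f"
      unfolding primitive_on_def
    proof (intro conjI allI impI f(1))
      fix c d :: real assume cd: "c < d \<and> {c..d} \<subseteq> {a..b}"
      show "set_integrable lborel {c..d} f"
        unfolding set_integrable_def by (intro integrable_mult_indicator f) auto
      have "cl c = c" "cl d = d" using cd by (auto simp: cl_def)
      then show "u d - u c = (LBINT x:{c..d}. f x)"
        using f(4)[of c d] cd interval_integral_Icc[of c d f] interval_integral_Ioc[of c d f] by simp
    qed
    show "AE x in lborel. x \<in> {a..b} \<longrightarrow> ennreal \<bar>f x\<bar> \<le> g x"
      using f(3) g' by eventually_elim (auto split: split_indicator_asm)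
  qed
qed

text \<open>This minimality of \<open>|f|\<close> among all gradients of \<open>u\<close> comes from uniqueness: a gradient \<open>g\<close>
  yields some derivative that it dominates, and that derivative is \<open>f\<close>.\<close>

lemma AE_derivative_le_gradient:
  assumes f: "primitive_on {a..b} u f"
    and g: "(\<lambda>x. g x * indicator {a..b} x) \<in> borel_measurable lebesgue"
    and fin: "(\<integral>\<^sup>+ x\<in>{a..b}. g x \<partial>lebesgue) < top"
    and grad: "interval_gradient {a..b} u g"
  shows "AE x in lborel. x \<in> {a..b} \<longrightarrow> ennreal \<bar>f x\<bar> \<le> g x"
proof -
  obtain k where k: "primitive_on {a..b} u k" "AE x in lborel. x \<in> {a..b} \<longrightarrow> ennreal \<bar>k x\<bar> \<le> g x"
    using interval_gradient_derivative[OF g fin grad] .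
  show ?thesis
    using AE_primitive_unique[OF f k(1)] k(2) by eventually_elim auto
qed

text \<open>By minimality of \<open>|k|\<close> it suffices that \<open>|k|\<close>, set to \<open>0\<close> on the zeros of \<open>u\<close>, still is a
  gradient of \<open>u\<close>.  For a segment that meets the zero set this follows by passing from its left end
  to the first zero and from the last zero to its right end, since \<open>u\<close> is \<open>0\<close> at both.\<close>

lemma AE_derivative_zero_on_zeros:
  assumes k: "primitive_on {a..b} u k"
  shows "AE x in lborel. x \<in> {a..b} \<longrightarrow> u x = 0 \<longrightarrow> k x = 0"
proof (cases "a \<le> b")
  case True
  have [measurable]: "k \<in> borel_measurable borel" using k by (simp add: primitive_on_def)
  have cont: "continuous_on {a..b} u" using primitive_on_continuous[OF k] .
  define Z where "Z = {x\<in>{a..b}. u x = 0}"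
  have cZ: "closed Z" unfolding Z_def
    using continuous_closed_preimage[OF cont, of "{0}"] by (simp add: vimage_def Int_def conj_commute)
  then have [measurable]: "Z \<in> sets borel" by (rule borel_closed)
  define g where "g x = ennreal \<bar>k x\<bar> * indicator (- Z) x" for x
  have ki: "set_integrable lborel {a..b} k" using primitive_onD[OF k True] by simp
  have grad: "interval_gradient {a..b} u g"
    unfolding interval_gradient_def
  proof (intro allI impI)
    fix c d assume cd: "c < d \<and> {c..d} \<subseteq> {a..b}"
    have step: "ennreal \<bar>u y - u x\<bar> \<le> (\<integral>\<^sup>+ t\<in>{x..y}. g t \<partial>lborel)"
      if "x \<le> y" "{x..y} \<subseteq> {a..b}" "{x<..<y} \<inter> Z = {}" for x y
    proof (cases "x = y")
      case False
      with that have "x < y" by simp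
      then have "ennreal \<bar>u y - u x\<bar> \<le> (\<integral>\<^sup>+ t\<in>{x..y}. ennreal \<bar>k t\<bar> \<partial>lborel)"
        using primitive_on_gradient[OF k] that by (simp add: interval_gradient_def nn_integral_completion)
      also have "\<dots> = (\<integral>\<^sup>+ t\<in>{x..y}. g t \<partial>lborel)"
      proof (rule nn_integral_cong_AE)
        show "AE t in lborel. ennreal \<bar>k t\<bar> * indicator {x..y} t = g t * indicator {x..y} t"
          using AE_lborel_singleton[of x] AE_lborel_singleton[of y]
        proof eventually_elim
          case (elim t)
          have "t \<notin> Z" if t: "t \<in> {x..y}"
          proof -
            have "t \<in> {x<..<y}" using t elim by auto
            then show ?thesis using \<open>{x<..<y} \<inter> Z = {}\<close> by blast
          qed
          then show ?case by (auto simp: g_def indicator_def)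
        qed
      qed
      finally show ?thesis .
    qed simp
    show "ennreal \<bar>u d - u c\<bar> \<le> (\<integral>\<^sup>+ x\<in>{c..d}. g x \<partial>lebesgue)"
    proof (cases "{c..d} \<inter> Z = {}")
      case True
      moreover have "{c<..<d} \<subseteq> {c..d}" by auto
      ultimately have "{c<..<d} \<inter> Z = {}" by blast
      then show ?thesis using step[of c d] cd by (auto simp: nn_integral_completion)
    next
      case False
      have comp: "compact ({c..d} \<inter> Z)" using cZ by (simp add: compact_Int_closed)
      obtain s where s: "s \<in> {c..d} \<inter> Z" "\<And>t. t \<in> {c..d} \<inter> Z \<Longrightarrow> s \<le> t"
        using compact_attains_inf[OF comp False] by auto
      obtain e where e: "e \<in> {c..d} \<inter> Z" "\<And>t. t \<in> {c..d} \<inter> Z \<Longrightarrow> t \<le> e"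
        using compact_attains_sup[OF comp False] by auto
      have se: "s \<le> e" using s(1) e(2) by auto
      have u0: "u s = 0" "u e = 0" using s e by (auto simp: Z_def)
      have A: "ennreal \<bar>u s - u c\<bar> \<le> (\<integral>\<^sup>+ t\<in>{c..s}. g t \<partial>lborel)"
      proof (rule step)
        have "t \<notin> Z" if "t \<in> {c<..<s}" for t
          using s(2)[of t] that s(1) by force
        then show "{c<..<s} \<inter> Z = {}" by blast
      qed (use s cd in auto)
      have B: "ennreal \<bar>u d - u e\<bar> \<le> (\<integral>\<^sup>+ t\<in>{e..d}. g t \<partial>lborel)"
      proof (rule step)
        have "t \<notin> Z" if "t \<in> {e<..<d}" for t
          using e(2)[of t] that e(1) by force
        then show "{e<..<d} \<inter> Z = {}" by blast
      qed (use e cd in auto)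
      have "ennreal \<bar>u d - u c\<bar> \<le> ennreal (\<bar>u s - u c\<bar> + \<bar>u d - u e\<bar>)"
        using u0 by (intro ennreal_leI) auto
      also have "\<dots> \<le> (\<integral>\<^sup>+ t\<in>{c..s}. g t \<partial>lborel) + (\<integral>\<^sup>+ t\<in>{e..d}. g t \<partial>lborel)"
        using A B by (simp add: add_mono)
      also have "\<dots> = (\<integral>\<^sup>+ t. g t * indicator {c..s} t + g t * indicator {e..d} t \<partial>lborel)"
        by (rule nn_integral_add[symmetric]) (auto simp: g_def)
      also have "\<dots> \<le> (\<integral>\<^sup>+ t\<in>{c..d}. g t \<partial>lborel)"
      proof (rule nn_integral_mono_AE)
        show "AE t in lborel. g t * indicator {c..s} t + g t * indicator {e..d} t \<le> g t * indicator {c..d} t"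
          using AE_lborel_singleton[of s]
        proof eventually_elim
          case (elim t)
          have "c \<le> s" "e \<le> d" using s(1) e(1) by auto
          then show ?case using elim se by (auto simp: indicator_def)
        qed
      qed
      finally show ?thesis by (simp add: nn_integral_completion)
    qed
  qed
  have fin: "(\<integral>\<^sup>+ x\<in>{a..b}. g x \<partial>lebesgue) < top"
  proof -
    have "(\<integral>\<^sup>+ x\<in>{a..b}. g x \<partial>lborel) \<le> (\<integral>\<^sup>+ x. ennreal (norm (indicator {a..b} x *\<^sub>R k x)) \<partial>lborel)"
      by (intro nn_integral_mono) (auto simp: g_def split: split_indicator)
    also have "\<dots> < top"
      using ki by (simp add: set_integrable_def integrable_iff_bounded)
    finally show ?thesis by (simp add: nn_integral_completion)
  qed
  have "(\<lambda>x. g x * indicator {a..b} x) \<in> borel_measurable borel"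
    unfolding g_def by measurable
  then have "(\<lambda>x. g x * indicator {a..b} x) \<in> borel_measurable lebesgue"
    by (simp add: measurable_completion)
  from AE_derivative_le_gradient[OF k this fin grad] show ?thesis
    by eventually_elim (auto simp: g_def Z_def split: split_indicator_asm)
qed auto

lemma AE_on_open_of_compact_intervals:
  fixes \<Omega> :: "real set"
  assumes "open \<Omega>" and "\<And>a b. a < b \<Longrightarrow> {a..b} \<subseteq> \<Omega> \<Longrightarrow> AE x in lborel. x \<in> {a..b} \<longrightarrow> P x"
  shows "AE x in lborel. x \<in> \<Omega> \<longrightarrow> P x"
proof -
  have "AE x in lborel. \<forall>q\<in>(\<rat> \<times> \<rat>) \<inter> {q. fst q < snd q \<and> {fst q..snd q} \<subseteq> \<Omega>}. x \<in> {fst q..snd q} \<longrightarrow> P x"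
    using assms(2)
    by (intro AE_ball_countable[THEN iffD2])
      (auto intro!: countable_Int1 countable_SIGMA countable_rat simp del: atLeastAtMost_iff)
  then show ?thesis
  proof eventually_elim
    case (elim x)
    show ?case
    proof
      assume "x \<in> \<Omega>"
      then obtain e where e: "e > 0" "ball x e \<subseteq> \<Omega>" using \<open>open \<Omega>\<close> openE by blast
      obtain a where a: "a \<in> \<rat>" "x - e < a" "a < x" using Rats_dense_in_real[of "x - e" x] e by auto
      obtain b where b: "b \<in> \<rat>" "x < b" "b < x + e" using Rats_dense_in_real[of x "x + e"] e by auto
      have "{a..b} \<subseteq> \<Omega>" using a b e by (auto simp: ball_def dist_real_def subset_eq)
      then show "P x" using elim[rule_format, of "(a, b)"] a b by auto
    qed
  qed
qed

section \<open>Curves on the line\<close>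

text \<open>A partition of \<open>[0,s]\<close> can be continued by the points \<open>s\<close> and \<open>t\<close>, so the length up to \<open>t\<close>
  is at least the length up to \<open>s\<close> plus the distance of \<open>\<gamma>(s)\<close> and \<open>\<gamma>(t)\<close>.\<close>

lemma arc_length_curve_Lipschitz:
  assumes \<gamma>: "arc_length_curve E l \<gamma>" and st: "0 \<le> s" "s \<le> t" "t \<le> l"
  shows "\<bar>\<gamma> t - \<gamma> s\<bar> \<le> t - s"
proof -
  have len: "curve_length \<gamma> 0 s = ennreal s" "curve_length \<gamma> 0 t = ennreal t"
    using \<gamma> st by (auto simp: arc_length_curve_def)
  let ?P = "\<lambda>t (n::nat) (\<tau>::nat \<Rightarrow> real). mono_on {..n} \<tau> \<and> \<tau> ` {..n} \<subseteq> {0..t}"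
  have le: "(\<Sum>i<n. dist (\<gamma> (\<tau> i)) (\<gamma> (\<tau> (Suc i)))) \<le> s - (t - s) + 2 * (t - s) - dist (\<gamma> s) (\<gamma> t)"
    if \<tau>: "?P s n \<tau>" for n \<tau>
  proof -
    define \<tau>' where "\<tau>' i = (if i \<le> n then \<tau> i else if i = Suc n then s else t)" for i
    have "?P t (Suc (Suc n)) \<tau>'"
    proof
      show "mono_on {..Suc (Suc n)} \<tau>'"
      proof (rule mono_onI)
        fix i j assume ij: "i \<in> {..Suc (Suc n)}" "j \<in> {..Suc (Suc n)}" "i \<le> j"
        have "\<tau> k \<le> s" if "k \<le> n" for k using \<tau> that by auto
        moreover have "\<tau> i \<le> \<tau> j" if "j \<le> n" using \<tau> that ij by (auto simp: mono_on_def)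
        ultimately show "\<tau>' i \<le> \<tau>' j"
          using ij st by (auto simp: \<tau>'_def intro: order_trans)
      qed
      show "\<tau>' ` {..Suc (Suc n)} \<subseteq> {0..t}"
      proof
        fix y assume "y \<in> \<tau>' ` {..Suc (Suc n)}"
        then obtain i where "y = \<tau>' i" by auto
        moreover have "\<tau> i \<in> {0..s}" if "i \<le> n" using \<tau> that by auto
        ultimately show "y \<in> {0..t}" using st by (auto simp: \<tau>'_def)
      qed
    qed
    then have "ennreal (\<Sum>i<Suc (Suc n). dist (\<gamma> (\<tau>' i)) (\<gamma> (\<tau>' (Suc i)))) \<le> curve_length \<gamma> 0 t"
      unfolding curve_length_def by (intro Sup_upper) blast
    then have "(\<Sum>i<Suc (Suc n). dist (\<gamma> (\<tau>' i)) (\<gamma> (\<tau>' (Suc i)))) \<le> t"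
      using len st by simp
    moreover have "(\<Sum>i<n. dist (\<gamma> (\<tau>' i)) (\<gamma> (\<tau>' (Suc i)))) = (\<Sum>i<n. dist (\<gamma> (\<tau> i)) (\<gamma> (\<tau> (Suc i))))"
      by (intro sum.cong) (auto simp: \<tau>'_def)
    moreover have "0 \<le> dist (\<gamma> (\<tau>' n)) (\<gamma> (\<tau>' (Suc n)))" by (rule zero_le_dist)
    moreover have "dist (\<gamma> (\<tau>' (Suc n))) (\<gamma> (\<tau>' (Suc (Suc n)))) = dist (\<gamma> s) (\<gamma> t)"
      by (simp add: \<tau>'_def)
    ultimately show ?thesis by (simp del: zero_le_dist)
  qed
  have "ennreal s \<le> ennreal (t - dist (\<gamma> s) (\<gamma> t))"
    unfolding len(1)[symmetric] curve_length_def
    by (intro Sup_least) (auto intro!: ennreal_leI dest!: le)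
  moreover have "0 \<le> t - dist (\<gamma> s) (\<gamma> t)"
    using le[of 0 "\<lambda>_. 0"] st by (simp add: mono_on_def)
  ultimately have "s \<le> t - dist (\<gamma> s) (\<gamma> t)" using st by simp
  then show ?thesis by (simp add: dist_real_def abs_minus_commute)
qed

lemma arc_length_curve_segment:
  assumes "a < b" "{a..b} \<subseteq> E"
  shows "arc_length_curve E (b - a) (\<lambda>t. a + t)"
proof -
  have "curve_length (\<lambda>t. a + t) 0 t = ennreal t" if t: "t \<in> {0..b - a}" for t
    unfolding curve_length_def
  proof (rule antisym)
    show "Sup {ennreal (\<Sum>i<n. dist (a + \<tau> i) (a + \<tau> (Suc i))) |n \<tau>. mono_on {..n} \<tau> \<and> \<tau> ` {..n} \<subseteq> {0..t}} \<le> ennreal t"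
    proof (rule Sup_least, clarify, rule ennreal_leI)
      fix n :: nat and \<tau> :: "nat \<Rightarrow> real" assume m: "mono_on {..n} \<tau>" and i: "\<tau> ` {..n} \<subseteq> {0..t}"
      have "(\<Sum>i<n. dist (a + \<tau> i) (a + \<tau> (Suc i))) = (\<Sum>i<n. \<tau> (Suc i) - \<tau> i)"
        by (intro sum.cong refl) (use m in \<open>auto simp: mono_on_def dist_real_def\<close>)
      also have "\<dots> = \<tau> n - \<tau> 0" by (rule sum_lessThan_telescope)
      also have "\<dots> \<le> t"
      proof -
        have "\<tau> n \<in> {0..t}" "\<tau> 0 \<in> {0..t}" using i by auto
        then show ?thesis by simp
      qed
      finally show "(\<Sum>i<n. dist (a + \<tau> i) (a + \<tau> (Suc i))) \<le> t" .
    qed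
    show "ennreal t \<le> Sup {ennreal (\<Sum>i<n. dist (a + \<tau> i) (a + \<tau> (Suc i))) |n \<tau>. mono_on {..n} \<tau> \<and> \<tau> ` {..n} \<subseteq> {0..t}}"
      by (rule Sup_upper, clarify, rule exI[of _ "1::nat"], rule exI[of _ "\<lambda>i. if i = 0 then 0 else t"])
        (use t in \<open>auto simp: mono_on_def dist_real_def\<close>)
  qed
  moreover have "(\<lambda>t. a + t) ` {0..b - a} \<subseteq> E" using assms by auto
  ultimately show ?thesis
    using assms by (auto simp: arc_length_curve_def intro!: continuous_intros)
qed

lemma curve_integral_segment:
  assumes "a < b" and g: "(\<lambda>x. g x * indicator {a..b} x) \<in> borel_measurable lebesgue"
  shows "curve_integral g (b - a) (\<lambda>t. a + t) = (\<integral>\<^sup>+ x\<in>{a..b}. g x \<partial>lebesgue)"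
proof -
  have "(\<integral>\<^sup>+ x\<in>{a..b}. g x \<partial>lebesgue) = (\<integral>\<^sup>+ x. g (a + 1 * x) * indicator {a..b} (a + 1 * x) \<partial>lebesgue)"
    using nn_integral_real_affine_lebesgue[OF g, of 1 a] by simp
  also have "\<dots> = curve_integral g (b - a) (\<lambda>t. a + t)"
    unfolding curve_integral_def by (intro nn_integral_cong) (auto split: split_indicator)
  finally show ?thesis by simp
qed

text \<open>A curve passing over \<open>[x,y]\<close> spends at least the time \<open>y - x\<close> in it: take \<open>t\<close> the first time
  at which the far end is reached and \<open>s\<close> the last time before \<open>t\<close> at the near end.\<close>

lemma ex_crossing_of_interval:
  fixes \<gamma> :: "real \<Rightarrow> real"
  assumes lip: "\<And>s t. 0 \<le> s \<Longrightarrow> s \<le> t \<Longrightarrow> t \<le> l \<Longrightarrow> \<bar>\<gamma> t - \<gamma> s\<bar> \<le> t - s"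
    and cont: "continuous_on {0..l} \<gamma>" and "0 \<le> l"
    and xy: "x < y" "{x..y} \<subseteq> {\<gamma> 0..\<gamma> l} \<or> {x..y} \<subseteq> {\<gamma> l..\<gamma> 0}"
  obtains s t where "0 \<le> s" "s \<le> t" "t \<le> l" "y - x \<le> t - s" "\<gamma> ` {s<..<t} \<subseteq> {x<..<y}"
proof -
  have key: thesis if lip: "\<And>s t. 0 \<le> s \<Longrightarrow> s \<le> t \<Longrightarrow> t \<le> l \<Longrightarrow> \<bar>\<delta> t - \<delta> s\<bar> \<le> t - s"
    and cont: "continuous_on {0..l} \<delta>" and xy: "x < y" "{x..y} \<subseteq> {\<delta> 0..\<delta> l}"
    and im: "\<And>s t. \<delta> ` {s<..<t} \<subseteq> {x<..<y} \<Longrightarrow> 0 \<le> s \<Longrightarrow> t \<le> l \<Longrightarrow> \<gamma> ` {s<..<t} \<subseteq> {x'<..<y'}"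
    and fin: "\<And>s t. 0 \<le> s \<Longrightarrow> s \<le> t \<Longrightarrow> t \<le> l \<Longrightarrow> y - x \<le> t - s \<Longrightarrow> \<gamma> ` {s<..<t} \<subseteq> {x'<..<y'} \<Longrightarrow> thesis"
    for \<delta> :: "real \<Rightarrow> real" and x y x' y' :: real
  proof -
    have b: "\<delta> 0 \<le> x" "y \<le> \<delta> l" using xy by auto
    define T where "T = {t\<in>{0..l}. \<delta> t = y}"
    have cT: "compact T" unfolding T_def
      using continuous_closed_preimage[OF cont, of "{y}"]
      by (intro compact_eq_bounded_closed[THEN iffD2] conjI)
        (auto simp: vimage_def Int_def conj_commute intro: bounded_subset[of "{0..l}"])
    have "\<exists>t\<ge>0. t \<le> l \<and> \<delta> t = y"
      by (rule IVT') (use b xy cont \<open>0 \<le> l\<close> in auto)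
    then have "T \<noteq> {}" by (auto simp: T_def)
    then obtain t where t: "t \<in> T" "\<And>r. r \<in> T \<Longrightarrow> t \<le> r" using compact_attains_inf[OF cT] by auto
    have tl: "0 \<le> t" "t \<le> l" "\<delta> t = y" using t by (auto simp: T_def)
    have cont': "continuous_on {0..t} \<delta>" using cont tl by (auto intro: continuous_on_subset)
    define S where "S = {s\<in>{0..t}. \<delta> s = x}"
    have cS: "compact S" unfolding S_def
      using continuous_closed_preimage[OF cont', of "{x}"]
      by (intro compact_eq_bounded_closed[THEN iffD2] conjI)
        (auto simp: vimage_def Int_def conj_commute intro: bounded_subset[of "{0..t}"])
    have "\<exists>s\<ge>0. s \<le> t \<and> \<delta> s = x"
      by (rule IVT') (use b xy cont' tl in auto)
    then have "S \<noteq> {}" by (auto simp: S_def)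
    then obtain s where s: "s \<in> S" "\<And>r. r \<in> S \<Longrightarrow> r \<le> s" using compact_attains_sup[OF cS] by auto
    have sl: "0 \<le> s" "s \<le> t" "\<delta> s = x" using s by (auto simp: S_def)
    have "\<delta> ` {s<..<t} \<subseteq> {x<..<y}"
    proof
      fix z assume "z \<in> \<delta> ` {s<..<t}"
      then obtain r where r: "z = \<delta> r" "s < r" "r < t" by auto
      have "\<delta> r < y"
      proof (rule ccontr)
        assume "\<not> \<delta> r < y"
        moreover have "continuous_on {0..r} \<delta>" using cont' r by (auto intro: continuous_on_subset)
        ultimately have "\<exists>q\<ge>0. q \<le> r \<and> \<delta> q = y"
          using b xy r sl by (intro IVT') auto
        then obtain q where "0 \<le> q" "q \<le> r" "\<delta> q = y" by auto
        then have "q \<in> T" using r tl by (auto simp: T_def)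
        then show False using t(2)[of q] \<open>q \<le> r\<close> r by simp
      qed
      moreover have "x < \<delta> r"
      proof (rule ccontr)
        assume "\<not> x < \<delta> r"
        moreover have "continuous_on {r..t} \<delta>" using cont' r sl by (auto intro: continuous_on_subset)
        ultimately have "\<exists>q\<ge>r. q \<le> t \<and> \<delta> q = x"
          using xy r tl by (intro IVT') auto
        then obtain q where "r \<le> q" "q \<le> t" "\<delta> q = x" by auto
        then have "q \<in> S" using r sl by (auto simp: S_def)
        then show False using s(2)[of q] \<open>r \<le> q\<close> r by simp
      qed
      ultimately show "z \<in> {x<..<y}" using r by simp
    qed
    then have "\<gamma> ` {s<..<t} \<subseteq> {x'<..<y'}" using sl tl by (intro im) auto
    moreover have "y - x \<le> t - s" using lip[of s t] sl tl by simp
    ultimately show thesis using sl tl fin by blast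
  qed
  show thesis
  proof (cases "{x..y} \<subseteq> {\<gamma> 0..\<gamma> l}")
    case True
    show thesis by (rule key[OF lip cont xy(1) True, of x y]) (use that in auto)
  next
    case False
    then have sub: "{-y..-x} \<subseteq> {- \<gamma> 0.. - \<gamma> l}" using xy by auto
    show thesis
    proof (rule key[where \<delta> = "\<lambda>t. - \<gamma> t" and x = "-y" and y = "-x" and x' = x and y' = y])
      show "\<bar>- \<gamma> t - - \<gamma> s\<bar> \<le> t - s" if "0 \<le> s" "s \<le> t" "t \<le> l" for s t
        using lip[OF that] by simp
      show "continuous_on {0..l} (\<lambda>t. - \<gamma> t)" using cont by (intro continuous_intros)
      show "-y < -x" using xy by simp
      show "{-y..-x} \<subseteq> {- \<gamma> 0.. - \<gamma> l}" by (rule sub)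
      show "\<gamma> ` {s<..<t} \<subseteq> {x<..<y}" if "(\<lambda>t. - \<gamma> t) ` {s<..<t} \<subseteq> {-y<..<-x}" for s t
        using that by (auto simp: image_subset_iff)
      show thesis if "0 \<le> s" "s \<le> t" "t \<le> l" "- x - - y \<le> t - s" "\<gamma> ` {s<..<t} \<subseteq> {x<..<y}" for s t
        using that by (intro \<open>\<And>s t. 0 \<le> s \<Longrightarrow> s \<le> t \<Longrightarrow> t \<le> l \<Longrightarrow> y - x \<le> t - s \<Longrightarrow> \<gamma> ` {s<..<t} \<subseteq> {x<..<y} \<Longrightarrow> thesis\<close>) auto
    qed
  qed
qed

text \<open>The image of arc length under \<open>\<gamma>\<close> dominates Lebesgue measure on \<open>[a,b]\<close>: by the crossing lemma
  on intervals, and then on all Borel sets.  The curve may run back and forth arbitrarily often, so no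
  change of variables is available.\<close>

lemma interval_integral_le_curve_integral:
  assumes \<gamma>: "arc_length_curve E l \<gamma>"
    and ab: "a < b" "(a = \<gamma> 0 \<and> b = \<gamma> l) \<or> (a = \<gamma> l \<and> b = \<gamma> 0)"
    and g: "(\<lambda>x. g x * indicator {a..b} x) \<in> borel_measurable lebesgue"
  shows "(\<integral>\<^sup>+ x\<in>{a..b}. g x \<partial>lebesgue) \<le> curve_integral g l \<gamma>"
proof -
  have l: "0 < l" and cont: "continuous_on {0..l} \<gamma>" using \<gamma> by (auto simp: arc_length_curve_def)
  obtain N g' where N: "N \<in> null_sets lborel" and [measurable]: "g' \<in> borel_measurable lborel"
    and g': "\<And>x. x \<notin> N \<Longrightarrow> g x * indicator {a..b} x = g' x"
  proof -
    obtain g'' where g'': "g'' \<in> borel_measurable lborel" "AE x in lborel. g x * indicator {a..b} x = g'' x"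
      using completion_ex_borel_measurable[OF g] by auto
    then obtain N where "N \<in> null_sets lborel" "{x \<in> space lborel. g x * indicator {a..b} x \<noteq> g'' x} \<subseteq> N"
      unfolding eventually_ae_filter by auto
    then show thesis using g''(1) by (intro that[of N g'']) auto
  qed
  \<comment> \<open>Composition with \<open>\<gamma>\<close> does not obviously respect equality almost everywhere, so \<open>g\<close> is
    replaced by a Borel function that lies below it everywhere and agrees with it almost everywhere.\<close>
  define h where "h x = g' x * indicator ({a..b} - N) x" for x
  have [measurable]: "N \<in> sets borel" using N by auto
  have [measurable]: "h \<in> borel_measurable borel" unfolding h_def by measurable
  have h_le: "h x \<le> g x" for x
    using g'[of x] by (cases "x \<in> N") (auto simp: h_def split: split_indicator split_indicator_asm)
  define \<gamma>' where "\<gamma>' t = (if t \<in> {0..l} then \<gamma> t else 0)" for t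
  have [measurable]: "\<gamma>' \<in> borel_measurable borel"
    unfolding \<gamma>'_def by (rule borel_measurable_continuous_on_if[of "{0..l}"]) (use cont in auto)
  define \<nu> where "\<nu> = distr (density lborel (indicator {0..l})) borel \<gamma>'"
  define \<mu> where "\<mu> = density lborel (indicator {a..b} :: real \<Rightarrow> ennreal)"
  have fi: "finite_measure (density lborel (indicator {c..d} :: real \<Rightarrow> ennreal))" for c d
    by (rule finite_measureI) (simp add: emeasure_density emeasure_lborel_Icc_eq)
  have "finite_measure \<nu>" "finite_measure \<mu>"
    unfolding \<nu>_def \<mu>_def by (auto intro!: fi finite_measure.finite_measure_distr[OF fi])
  then have fb: "finite_borel_measure \<mu>" "finite_borel_measure \<nu>"
    by (auto simp: finite_borel_measure_def finite_borel_measure_axioms_def \<nu>_def \<mu>_def)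
  have e\<nu>: "emeasure \<nu> A = emeasure lborel ({0..l} \<inter> \<gamma>' -` A)" if [measurable]: "A \<in> sets borel" for A
  proof -
    have [measurable]: "\<gamma>' -` A \<in> sets borel" using measurable_sets[of \<gamma>' borel borel A] by simp
    show ?thesis by (simp add: \<nu>_def emeasure_distr emeasure_density flip: indicator_inter_arith)
  qed
  have e\<mu>: "emeasure \<mu> A = emeasure lborel ({a..b} \<inter> A)" if [measurable]: "A \<in> sets borel" for A
    by (simp add: \<mu>_def emeasure_density flip: indicator_inter_arith)
  have le: "emeasure \<mu> {x<..y} \<le> emeasure \<nu> {x<..y}" if "x < y" for x y
  proof -
    define x' y' where "x' = max a x" and "y' = min b y"
    have "emeasure \<mu> {x<..y} \<le> emeasure lborel {x'..y'}"
      unfolding e\<mu>[OF greaterThanAtMost_borel] by (rule emeasure_mono) (auto simp: x'_def y'_def)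
    also have "\<dots> \<le> emeasure \<nu> {x<..y}"
    proof (cases "x' < y'")
      case True
      obtain s t where st: "0 \<le> s" "s \<le> t" "t \<le> l" "y' - x' \<le> t - s" "\<gamma> ` {s<..<t} \<subseteq> {x'<..<y'}"
      proof (rule ex_crossing_of_interval[where \<gamma> = \<gamma> and l = l and x = x' and y = y'])
        show "\<bar>\<gamma> t - \<gamma> s\<bar> \<le> t - s" if "0 \<le> s" "s \<le> t" "t \<le> l" for s t
          by (rule arc_length_curve_Lipschitz[OF \<gamma> that])
        show "{x'..y'} \<subseteq> {\<gamma> 0..\<gamma> l} \<or> {x'..y'} \<subseteq> {\<gamma> l..\<gamma> 0}"
          using ab(2) by (auto simp: x'_def y'_def)
      qed (use cont l True in auto)
      have "emeasure lborel {x'..y'} \<le> emeasure lborel {s<..<t}"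
        using st True by (simp add: ennreal_leI)
      also have "\<dots> \<le> emeasure lborel ({0..l} \<inter> \<gamma>' -` {x<..y})"
      proof (rule emeasure_mono)
        have "\<gamma>' -` {x<..y} \<in> sets borel" using measurable_sets[of \<gamma>' borel borel "{x<..y}"] by simp
        then show "{0..l} \<inter> \<gamma>' -` {x<..y} \<in> sets lborel" by simp
        show "{s<..<t} \<subseteq> {0..l} \<inter> \<gamma>' -` {x<..y}"
          using st by (force simp: \<gamma>'_def image_subset_iff x'_def y'_def)
      qed
      finally show ?thesis by (simp add: e\<nu>)
    qed (simp add: emeasure_lborel_Icc_eq)
    finally show ?thesis .
  qed
  have "(\<integral>\<^sup>+ x\<in>{a..b}. g x \<partial>lebesgue) = (\<integral>\<^sup>+ x\<in>{a..b}. h x \<partial>lborel)"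
    unfolding nn_integral_completion
  proof (rule nn_integral_cong_AE)
    show "AE x in lborel. g x * indicator {a..b} x = h x * indicator {a..b} x"
      using AE_not_in[OF N]
    proof eventually_elim
      case (elim x)
      then show ?case using g'[of x] by (auto simp: h_def indicator_def)
    qed
  qed
  also have "\<dots> = (\<integral>\<^sup>+ x. h x \<partial>\<mu>)"
    unfolding \<mu>_def by (subst nn_integral_density) (auto simp: mult.commute)
  also have "\<dots> \<le> (\<integral>\<^sup>+ x. h x \<partial>\<nu>)"
  proof (rule nn_integral_mono_measure)
    show sets: "sets \<mu> = sets \<nu>" by (simp add: \<mu>_def \<nu>_def)
    have "emeasure \<mu> A \<le> emeasure \<nu> A" if "A \<in> sets \<mu>" for A
      using that by (intro emeasure_le_of_Ioc_le[OF fb le]) (auto simp: \<mu>_def)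
    then show "\<mu> \<le> \<nu>" using le_measure[OF sets] by blast
  qed
  also have "\<dots> = (\<integral>\<^sup>+ t. h (\<gamma>' t) \<partial>density lborel (indicator {0..l}))"
    unfolding \<nu>_def by (rule nn_integral_distr) auto
  also have "\<dots> = (\<integral>\<^sup>+ t\<in>{0..l}. h (\<gamma>' t) \<partial>lborel)"
    by (subst nn_integral_density) (auto simp: mult.commute)
  also have "\<dots> \<le> (\<integral>\<^sup>+ t\<in>{0..l}. g (\<gamma> t) \<partial>lborel)"
    by (intro nn_integral_mono) (auto simp: \<gamma>'_def h_le split: split_indicator)
  finally show ?thesis by (simp add: curve_integral_def nn_integral_completion)
qed

section \<open>Local integrability of the dual weight\<close>

lemma ext_dist_ereal: "ext_dist (ereal x) (ereal y) = ennreal \<bar>x - y\<bar>"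
  by (simp add: ext_dist_def e2ennreal_ereal)

lemma epowr_ennreal: "0 \<le> x \<Longrightarrow> epowr (ennreal x) p = ennreal (x powr p)"
  by (simp add: epowr_def)

text \<open>The segment between the end points of a curve is covered by the curve and contributes at most the
  curve integral.\<close>

lemma weak_upper_gradient_of_interval_gradient:
  assumes g: "g \<in> borel_measurable M"
    and gl: "\<And>a b. a < b \<Longrightarrow> {a..b} \<subseteq> space M \<Longrightarrow> (\<lambda>x. g x * indicator {a..b} x) \<in> borel_measurable lebesgue"
    and grad: "interval_gradient (space M) u g"
    and p: "0 < p"
  shows "weak_upper_gradient M p (\<lambda>x. ereal (u x)) g"
  unfolding weak_upper_gradient_def p_ae_curve_def
\<comment> \<open>No curve is exceptional, as \<open>\<rho> = 0\<close> certifies.\<close>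
proof (intro conjI g bexI[of _ "\<lambda>_. 0"] allI impI)
  show "Lp_integral M p (\<lambda>_. 0) < top" using p by (simp add: Lp_integral_def epowr_def)
  fix l \<gamma>
  assume "arc_length_curve (space M) l \<gamma> \<and> \<not> ext_dist (ereal (u (\<gamma> 0))) (ereal (u (\<gamma> l))) \<le> curve_integral g l \<gamma>"
  then have \<gamma>: "arc_length_curve (space M) l \<gamma>"
    and n: "\<not> ennreal \<bar>u (\<gamma> 0) - u (\<gamma> l)\<bar> \<le> curve_integral g l \<gamma>"
    by (auto simp: ext_dist_ereal)
  define a b where "a = min (\<gamma> 0) (\<gamma> l)" and "b = max (\<gamma> 0) (\<gamma> l)"
  have "ennreal \<bar>u (\<gamma> 0) - u (\<gamma> l)\<bar> \<le> curve_integral g l \<gamma>"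
  proof (cases "\<gamma> 0 = \<gamma> l")
    case False
    then have ab: "a < b" by (auto simp: a_def b_def)
    have "connected (\<gamma> ` {0..l})"
      using \<gamma> by (intro connected_continuous_image) (auto simp: arc_length_curve_def)
    then have "{a..b} \<subseteq> \<gamma> ` {0..l}"
      using \<gamma> by (intro connected_contains_Icc) (auto simp: arc_length_curve_def a_def b_def min_def max_def)
    then have sub: "{a..b} \<subseteq> space M" using \<gamma> by (auto simp: arc_length_curve_def)
    have "ennreal \<bar>u (\<gamma> 0) - u (\<gamma> l)\<bar> = ennreal \<bar>u b - u a\<bar>"
      by (auto simp: a_def b_def min_def max_def abs_minus_commute)
    also have "\<dots> \<le> (\<integral>\<^sup>+ x\<in>{a..b}. g x \<partial>lebesgue)"
      using grad ab sub by (simp add: interval_gradient_def)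
    also have "\<dots> \<le> curve_integral g l \<gamma>"
      by (rule interval_integral_le_curve_integral[OF \<gamma> ab _ gl[OF ab sub]])
        (auto simp: a_def b_def min_def max_def)
    finally show ?thesis .
  qed simp
  with n show "curve_integral (\<lambda>_. 0) l \<gamma> = top" by simp
qed simp

lemma measurable_weighted_measure:
  "f \<in> borel_measurable lebesgue \<Longrightarrow> f \<in> borel_measurable (weighted_measure w)"
  unfolding weighted_measure_def by (intro measurable_completion) simp

lemma nn_integral_weighted_measure:
  assumes [measurable]: "w \<in> borel_measurable borel" "f \<in> borel_measurable borel"
  shows "(\<integral>\<^sup>+ x. f x \<partial>weighted_measure w) = (\<integral>\<^sup>+ x. ennreal (w x) * f x \<partial>lborel)"
proof -
  have "w \<in> borel_measurable lebesgue" "f \<in> borel_measurable lebesgue"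
    by (simp_all add: measurable_completion)
  then show ?thesis
    by (simp add: weighted_measure_def nn_integral_completion nn_integral_density)
qed

lemma space_weighted_measure [simp]: "space (weighted_measure w) = UNIV"
  by (simp add: weighted_measure_def)

lemma sets_weighted_measure: "A \<in> sets borel \<Longrightarrow> A \<in> sets (weighted_measure w)"
  by (simp add: weighted_measure_def)

text \<open>The test function is the primitive \<open>u\<close> of \<open>\<rho> = (w + e)\<^sup>-\<^sup>1\<^sup>/\<^sup>(\<^sup>p\<^sup>-\<^sup>1\<^sup>)\<close> cut off to the middle half of a
  ball.  It is \<open>0\<close> on the left quarter of the ball and equal to \<open>S = \<integral>\<rho>\<close> on the right one, so its
  mean oscillation is at least a fixed multiple of \<open>S\<close>.  On the other side \<open>w \<rho>\<^sup>p \<le> \<rho>\<close>, so that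
  the Poincare inequality reads \<open>S \<le> D S\<^sup>1\<^sup>/\<^sup>p\<close>.  This bounds \<open>S\<close> independently of \<open>e\<close>.  The
  summand \<open>e\<close> only serves to make \<open>S\<close> finite beforehand.\<close>

lemma poincare_dual_weight_bound:
  fixes w :: "real \<Rightarrow> real"
  assumes p: "1 < p" and [measurable]: "w \<in> borel_measurable borel" and w0: "\<And>x. 0 \<le> w x"
    and \<mu>: "\<mu> = weighted_measure w"
    and pos: "positive_finite_on_balls \<mu>" and poin: "local_poincare \<mu> p"
  obtains r D where "0 < r"
    "\<And>e. 0 < e \<Longrightarrow> (\<integral>\<^sup>+ x\<in>{x0-r..x0+r}. ennreal ((w x + e) powr (-1/(p-1))) \<partial>lborel) \<le> ennreal D"
proof -
  define Q where "Q C \<Lambda> x r \<longleftrightarrow> (\<forall>u g. u \<in> borel_measurable (restrict_space \<mu> (ball x (\<Lambda> * r))) \<and>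
      (\<integral>\<^sup>+ y. e2ennreal \<bar>u y\<bar> \<partial>restrict_space \<mu> (ball x (\<Lambda> * r))) < top \<and>
      weak_upper_gradient (restrict_space \<mu> (ball x (\<Lambda> * r))) p u g \<longrightarrow>
      (\<integral>\<^sup>+ y\<in>ball x r. ext_dist (u y) (ereal (ball_average \<mu> u (ball x r))) \<partial>\<mu>) / emeasure \<mu> (ball x r)
        \<le> ennreal (C * r) * epowr (Lp_integral (restrict_space \<mu> (ball x (\<Lambda> * r))) p g
             / emeasure \<mu> (ball x (\<Lambda> * r))) (1 / p))" for C \<Lambda> x r
  have "\<exists>r0>0. \<exists>C>0. \<exists>\<Lambda>\<ge>1. \<forall>x r. 0 < r \<and> ball x r \<subseteq> ball x0 r0 \<longrightarrow> Q C \<Lambda> x r"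
    using poin unfolding local_poincare_def Q_def Let_def by (rule spec)
  then obtain r0 C \<Lambda> where r0: "0 < r0" and C: "0 < C" and \<Lambda>: "1 \<le> \<Lambda>" and Q: "Q C \<Lambda> x0 r0"
    by blast
  define B B' where "B = ball x0 r0" and "B' = ball x0 (\<Lambda> * r0)"
  define M where "M = restrict_space \<mu> B'"
  define L R where "L = ball (x0 - 3*r0/4) (r0/4)" and "R = ball (x0 + 3*r0/4) (r0/4)"
  have [measurable]: "B \<in> sets \<mu>" "B' \<in> sets \<mu>" "L \<in> sets \<mu>" "R \<in> sets \<mu>"
    by (auto simp: B_def B'_def L_def R_def \<mu> intro: sets_weighted_measure)
  have [measurable]: "B' \<in> sets borel" by (simp add: B'_def)
  have \<Lambda>r: "0 < \<Lambda> * r0" using \<Lambda> r0 by simp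
  obtain b where b: "emeasure \<mu> B = ennreal b" "0 < b"
    using pos r0 unfolding positive_finite_on_balls_def B_def by (metis ennreal_cases ennreal_less_zero_iff less_top)
  obtain b' where b': "emeasure \<mu> B' = ennreal b'" "0 < b'"
    using pos \<Lambda>r unfolding positive_finite_on_balls_def B'_def by (metis ennreal_cases ennreal_less_zero_iff less_top)
  obtain \<kappa>L where \<kappa>L: "emeasure \<mu> L = ennreal \<kappa>L" "0 < \<kappa>L"
    using pos r0 unfolding positive_finite_on_balls_def L_def
    by (metis ennreal_cases ennreal_less_zero_iff less_top divide_pos_pos zero_less_numeral)
  obtain \<kappa>R where \<kappa>R: "emeasure \<mu> R = ennreal \<kappa>R" "0 < \<kappa>R"
    using pos r0 unfolding positive_finite_on_balls_def R_def
    by (metis ennreal_cases ennreal_less_zero_iff less_top divide_pos_pos zero_less_numeral)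
  define \<kappa> where "\<kappa> = min \<kappa>L \<kappa>R"
  have \<kappa>: "0 < \<kappa>" using \<kappa>L \<kappa>R by (simp add: \<kappa>_def)
  define D where "D = C * r0 * b / \<kappa> / b' powr (1/p)"
  have D: "0 < D" using C r0 b \<kappa> b' by (simp add: D_def)
  define K where "K = {x0 - r0/2..x0 + r0/2}"
  have KB: "K \<subseteq> B'"
  proof -
    have "K \<subseteq> ball x0 r0" using r0 by (auto simp: K_def ball_def dist_real_def abs_if)
    also have "\<dots> \<subseteq> B'" unfolding B'_def using \<Lambda> r0 by (intro subset_ball) simp
    finally show ?thesis .
  qed
  show thesis
  proof (rule that[of "r0/2" "D powr (p/(p-1))"])
    show "0 < r0/2" using r0 by simp
    fix e :: real assume e: "0 < e"
    define \<rho> where "\<rho> x = indicator K x * (w x + e) powr (-1/(p-1))" for x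
    have [measurable]: "K \<in> sets borel" by (simp add: K_def)
    have [measurable]: "\<rho> \<in> borel_measurable borel" unfolding \<rho>_def by measurable
    have \<rho>0: "0 \<le> \<rho> x" for x by (simp add: \<rho>_def)
    have \<rho>i: "integrable lborel \<rho>"
    proof (rule Bochner_Integration.integrable_bound)
      show "integrable lborel (\<lambda>x. indicator K x * e powr (-1/(p-1)))"
        by (auto simp: K_def emeasure_lborel_Icc_eq intro!: integrable_real_indicator)
      show "AE x in lborel. norm (\<rho> x) \<le> norm (indicator K x * e powr (-1/(p-1)))"
        using p e w0 by (auto simp: \<rho>_def indicator_def intro!: powr_mono2')
    qed simp
    define S where "S = (LBINT x. \<rho> x)"
    have S0: "0 \<le> S" unfolding S_def by (rule integral_nonneg_AE) (simp add: \<rho>0)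
    have S: "(\<integral>\<^sup>+ x. ennreal (\<rho> x) \<partial>lborel) = ennreal S"
      unfolding S_def by (rule nn_integral_eq_integral[OF \<rho>i]) (simp add: \<rho>0)
    define u where "u x = (LBINT y:{..x}. \<rho> y)" for x
    have prim: "primitive_on UNIV u \<rho>"
      unfolding u_def by (rule primitive_on_integral[OF \<rho>i]) simp
    have us: "set_integrable lborel A \<rho>" if "A \<in> sets borel" for A
      using \<rho>i that by (auto simp: set_integrable_def integrable_mult_indicator simp del: real_scaleR_def)
    have umono: "mono u"
    proof (rule monoI)
      show "u x \<le> u y" if "x \<le> y" for x y
        unfolding u_def set_lebesgue_integral_def
        by (intro integral_mono us[unfolded set_integrable_def])
          (use that in \<open>auto simp: \<rho>0 split: split_indicator\<close>)
    qed
    then have [measurable]: "u \<in> borel_measurable borel" by (rule borel_measurable_mono)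
    have u0: "0 \<le> u x" for x
      unfolding u_def set_lebesgue_integral_def by (intro integral_nonneg_AE) (simp add: \<rho>0)
    have uS: "u x \<le> S" for x
      unfolding u_def set_lebesgue_integral_def S_def
      by (intro integral_mono us[unfolded set_integrable_def] \<rho>i) (auto simp: \<rho>0 split: split_indicator)
    have uL: "u x = 0" if "x \<in> L" for x
    proof -
      have "x < x0 - r0/2" using that by (auto simp: L_def ball_def dist_real_def abs_if split: if_splits)
      then have "(LBINT y:{..x}. \<rho> y) = (LBINT y:{..x}. 0)"
        by (intro set_lebesgue_integral_cong) (auto simp: \<rho>_def K_def)
      then show ?thesis by (simp add: u_def set_lebesgue_integral_def)
    qed
    have uR: "u x = S" if "x \<in> R" for x
    proof -
      have "x > x0 + r0/2" using that by (auto simp: R_def ball_def dist_real_def abs_if split: if_splits)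
      then show ?thesis unfolding u_def S_def set_lebesgue_integral_def
        by (intro Bochner_Integration.integral_cong) (auto simp: \<rho>_def K_def split: split_indicator)
    qed
    have spM: "space M = B'" by (simp add: M_def space_restrict_space \<mu>)
    have meas: "f \<in> borel_measurable M" if "f \<in> borel_measurable borel" for f :: "real \<Rightarrow> 'b::topological_space"
      unfolding M_def \<mu> by (intro measurable_restrict_space1 measurable_weighted_measure measurable_completion) (use that in simp)
    have wug: "weak_upper_gradient M p (\<lambda>x. ereal (u x)) (\<lambda>x. ennreal (\<rho> x))"
    proof (rule weak_upper_gradient_of_interval_gradient)
      show "(\<lambda>x. ennreal (\<rho> x)) \<in> borel_measurable M" by (rule meas) measurable
      have "(\<lambda>x. ennreal (\<rho> x) * indicator {c..d} x) \<in> borel_measurable lborel" for c d by measurable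
      then show "(\<lambda>x. ennreal (\<rho> x) * indicator {c..d} x) \<in> borel_measurable lebesgue" for c d
        by (rule measurable_completion)
      show "interval_gradient (space M) u (\<lambda>x. ennreal (\<rho> x))"
        using primitive_on_gradient[OF primitive_on_subset[OF prim subset_UNIV]] \<rho>0 by simp
      show "0 < p" using p by simp
    qed
    have nnM: "(\<integral>\<^sup>+ x. f x \<partial>M) = (\<integral>\<^sup>+ x\<in>B'. f x \<partial>\<mu>)" for f
      unfolding M_def by (rule nn_integral_restrict_space) (simp add: \<mu> sets_weighted_measure)
    have "(\<integral>\<^sup>+ y. e2ennreal \<bar>ereal (u y)\<bar> \<partial>M) \<le> (\<integral>\<^sup>+ y\<in>B'. ennreal S \<partial>\<mu>)"
      unfolding nnM by (intro nn_integral_mono) (auto simp: e2ennreal_ereal u0 uS intro!: ennreal_leI split: split_indicator)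
    also have "\<dots> < top" using b' by (simp add: nn_integral_cmult ennreal_mult_less_top)
    finally have ui: "(\<integral>\<^sup>+ y. e2ennreal \<bar>ereal (u y)\<bar> \<partial>M) < top" .
    define m where "m = ball_average \<mu> (\<lambda>x. ereal (u x)) B"
    have "(\<lambda>x. ereal (u x)) \<in> borel_measurable M" by (rule meas) measurable
    then have P0: "(\<integral>\<^sup>+ y\<in>B. ext_dist (ereal (u y)) (ereal m) \<partial>\<mu>) / emeasure \<mu> B
        \<le> ennreal (C * r0) * epowr (Lp_integral M p (\<lambda>x. ennreal (\<rho> x)) / emeasure \<mu> B') (1 / p)"
      using Q ui wug unfolding Q_def B_def[symmetric] B'_def[symmetric] M_def[symmetric] m_def by blast
    have P1: "(\<integral>\<^sup>+ y\<in>B. ennreal \<bar>u y - m\<bar> \<partial>\<mu>) / ennreal b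
        \<le> ennreal (C * r0) * epowr (Lp_integral M p (\<lambda>x. ennreal (\<rho> x)) / ennreal b') (1 / p)"
      using P0 unfolding ext_dist_ereal b(1) b'(1) .
    have "Lp_integral M p (\<lambda>x. ennreal (\<rho> x)) = (\<integral>\<^sup>+ x. ennreal (w x) * (ennreal (\<rho> x powr p) * indicator B' x) \<partial>lborel)"
      unfolding Lp_integral_def nnM \<mu> epowr_ennreal[OF \<rho>0]
      by (rule nn_integral_weighted_measure) measurable
    also have "\<dots> \<le> (\<integral>\<^sup>+ x. ennreal (\<rho> x) \<partial>lborel)"
    proof (rule nn_integral_mono)
      fix x
      have "w x * \<rho> x powr p \<le> \<rho> x"
      proof (cases "x \<in> K")
        case True
        have we: "0 < w x + e" using w0[of x] e by simp
        have "w x * \<rho> x powr p \<le> (w x + e) * ((w x + e) powr (-1/(p-1))) powr p"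
          using True e by (auto simp: \<rho>_def intro!: mult_right_mono)
        also have "\<dots> = (w x + e) powr (1 + (-1/(p-1)) * p)"
          using we powr_add[of "w x + e" 1 "(-1/(p-1)) * p"] by (simp add: powr_powr)
        also have "1 + (-1/(p-1)) * p = -1/(p-1)" using p by (simp add: field_simps)
        finally show ?thesis using True by (simp add: \<rho>_def)
      qed (simp add: \<rho>_def)
      then have "ennreal (w x * \<rho> x powr p) \<le> ennreal (\<rho> x)" by (rule ennreal_leI)
      then show "ennreal (w x) * (ennreal (\<rho> x powr p) * indicator B' x) \<le> ennreal (\<rho> x)"
        using w0[of x] by (auto simp: ennreal_mult split: split_indicator)
    qed
    also have "\<dots> = ennreal S" by (rule S)
    finally have Lp: "Lp_integral M p (\<lambda>x. ennreal (\<rho> x)) \<le> ennreal S" .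
    then obtain q where q: "Lp_integral M p (\<lambda>x. ennreal (\<rho> x)) = ennreal q" "0 \<le> q" "q \<le> S"
      using S0 by (cases "Lp_integral M p (\<lambda>x. ennreal (\<rho> x))") (auto simp: top_unique)
    have "ennreal (\<kappa> * S) \<le> ennreal (\<bar>m\<bar> * \<kappa>L + \<bar>S - m\<bar> * \<kappa>R)"
    proof (rule ennreal_leI)
      have "\<kappa> * S \<le> \<kappa> * (\<bar>m\<bar> + \<bar>S - m\<bar>)" using \<kappa> by (intro mult_left_mono) auto
      also have "\<dots> = \<bar>m\<bar> * \<kappa> + \<bar>S - m\<bar> * \<kappa>" by (simp add: algebra_simps)
      also have "\<dots> \<le> \<bar>m\<bar> * \<kappa>L + \<bar>S - m\<bar> * \<kappa>R"
        by (intro add_mono mult_left_mono) (auto simp: \<kappa>_def)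
      finally show "\<kappa> * S \<le> \<bar>m\<bar> * \<kappa>L + \<bar>S - m\<bar> * \<kappa>R" .
    qed
    also have "\<dots> = (\<integral>\<^sup>+ y. ennreal \<bar>m\<bar> * indicator L y \<partial>\<mu>) + (\<integral>\<^sup>+ y. ennreal \<bar>S - m\<bar> * indicator R y \<partial>\<mu>)"
      using \<kappa>L \<kappa>R by (simp add: nn_integral_cmult ennreal_mult ennreal_plus[symmetric])
    also have "\<dots> = (\<integral>\<^sup>+ y. ennreal \<bar>m\<bar> * indicator L y + ennreal \<bar>S - m\<bar> * indicator R y \<partial>\<mu>)"
      by (rule nn_integral_add[symmetric]) auto
    also have "\<dots> \<le> (\<integral>\<^sup>+ y\<in>B. ennreal \<bar>u y - m\<bar> \<partial>\<mu>)"
    proof (rule nn_integral_mono)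
      fix y
      have "L \<inter> R = {}" "L \<subseteq> B" "R \<subseteq> B"
        using r0 by (auto simp: L_def R_def B_def ball_def dist_real_def abs_if split: if_splits)
      then show "ennreal \<bar>m\<bar> * indicator L y + ennreal \<bar>S - m\<bar> * indicator R y \<le> ennreal \<bar>u y - m\<bar> * indicator B y"
        using uL[of y] uR[of y] by (cases "y \<in> L"; cases "y \<in> R") auto
    qed
    finally have low: "ennreal (\<kappa> * S) \<le> (\<integral>\<^sup>+ y\<in>B. ennreal \<bar>u y - m\<bar> \<partial>\<mu>)" .
    have "ennreal (\<kappa> * S / b) \<le> (\<integral>\<^sup>+ y\<in>B. ennreal \<bar>u y - m\<bar> \<partial>\<mu>) / ennreal b"
      using divide_right_mono_ennreal[OF low, of "ennreal b"] b \<kappa> S0 by (simp add: divide_ennreal)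
    also have "\<dots> \<le> ennreal (C * r0) * epowr (ennreal q / ennreal b') (1 / p)"
      using P1 q by simp
    also have "\<dots> = ennreal (C * r0 * (q / b') powr (1/p))"
      using q b' C r0 by (simp add: divide_ennreal epowr_ennreal ennreal_mult)
    finally have "\<kappa> * S / b \<le> C * r0 * (q / b') powr (1/p)"
      using C r0 by (simp add: ennreal_le_iff)
    also have "\<dots> \<le> C * r0 * (S / b') powr (1/p)"
      using q b' C r0 p by (intro mult_left_mono powr_mono2 divide_right_mono) auto
    also have "\<dots> = D * \<kappa> / b * S powr (1/p)"
      using q b' S0 \<kappa> b by (simp add: D_def powr_divide field_simps)
    finally have SD: "S \<le> D * S powr (1/p)"
      using \<kappa> b by (simp add: field_simps)
    have "S \<le> D powr (p/(p-1))"
    proof (cases "S = 0")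
      case False
      with S0 have Sp: "0 < S" by simp
      have "S powr (1 - 1/p) \<le> D"
        using SD Sp by (simp add: powr_diff divide_le_eq mult.commute)
      then have "(S powr (1 - 1/p)) powr (p/(p-1)) \<le> D powr (p/(p-1))"
        using p by (intro powr_mono2) auto
      moreover have "(S powr (1 - 1/p)) powr (p/(p-1)) = S"
      proof -
        have "(1 - 1/p) * (p/(p-1)) = 1" using p by (simp add: field_simps)
        then show ?thesis using Sp by (simp only: powr_powr) simp
      qed
      ultimately show ?thesis by simp
    qed simp
    then have "ennreal S \<le> ennreal (D powr (p/(p-1)))" by (rule ennreal_leI)
    also have "ennreal S = (\<integral>\<^sup>+ x\<in>{x0 - r0/2..x0 + r0/2}. ennreal ((w x + e) powr (-1/(p-1))) \<partial>lborel)"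
      unfolding S[symmetric] by (intro nn_integral_cong) (auto simp: \<rho>_def K_def split: split_indicator)
    finally show "(\<integral>\<^sup>+ x\<in>{x0 - r0/2..x0 + r0/2}. ennreal ((w x + e) powr (-1/(p-1))) \<partial>lborel) \<le> ennreal (D powr (p/(p-1)))" .
  qed
qed

lemma completion_completion: "completion (completion M) = completion M"
proof (rule measure_eqI)
  show sets: "sets (completion (completion M)) = sets (completion M)"
  proof
    show "sets (completion (completion M)) \<subseteq> sets (completion M)"
    proof
      fix A assume "A \<in> sets (completion (completion M))"
      then obtain S N N' where A: "A = S \<union> N" "S \<in> sets (completion M)" "N \<subseteq> N'" "N' \<in> null_sets (completion M)"
        by (rule sets_completionE)
      then have "N \<in> null_sets (completion M)" using completion.complete2 by blast
      then show "A \<in> sets (completion M)" using A by auto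
    qed
  qed auto
  fix A assume "A \<in> sets (completion (completion M))"
  then show "emeasure (completion (completion M)) A = emeasure (completion M) A"
    unfolding sets by simp
qed

lemma weighted_measure_cong_AE:
  assumes "w \<in> borel_measurable lebesgue" "w' \<in> borel_measurable lebesgue" "AE x in lborel. w x = w' x"
  shows "weighted_measure w = weighted_measure w'"
proof -
  have "density lebesgue (\<lambda>x. ennreal (w x)) = density lebesgue (\<lambda>x. ennreal (w' x))"
    by (rule density_cong) (use assms in \<open>auto intro: AE_completion\<close>)
  then show ?thesis by (simp add: weighted_measure_def)
qed

text \<open>The null sets of \<open>w dx\<close> are those of Lebesgue measure if \<open>w\<close> is positive, hence the completion
  adds nothing to the Lebesgue sets.\<close>

lemma weighted_measure_eq_density:
  assumes [measurable]: "w \<in> borel_measurable borel" and pos: "\<And>x. 0 < w x"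
  shows "weighted_measure w = density lebesgue (\<lambda>x. ennreal (w x))"
proof -
  have e: "density lebesgue (\<lambda>x. ennreal (w x)) = completion (density lborel (\<lambda>x. ennreal (w x)))"
    by (rule completion_density_eq[symmetric]) (use pos in auto)
  show ?thesis
    unfolding weighted_measure_def e by (rule completion_completion)
qed

lemma nn_integral_Icc_finite_of_local:
  assumes [measurable]: "f \<in> borel_measurable lebesgue"
    and loc: "\<And>x. x \<in> {a..b::real} \<Longrightarrow> \<exists>r>0. (\<integral>\<^sup>+ y\<in>ball x r. f y \<partial>lebesgue) < top"
  shows "(\<integral>\<^sup>+ y\<in>{a..b}. f y \<partial>lebesgue) < top"
proof -
  obtain r where r: "\<And>x. x \<in> {a..b} \<Longrightarrow> 0 < r x \<and> (\<integral>\<^sup>+ y\<in>ball x (r x). f y \<partial>lebesgue) < top"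
    using loc by metis
  obtain C where C: "C \<subseteq> {a..b}" "finite C" "{a..b} \<subseteq> (\<Union>c\<in>C. ball c (r c))"
  proof (rule compactE_image[of "{a..b}" "{a..b}" "\<lambda>c. ball c (r c)"])
    show "{a..b} \<subseteq> (\<Union>c\<in>{a..b}. ball c (r c))"
    proof
      fix x assume "x \<in> {a..b}"
      then show "x \<in> (\<Union>c\<in>{a..b}. ball c (r c))" using r[of x] by (intro UN_I[of x]) auto
    qed
  qed auto
  have "(\<integral>\<^sup>+ y\<in>{a..b}. f y \<partial>lebesgue) \<le> (\<integral>\<^sup>+ y. (\<Sum>c\<in>C. f y * indicator (ball c (r c)) y) \<partial>lebesgue)"
  proof (rule nn_integral_mono)
    fix y
    show "f y * indicator {a..b} y \<le> (\<Sum>c\<in>C. f y * indicator (ball c (r c)) y)"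
    proof (cases "y \<in> {a..b}")
      case True
      then obtain c where c: "c \<in> C" "y \<in> ball c (r c)" using C by blast
      then have "f y * indicator {a..b} y \<le> f y * indicator (ball c (r c)) y" by (auto split: split_indicator)
      also have "\<dots> \<le> (\<Sum>c\<in>C. f y * indicator (ball c (r c)) y)"
        using C c by (intro member_le_sum) auto
      finally show ?thesis .
    qed simp
  qed
  also have "\<dots> = (\<Sum>c\<in>C. \<integral>\<^sup>+ y\<in>ball c (r c). f y \<partial>lebesgue)"
    by (rule nn_integral_sum) (auto intro!: borel_measurable_times_ennreal borel_measurable_indicator)
  also have "\<dots> < top"
    using C r by (subst ennreal_sum_less_top) auto
  finally show ?thesis .
qed

text \<open>Let \<open>e\<close> tend to \<open>0\<close> in the preceding bound.  The limit of the integrands is infinite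
  where \<open>w\<close> vanishes, so \<open>w\<close> is positive almost everywhere.\<close>

lemma poincare_dual_weight_integrable:
  fixes w :: "real \<Rightarrow> real"
  assumes p: "1 < p" and [measurable]: "w \<in> borel_measurable borel" and w0: "\<And>x. 0 \<le> w x"
    and \<mu>: "\<mu> = weighted_measure w"
    and pos: "positive_finite_on_balls \<mu>" and poin: "local_poincare \<mu> p"
  shows "AE x in lborel. 0 < w x"
    and "(\<integral>\<^sup>+ x\<in>{a..b}. ennreal (w x powr (-1/(p-1))) \<partial>lborel) < top"
proof -
  define q where "q = -1/(p-1)"
  have q: "q < 0" using p by (simp add: q_def)
  define s where "s n x = ennreal ((w x + 1 / Suc n) powr q)" for n x
  have [measurable]: "s n \<in> borel_measurable borel" for n unfolding s_def by measurable
  define S where "S x = (SUP n. s n x)" for x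
  have [measurable]: "S \<in> borel_measurable borel" unfolding S_def by measurable
  have inc: "incseq s"
  proof (intro incseq_SucI le_funI)
    fix n x
    have "(w x + 1 / Suc n) powr q \<le> (w x + 1 / Suc (Suc n)) powr q"
      using q w0[of x] by (intro powr_mono2') (auto simp: frac_le intro!: add_nonneg_pos)
    then show "s n x \<le> s (Suc n) x" unfolding s_def by (rule ennreal_leI)
  qed
  have loc: "\<exists>r>0. (\<integral>\<^sup>+ y\<in>ball x r. S y \<partial>lborel) < top" for x
  proof -
    obtain r D where r: "0 < r" and D: "\<And>e. 0 < e \<Longrightarrow>
        (\<integral>\<^sup>+ y\<in>{x-r..x+r}. ennreal ((w y + e) powr (-1/(p-1))) \<partial>lborel) \<le> ennreal D"
      using poincare_dual_weight_bound[OF p _ w0 \<mu> pos poin, of x] by auto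
    have "(\<integral>\<^sup>+ y\<in>ball x r. S y \<partial>lborel) \<le> (\<integral>\<^sup>+ y. (SUP n. s n y * indicator {x-r..x+r} y) \<partial>lborel)"
      by (intro nn_integral_mono)
        (auto simp: S_def ball_def dist_real_def SUP_mult_right_ennreal[symmetric] split: split_indicator)
    also have "\<dots> = (SUP n. \<integral>\<^sup>+ y\<in>{x-r..x+r}. s n y \<partial>lborel)"
      by (rule nn_integral_monotone_convergence_SUP)
        (use inc in \<open>auto simp: incseq_def le_fun_def intro!: mult_right_mono\<close>)
    also have "\<dots> \<le> ennreal D"
      unfolding s_def q_def by (intro SUP_least D) simp
    also have "\<dots> < top" by simp
    finally show ?thesis using r by blast
  qed
  have S_int: "(\<integral>\<^sup>+ x\<in>{a..b}. S x \<partial>lborel) < top" for a b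
    using nn_integral_Icc_finite_of_local[of S a b] loc by (simp add: nn_integral_completion measurable_completion)
  have "AE x in lborel. x \<in> {a..b} \<longrightarrow> S x \<noteq> top" for a b
  proof -
    have "AE x in lborel. S x * indicator {a..b} x \<noteq> \<infinity>"
      using S_int[of a b] by (intro nn_integral_PInf_AE) auto
    then show ?thesis by eventually_elim (auto split: split_indicator_asm)
  qed
  then have fin: "AE x in lborel. S x \<noteq> top"
    using AE_on_open_of_compact_intervals[of UNIV "\<lambda>x. S x \<noteq> top"] by auto
  have S_pos: "0 < w x" if nt: "S x \<noteq> top" for x
  proof (rule ccontr)
    assume "\<not> 0 < w x"
    then have w: "w x = 0" using w0[of x] by simp
    obtain B where B: "S x = ennreal B" "0 \<le> B" using nt by (cases "S x") auto
    obtain n :: nat where n: "max 1 B powr (1 / - q) < real n" using reals_Archimedean2 by blast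
    have "max 1 B = (max 1 B powr (1 / - q)) powr (- q)" using q by (simp add: powr_powr)
    also have "\<dots> < real (Suc n) powr (- q)" using n q by (intro powr_less_mono2) auto
    also have "\<dots> = (1 / Suc n) powr q"
      by (simp add: powr_minus powr_divide field_simps)
    finally have "ennreal B < s n x"
      by (auto simp: s_def w ennreal_less_iff B)
    also have "s n x \<le> S x" unfolding S_def by (rule SUP_upper) simp
    finally show False using B by simp
  qed
  show "AE x in lborel. 0 < w x" using fin by eventually_elim (rule S_pos)
  have le: "ennreal (w x powr q) \<le> S x" if "0 < w x" for x
  proof -
    have "(\<lambda>n. (w x + 1 / Suc n) powr q) \<longlonglongrightarrow> (w x + 0) powr q"
      using that by (intro tendsto_powr tendsto_add tendsto_const LIMSEQ_Suc[OF lim_1_over_n]) auto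
    then have "(\<lambda>n. s n x) \<longlonglongrightarrow> ennreal (w x powr q)"
      unfolding s_def by (simp add: tendsto_ennrealI)
    then show ?thesis
      unfolding S_def by (rule LIMSEQ_le_const2) (intro exI[of _ 0] allI impI SUP_upper UNIV_I)
  qed
  have "AE x in lborel. ennreal (w x powr q) * indicator {a..b} x \<le> S x * indicator {a..b} x"
    using fin by eventually_elim (auto intro!: le S_pos split: split_indicator)
  then have "(\<integral>\<^sup>+ x\<in>{a..b}. ennreal (w x powr q) \<partial>lborel) \<le> (\<integral>\<^sup>+ x\<in>{a..b}. S x \<partial>lborel)"
    by (rule nn_integral_mono_AE)
  then show "(\<integral>\<^sup>+ x\<in>{a..b}. ennreal (w x powr (-1/(p-1))) \<partial>lborel) < top"
    using S_int[of a b] by (simp add: q_def order.strict_trans1)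
qed

text \<open>The consequences of the local assumptions that the rest of the proof uses.  The representative of
  the weight can be chosen Borel and positive everywhere, since a change on a Lebesgue null set
  does not affect \<open>\<mu>\<close>.\<close>

locale weighted_line =
  fixes p :: real and w :: "real \<Rightarrow> real" and \<mu> :: "real measure"
  assumes p: "1 < p"
    and w_measurable [measurable]: "w \<in> borel_measurable borel"
    and w_pos: "\<And>x. 0 < w x"
    and \<mu>: "\<mu> = density lebesgue (\<lambda>x. ennreal (w x))"
    and w_int: "\<And>a b. (\<integral>\<^sup>+ x\<in>{a..b}. ennreal (w x) \<partial>lborel) < top"
    and dual_int: "\<And>a b. (\<integral>\<^sup>+ x\<in>{a..b}. ennreal (w x powr (-1/(p-1))) \<partial>lborel) < top"

lemma weight_borel_measurable:
  assumes "weight w"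
  shows "w \<in> borel_measurable lebesgue"
proof (rule borel_measurable_LIMSEQ_real)
  show "(\<lambda>n. indicator {-real n..real n} x * w x) \<longlonglongrightarrow> w x" for x
  proof (rule tendsto_eventually)
    obtain N :: nat where "\<bar>x\<bar> \<le> real N" using real_arch_simple by blast
    then show "\<forall>\<^sub>F n in sequentially. indicator {-real n..real n} x * w x = w x"
      by (intro eventually_sequentiallyI[of N]) (auto split: split_indicator)
  qed
  show "(\<lambda>x. indicator {-real n..real n} x * w x) \<in> borel_measurable lebesgue" for n
  proof -
    have "set_integrable lebesgue {-real n..real n} w"
      using assms compact_Icc unfolding weight_def by blast
    then show ?thesis
      using borel_measurable_integrable[of lebesgue "\<lambda>x. indicator {-real n..real n} x *\<^sub>R w x"]
      by (simp add: set_integrable_def)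
  qed
qed

lemma weighted_line_of_poincare:
  assumes p: "1 < p" and w: "weight w" and \<mu>: "\<mu> = weighted_measure w"
    and pos: "positive_finite_on_balls \<mu>" and poin: "local_poincare \<mu> p"
  obtains w' where "weighted_line p w' \<mu>"
proof -
  have wl: "w \<in> borel_measurable lebesgue" by (rule weight_borel_measurable[OF w])
  obtain w1 where [measurable]: "w1 \<in> borel_measurable lborel" and w1: "AE x in lborel. w x = w1 x"
    using completion_ex_borel_measurable_real[OF wl] by auto
  define w2 where "w2 x = max 0 (w1 x)" for x
  have [measurable]: "w2 \<in> borel_measurable borel" unfolding w2_def by measurable
  have w2: "AE x in lborel. w x = w2 x"
    using w1
  proof eventually_elim
    case (elim x)
    moreover have "0 \<le> w x" using w by (simp add: weight_def)
    ultimately show ?case by (simp add: w2_def)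
  qed
  have w20: "0 \<le> w2 x" for x by (simp add: w2_def)
  have \<mu>2: "\<mu> = weighted_measure w2"
    unfolding \<mu> by (rule weighted_measure_cong_AE[OF wl _ w2]) (simp add: measurable_completion)
  note dual = poincare_dual_weight_integrable[OF p _ w20 \<mu>2 pos poin]
  define w3 where "w3 x = (if 0 < w2 x then w2 x else 1)" for x
  have [measurable]: "w3 \<in> borel_measurable borel" unfolding w3_def by measurable
  have w3: "AE x in lborel. w2 x = w3 x"
    using dual(1) by (auto simp: w3_def elim!: eventually_mono)
  have pos3: "0 < w3 x" for x by (simp add: w3_def)
  have \<mu>3: "\<mu> = weighted_measure w3"
    unfolding \<mu>2 by (rule weighted_measure_cong_AE[OF _ _ w3]) (simp_all add: measurable_completion)
  have "weighted_line p w3 \<mu>"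
  proof
    show "\<mu> = density lebesgue (\<lambda>x. ennreal (w3 x))"
      unfolding \<mu>3 by (rule weighted_measure_eq_density[OF _ pos3]) simp
    show "(\<integral>\<^sup>+ x\<in>{a..b}. ennreal (w3 x) \<partial>lborel) < top" for a b
    proof -
      have "(\<integral>\<^sup>+ x\<in>{a..b}. ennreal (w3 x) \<partial>lborel) = (\<integral>\<^sup>+ x. indicator {a..b} x \<partial>\<mu>)"
        unfolding \<mu>3 by (subst nn_integral_weighted_measure) auto
      also have "\<dots> \<le> (\<integral>\<^sup>+ x. indicator (ball 0 (\<bar>a\<bar> + \<bar>b\<bar> + 1)) x \<partial>\<mu>)"
        by (intro nn_integral_mono) (auto simp: ball_def dist_real_def split: split_indicator)
      also have "\<dots> = emeasure \<mu> (ball 0 (\<bar>a\<bar> + \<bar>b\<bar> + 1))"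
        by (rule nn_integral_indicator) (simp add: \<mu> sets_weighted_measure)
      also have "\<dots> < top" using pos unfolding positive_finite_on_balls_def by simp
      finally show ?thesis .
    qed
    show "(\<integral>\<^sup>+ x\<in>{a..b}. ennreal (w3 x powr (-1/(p-1))) \<partial>lborel) < top" for a b
    proof -
      have "(\<integral>\<^sup>+ x\<in>{a..b}. ennreal (w3 x powr (-1/(p-1))) \<partial>lborel) = (\<integral>\<^sup>+ x\<in>{a..b}. ennreal (w2 x powr (-1/(p-1))) \<partial>lborel)"
        by (rule nn_integral_cong_AE) (use w3 in \<open>auto elim!: eventually_mono\<close>)
      then show ?thesis using dual(2)[of a b] by simp
    qed
  qed (use p pos3 in auto)
  then show thesis by (rule that)
qed

section \<open>Minimal weak upper gradients for a locally integrable dual weight\<close>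

lemma epowr_mono: "a \<le> b \<Longrightarrow> 0 < p \<Longrightarrow> epowr a p \<le> epowr b p"
  by (cases a; cases b) (auto simp: epowr_def top_unique intro!: powr_mono2 ennreal_leI)

lemma measurable_epowr [measurable (raw)]:
  assumes f [measurable]: "f \<in> borel_measurable M"
  shows "(\<lambda>x. epowr (f x) p) \<in> borel_measurable M"
proof -
  have [measurable]: "Measurable.pred M (\<lambda>x. f x = top)"
    using measurable_sets[OF f, of "{top}"] by (simp add: pred_def vimage_def Int_def conj_commute)
  have [measurable]: "(\<lambda>x. ennreal (enn2real (f x) powr p)) \<in> borel_measurable M"
    by measurable
  show ?thesis unfolding epowr_def by measurable
qed

context weighted_line
begin

definition \<sigma> :: "real \<Rightarrow> real" where "\<sigma> x = w x powr (-1/(p-1))"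

lemma \<sigma>_measurable [measurable]: "\<sigma> \<in> borel_measurable borel"
  unfolding \<sigma>_def by measurable

lemma \<sigma>_pos: "0 < \<sigma> x"
  using w_pos[of x] by (simp add: \<sigma>_def)

lemma w_mult_\<sigma>_powr: "w x * \<sigma> x powr p = \<sigma> x"
proof -
  have "w x * \<sigma> x powr p = w x powr 1 * w x powr ((-1/(p-1)) * p)"
    using w_pos[of x] by (simp add: \<sigma>_def powr_powr)
  also have "\<dots> = w x powr (1 + (-1/(p-1)) * p)" by (rule powr_add[symmetric])
  also have "1 + (-1/(p-1)) * p = -1/(p-1)" using p by (simp add: field_simps)
  finally show ?thesis by (simp add: \<sigma>_def)
qed

text \<open>This pointwise inequality takes the place of Hoelder's inequality; optimizing the free
  parameter \<open>\<theta>\<close> after integration recovers the latter up to a constant.  Either \<open>t \<le> \<sigma>/\<theta>\<close>, or \<open>\<theta> t > \<sigma>\<close> and then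
  \<open>w (\<theta> t)\<^sup>p\<^sup>-\<^sup>1 \<ge> w \<sigma>\<^sup>p\<^sup>-\<^sup>1 = 1\<close>.\<close>

lemma le_weighted_powr_add_dual:
  assumes "0 \<le> t" "0 < \<theta>"
  shows "t \<le> \<theta> powr (p - 1) * (w x * t powr p) + \<sigma> x / \<theta>"
proof (cases "\<theta> * t \<le> \<sigma> x")
  case True
  then have "t \<le> \<sigma> x / \<theta>" using assms by (simp add: field_simps)
  also have "\<dots> \<le> \<theta> powr (p - 1) * (w x * t powr p) + \<sigma> x / \<theta>"
    using w_pos[of x] by simp
  finally show ?thesis .
next
  case False
  then have t: "0 < t" using assms \<sigma>_pos[of x] by (cases "t = 0") auto
  have "1 = w x * w x powr (-1)" using w_pos[of x] by (simp add: powr_minus)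
  also have "w x powr (-1) = \<sigma> x powr (p - 1)" using p by (simp add: \<sigma>_def powr_powr)
  also have "\<dots> \<le> (\<theta> * t) powr (p - 1)"
    using False p \<sigma>_pos[of x] by (intro powr_mono2) auto
  finally have "1 \<le> w x * (\<theta> * t) powr (p - 1)" using w_pos[of x] by simp
  then have "t * 1 \<le> t * (w x * (\<theta> * t) powr (p - 1))" using t by (intro mult_left_mono) auto
  also have "\<dots> = \<theta> powr (p - 1) * (w x * (t powr 1 * t powr (p - 1)))"
    using t assms by (simp add: powr_mult)
  also have "t powr 1 * t powr (p - 1) = t powr p" by (subst powr_add[symmetric]) simp
  also have "\<theta> powr (p - 1) * (w x * t powr p) \<le> \<theta> powr (p - 1) * (w x * t powr p) + \<sigma> x / \<theta>"
    using \<sigma>_pos[of x] assms by simp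
  finally show ?thesis by simp
qed

lemma ennreal_le_weighted_epowr_add_dual:
  "h \<le> ennreal (w x) * epowr h p + ennreal (\<sigma> x)"
proof (cases h)
  case (real t)
  then have "ennreal t \<le> ennreal (w x * t powr p + \<sigma> x)"
    using le_weighted_powr_add_dual[of t 1 x] by (intro ennreal_leI) simp
  also have "\<dots> = ennreal (w x) * epowr h p + ennreal (\<sigma> x)"
    using real w_pos[of x] \<sigma>_pos[of x] by (simp add: epowr_ennreal ennreal_mult)
  finally show ?thesis using real by simp
next
  case top
  then show ?thesis using w_pos[of x] by (simp add: epowr_def ennreal_mult_top)
qed

lemma space_\<mu> [simp]: "space \<mu> = UNIV" and sets_\<mu> [simp, measurable_cong]: "sets \<mu> = sets lebesgue"
  by (simp_all add: \<mu>)

lemma nn_integral_\<mu>: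
  assumes "f \<in> borel_measurable lebesgue"
  shows "(\<integral>\<^sup>+ x. f x \<partial>\<mu>) = (\<integral>\<^sup>+ x. ennreal (w x) * f x \<partial>lborel)"
  unfolding \<mu> by (subst nn_integral_density) (use assms in \<open>simp_all add: nn_integral_completion measurable_completion\<close>)

lemma AE_\<mu>_iff: "(AE x in \<mu>. P x) \<longleftrightarrow> (AE x in lborel. P x)"
proof -
  have "(AE x in \<mu>. P x) \<longleftrightarrow> (AE x in lebesgue. 0 < ennreal (w x) \<longrightarrow> P x)"
    unfolding \<mu> by (rule AE_density) (simp add: measurable_completion)
  then show ?thesis using w_pos by (simp add: AE_completion_iff)
qed

lemma restrict_facts:
  assumes "E \<in> sets borel"
  shows space_restrict_\<mu>: "space (restrict_space \<mu> E) = E"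
    and measurable_restrict_\<mu>: "g \<in> borel_measurable (restrict_space \<mu> E) \<longleftrightarrow>
      (\<lambda>x. (g x :: ennreal) * indicator E x) \<in> borel_measurable lebesgue"
    and AE_restrict_\<mu>: "(AE x in restrict_space \<mu> E. P x) \<longleftrightarrow> (AE x in lborel. x \<in> E \<longrightarrow> P x)"
proof -
  have E: "E \<inter> space \<mu> \<in> sets \<mu>" using assms by simp
  show "space (restrict_space \<mu> E) = E" by (simp add: space_restrict_space)
  have "borel_measurable \<mu> = (borel_measurable lebesgue :: (real \<Rightarrow> ennreal) set)"
    by (rule measurable_cong_sets) simp_all
  then show "g \<in> borel_measurable (restrict_space \<mu> E) \<longleftrightarrow>
      (\<lambda>x. (g x :: ennreal) * indicator E x) \<in> borel_measurable lebesgue"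
    using borel_measurable_restrict_space_iff_ennreal[OF E, of g] by simp
  show "(AE x in restrict_space \<mu> E. P x) \<longleftrightarrow> (AE x in lborel. x \<in> E \<longrightarrow> P x)"
    using AE_restrict_space_iff[OF E, of P] by (simp add: AE_\<mu>_iff)
qed

lemma nn_integral_restrict_\<mu>:
  assumes E: "E \<in> sets borel" and g: "g \<in> borel_measurable (restrict_space \<mu> E)"
  shows "(\<integral>\<^sup>+ x. g x \<partial>restrict_space \<mu> E) = (\<integral>\<^sup>+ x\<in>E. ennreal (w x) * g x \<partial>lborel)"
proof -
  have "(\<integral>\<^sup>+ x. g x \<partial>restrict_space \<mu> E) = (\<integral>\<^sup>+ x\<in>E. g x \<partial>\<mu>)"
    by (rule nn_integral_restrict_space) (use E in simp)
  also have "\<dots> = (\<integral>\<^sup>+ x. ennreal (w x) * (g x * indicator E x) \<partial>lborel)"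
    by (rule nn_integral_\<mu>) (rule measurable_restrict_\<mu>[OF E, THEN iffD1, OF g])
  finally show ?thesis by (simp add: mult.assoc)
qed

lemma Lp_integral_restrict_\<mu>:
  assumes "E \<in> sets borel" and g: "g \<in> borel_measurable (restrict_space \<mu> E)"
  shows "Lp_integral (restrict_space \<mu> E) p g = (\<integral>\<^sup>+ x\<in>E. ennreal (w x) * epowr (g x) p \<partial>lborel)"
  unfolding Lp_integral_def by (rule nn_integral_restrict_\<mu>[OF assms(1) measurable_epowr[OF g]])

lemma nn_integral_Icc_finite_of_Lp:
  assumes g: "(\<lambda>x. g x * indicator {a..b} x) \<in> borel_measurable lebesgue"
    and fin: "(\<integral>\<^sup>+ x\<in>{a..b}. ennreal (w x) * epowr (g x) p \<partial>lborel) < top"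
  shows "(\<integral>\<^sup>+ x\<in>{a..b}. g x \<partial>lebesgue) < top"
proof -
  let ?g = "\<lambda>x. g x * indicator {a..b} x"
  obtain h where [measurable]: "h \<in> borel_measurable lborel" and h: "AE x in lborel. ?g x = h x"
    using completion_ex_borel_measurable[OF g] by auto
  have "(\<integral>\<^sup>+ x\<in>{a..b}. g x \<partial>lborel) = (\<integral>\<^sup>+ x\<in>{a..b}. h x \<partial>lborel)"
    by (rule nn_integral_cong_AE) (use h in \<open>auto elim!: eventually_mono split: split_indicator\<close>)
  also have "\<dots> \<le> (\<integral>\<^sup>+ x. ennreal (w x) * epowr (h x) p * indicator {a..b} x + ennreal (\<sigma> x) * indicator {a..b} x \<partial>lborel)"
    by (intro nn_integral_mono) (use ennreal_le_weighted_epowr_add_dual in \<open>auto split: split_indicator\<close>)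
  also have "\<dots> = (\<integral>\<^sup>+ x\<in>{a..b}. ennreal (w x) * epowr (h x) p \<partial>lborel) + (\<integral>\<^sup>+ x\<in>{a..b}. ennreal (\<sigma> x) \<partial>lborel)"
    by (rule nn_integral_add) auto
  also have "(\<integral>\<^sup>+ x\<in>{a..b}. ennreal (w x) * epowr (h x) p \<partial>lborel) = (\<integral>\<^sup>+ x\<in>{a..b}. ennreal (w x) * epowr (g x) p \<partial>lborel)"
    by (rule nn_integral_cong_AE) (use h in \<open>auto elim!: eventually_mono split: split_indicator\<close>)
  also have "\<dots> + (\<integral>\<^sup>+ x\<in>{a..b}. ennreal (\<sigma> x) \<partial>lborel) < top"
    using fin dual_int[of a b] by (simp add: \<sigma>_def)
  finally show ?thesis by (simp add: nn_integral_completion)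
qed

text \<open>No segment is exceptional: a function in \<open>L\<^sup>p(\<mu>)\<close> is integrable over it with respect to length,
  because the dual weight is.\<close>

lemma interval_gradient_of_weak_upper_gradient:
  assumes E: "E \<in> sets borel" and wug: "weak_upper_gradient (restrict_space \<mu> E) p (\<lambda>x. ereal (u x)) g"
  shows "interval_gradient E u g"
  unfolding interval_gradient_def
proof (intro allI impI)
  fix a b :: real assume ab: "a < b \<and> {a..b} \<subseteq> E"
  let ?M = "restrict_space \<mu> E"
  have Icc_meas: "(\<lambda>x. h x * indicator {a..b} x) \<in> borel_measurable lebesgue"
    if "h \<in> borel_measurable ?M" for h :: "real \<Rightarrow> ennreal"
  proof -
    have "(\<lambda>x. h x * indicator E x) \<in> borel_measurable lebesgue"
      using that measurable_restrict_\<mu>[OF E] by blast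
    then have "(\<lambda>x. h x * indicator E x * indicator {a..b} x) \<in> borel_measurable lebesgue"
      by (rule borel_measurable_times_ennreal[OF _ borel_measurable_indicator]) simp
    also have "(\<lambda>x. h x * indicator E x * indicator {a..b} x) = (\<lambda>x. h x * indicator {a..b} x)"
      using ab by (auto simp: fun_eq_iff split: split_indicator)
    finally show ?thesis .
  qed
  have g: "g \<in> borel_measurable ?M" using wug by (simp add: weak_upper_gradient_def)
  obtain \<rho> where \<rho>: "\<rho> \<in> borel_measurable (restrict_space borel E)" and Lp: "Lp_integral ?M p \<rho> < top"
    and ex: "\<And>l \<gamma>. arc_length_curve E l \<gamma> \<Longrightarrow>
       \<not> ext_dist (ereal (u (\<gamma> 0))) (ereal (u (\<gamma> l))) \<le> curve_integral g l \<gamma> \<Longrightarrow> curve_integral \<rho> l \<gamma> = top"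
    using wug unfolding weak_upper_gradient_def p_ae_curve_def space_restrict_\<mu>[OF E] by blast
  have \<rho>M: "\<rho> \<in> borel_measurable ?M"
  proof -
    have "(\<lambda>x. \<rho> x * indicator E x) \<in> borel_measurable borel"
      using \<rho> borel_measurable_restrict_space_iff_ennreal[of E borel \<rho>] E by simp
    then have "(\<lambda>x. \<rho> x * indicator E x) \<in> borel_measurable lebesgue"
      by (intro measurable_completion) simp
    then show ?thesis using measurable_restrict_\<mu>[OF E] by blast
  qed
  have "curve_integral \<rho> (b - a) (\<lambda>t. a + t) = (\<integral>\<^sup>+ x\<in>{a..b}. \<rho> x \<partial>lebesgue)"
    by (rule curve_integral_segment) (use ab Icc_meas[OF \<rho>M] in auto)
  also have "\<dots> < top"
  proof (rule nn_integral_Icc_finite_of_Lp[OF Icc_meas[OF \<rho>M]])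
    have "(\<integral>\<^sup>+ x\<in>{a..b}. ennreal (w x) * epowr (\<rho> x) p \<partial>lborel) \<le> (\<integral>\<^sup>+ x\<in>E. ennreal (w x) * epowr (\<rho> x) p \<partial>lborel)"
      using ab by (intro nn_integral_mono) (auto split: split_indicator)
    then show "(\<integral>\<^sup>+ x\<in>{a..b}. ennreal (w x) * epowr (\<rho> x) p \<partial>lborel) < top"
      using Lp Lp_integral_restrict_\<mu>[OF E \<rho>M] by (simp add: order.strict_trans1)
  qed
  finally have "curve_integral \<rho> (b - a) (\<lambda>t. a + t) \<noteq> top" by simp
  then have "ext_dist (ereal (u (a + 0))) (ereal (u (a + (b - a)))) \<le> curve_integral g (b - a) (\<lambda>t. a + t)"
    using ex[OF arc_length_curve_segment[of a b E]] ab by blast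
  then show "ennreal \<bar>u b - u a\<bar> \<le> (\<integral>\<^sup>+ x\<in>{a..b}. g x \<partial>lebesgue)"
    using curve_integral_segment[OF _ Icc_meas[OF g]] ab
    by (simp add: ext_dist_ereal abs_minus_commute)
qed

lemma weak_upper_gradient_of_primitive:
  assumes E: "E \<in> sets borel" and f: "primitive_on E u f"
  shows "weak_upper_gradient (restrict_space \<mu> E) p (\<lambda>x. ereal (u x)) (\<lambda>x. ennreal \<bar>f x\<bar>)"
proof (rule weak_upper_gradient_of_interval_gradient)
  have [measurable]: "f \<in> borel_measurable borel" using f by (simp add: primitive_on_def)
  have m: "(\<lambda>x. ennreal \<bar>f x\<bar> * indicator A x) \<in> borel_measurable lebesgue" if [measurable]: "A \<in> sets borel" for A
    by (rule measurable_completion) measurable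
  show "(\<lambda>x. ennreal \<bar>f x\<bar>) \<in> borel_measurable (restrict_space \<mu> E)"
    unfolding measurable_restrict_\<mu>[OF E] by (rule m[OF E])
  show "(\<lambda>x. ennreal \<bar>f x\<bar> * indicator {a..b} x) \<in> borel_measurable lebesgue" for a b
    by (rule m) simp
  show "interval_gradient (space (restrict_space \<mu> E)) u (\<lambda>x. ennreal \<bar>f x\<bar>)"
    unfolding space_restrict_\<mu>[OF E] by (rule primitive_on_gradient[OF f])
  show "0 < p" using p by simp
qed

definition energy :: "(real \<Rightarrow> real) \<Rightarrow> real set \<Rightarrow> ennreal" where
  "energy f A = (\<integral>\<^sup>+ x\<in>A. ennreal (w x * \<bar>f x\<bar> powr p) \<partial>lborel)"

lemma weighted_epowr_abs: "ennreal (w x) * epowr (ennreal \<bar>t\<bar>) p = ennreal (w x * \<bar>t\<bar> powr p)"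
  using w_pos[of x] by (simp add: epowr_ennreal ennreal_mult)

lemma is_minimal_weak_upper_gradient_of_primitive:
  assumes E: "open E" and f: "primitive_on E u f"
    and fin: "\<And>a b. a < b \<Longrightarrow> {a..b} \<subseteq> E \<Longrightarrow> energy f {a..b} < top"
  shows "is_minimal_weak_upper_gradient (restrict_space \<mu> E) p (\<lambda>x. ereal (u x)) (\<lambda>x. ennreal \<bar>f x\<bar>)"
  unfolding is_minimal_weak_upper_gradient_def
proof (intro conjI allI impI)
  let ?M = "restrict_space \<mu> E"
  have Eb [measurable]: "E \<in> sets borel" using E by (rule borel_open)
  have [measurable]: "f \<in> borel_measurable borel" using f by (simp add: primitive_on_def)
  show wug: "weak_upper_gradient ?M p (\<lambda>x. ereal (u x)) (\<lambda>x. ennreal \<bar>f x\<bar>)"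
    by (rule weak_upper_gradient_of_primitive[OF Eb f])
  have restrict: "restrict_space ?M (ball x r \<inter> E) = restrict_space \<mu> (ball x r \<inter> E)" for x r
    by (subst restrict_restrict_space) (auto simp: Int_absorb2 intro!: arg_cong2[where f = restrict_space])
  have restr_meas: "g \<in> borel_measurable (restrict_space \<mu> (ball x r \<inter> E))" if "g \<in> borel_measurable ?M"
    for g :: "real \<Rightarrow> ennreal" and x r
    unfolding restrict[symmetric] by (rule measurable_restrict_space1[OF that])
  show "(\<lambda>x. ennreal \<bar>f x\<bar>) \<in> Lp_loc ?M p"
    unfolding Lp_loc_def space_restrict_\<mu>[OF Eb]
  proof (safe)
    show m: "(\<lambda>x. ennreal \<bar>f x\<bar>) \<in> borel_measurable ?M"
      using wug by (simp add: weak_upper_gradient_def)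
    fix x assume "x \<in> E"
    then obtain r where r: "0 < r" "cball x r \<subseteq> E" using E open_contains_cball by blast
    have "Lp_integral (restrict_space ?M (ball x r \<inter> E)) p (\<lambda>x. ennreal \<bar>f x\<bar>)
        = (\<integral>\<^sup>+ y\<in>ball x r \<inter> E. ennreal (w y) * epowr (ennreal \<bar>f y\<bar>) p \<partial>lborel)"
      unfolding restrict by (rule Lp_integral_restrict_\<mu>[OF _ restr_meas[OF m]]) simp
    also have "\<dots> \<le> energy f {x-r..x+r}"
      unfolding energy_def weighted_epowr_abs
      by (intro nn_integral_mono) (auto simp: ball_def dist_real_def split: split_indicator)
    also have "\<dots> < top"
    proof (rule fin)
      show "{x-r..x+r} \<subseteq> E" using r by (simp add: cball_eq_atLeastAtMost)
    qed (use r in simp)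
    finally show "\<exists>r>0. Lp_integral (restrict_space ?M (ball x r \<inter> E)) p (\<lambda>x. ennreal \<bar>f x\<bar>) < top"
      using r by blast
  qed
  fix h assume "weak_upper_gradient ?M p (\<lambda>x. ereal (u x)) h \<and> h \<in> Lp_loc ?M p"
  then have hw: "weak_upper_gradient ?M p (\<lambda>x. ereal (u x)) h" and hL: "h \<in> Lp_loc ?M p" by auto
  have hm: "h \<in> borel_measurable ?M" using hw by (simp add: weak_upper_gradient_def)
  have hE: "(\<lambda>x. h x * indicator E x) \<in> borel_measurable lebesgue"
    using hm measurable_restrict_\<mu>[OF Eb] by blast
  have grad: "interval_gradient E u h" by (rule interval_gradient_of_weak_upper_gradient[OF Eb hw])
  show "AE x in ?M. ennreal \<bar>f x\<bar> \<le> h x"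
    unfolding AE_restrict_\<mu>[OF Eb]
  proof (rule AE_on_open_of_compact_intervals[OF E])
    fix a b :: real assume ab: "a < b" "{a..b} \<subseteq> E"
    have ind: "h x * indicator E x * indicator {a..b} x = h x * indicator {a..b} x" for x
      using ab by (auto split: split_indicator)
    have hab: "(\<lambda>x. h x * indicator {a..b} x) \<in> borel_measurable lebesgue"
      using borel_measurable_times_ennreal[OF hE borel_measurable_indicator[of "{a..b}" lebesgue]]
      by (simp add: ind)
    show "AE x in lborel. x \<in> {a..b} \<longrightarrow> ennreal \<bar>f x\<bar> \<le> h x"
    proof (rule AE_derivative_le_gradient[OF primitive_on_subset[OF f ab(2)] hab])
      show "interval_gradient {a..b} u h" using grad ab(2) unfolding interval_gradient_def by blast
      show "(\<integral>\<^sup>+ x\<in>{a..b}. h x \<partial>lebesgue) < top"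
      proof (rule nn_integral_Icc_finite_of_Lp[OF hab])
        define H where "H x = ennreal (w x) * epowr (h x * indicator E x) p" for x
        have [measurable]: "H \<in> borel_measurable lebesgue"
          unfolding H_def
          by (rule borel_measurable_times_ennreal[OF _ measurable_epowr[OF hE]]) (simp add: measurable_completion)
        have "(\<integral>\<^sup>+ y\<in>{a..b}. H y \<partial>lebesgue) < top"
        proof (rule nn_integral_Icc_finite_of_local)
          fix x assume "x \<in> {a..b}"
          then have "x \<in> E" using ab by blast
          then obtain r where r: "0 < r" "Lp_integral (restrict_space ?M (ball x r \<inter> E)) p h < top"
            using hL unfolding Lp_loc_def space_restrict_\<mu>[OF Eb] by blast
          obtain r' where r': "0 < r'" "ball x r' \<subseteq> E" using \<open>x \<in> E\<close> E openE by blast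
          have "(\<integral>\<^sup>+ y\<in>ball x (min r r'). H y \<partial>lborel)
              \<le> (\<integral>\<^sup>+ y\<in>ball x r \<inter> E. ennreal (w y) * epowr (h y) p \<partial>lborel)"
          proof (rule nn_integral_mono)
            fix y
            have "y \<in> ball x r'" if "y \<in> ball x (min r r')" using that by simp
            then show "H y * indicator (ball x (min r r')) y \<le> ennreal (w y) * epowr (h y) p * indicator (ball x r \<inter> E) y"
              using r'(2) by (auto simp: H_def split: split_indicator)
          qed
          also have "\<dots> = Lp_integral (restrict_space ?M (ball x r \<inter> E)) p h"
            unfolding restrict by (rule Lp_integral_restrict_\<mu>[OF _ restr_meas[OF hm], symmetric]) simp
          finally show "\<exists>r>0. (\<integral>\<^sup>+ y\<in>ball x r. H y \<partial>lebesgue) < top"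
            using r r' by (intro exI[of _ "min r r'"]) (auto simp: nn_integral_completion)
        qed simp
        also have "(\<integral>\<^sup>+ y\<in>{a..b}. H y \<partial>lebesgue) = (\<integral>\<^sup>+ x\<in>{a..b}. ennreal (w x) * epowr (h x) p \<partial>lborel)"
          unfolding nn_integral_completion using ab(2)
          by (intro nn_integral_cong) (auto simp: H_def split: split_indicator)
        finally show "(\<integral>\<^sup>+ x\<in>{a..b}. ennreal (w x) * epowr (h x) p \<partial>lborel) < top" .
      qed
    qed
  qed
qed

text \<open>The selected minimal weak upper gradient is one, as \<open>|f|\<close> is, and two of them dominate each other.\<close>

lemma AE_min_weak_upper_gradient_eq:
  assumes E: "open E" and f: "primitive_on E u f"
    and fin: "\<And>a b. a < b \<Longrightarrow> {a..b} \<subseteq> E \<Longrightarrow> energy f {a..b} < top"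
  shows "AE x in lborel. x \<in> E \<longrightarrow>
      min_weak_upper_gradient (restrict_space \<mu> E) p (\<lambda>x. ereal (u x)) x = ennreal \<bar>f x\<bar>"
    and "min_weak_upper_gradient (restrict_space \<mu> E) p (\<lambda>x. ereal (u x)) \<in> borel_measurable (restrict_space \<mu> E)"
proof -
  let ?M = "restrict_space \<mu> E" and ?u = "\<lambda>x. ereal (u x)"
  have Eb: "E \<in> sets borel" using E by (rule borel_open)
  have f_min: "is_minimal_weak_upper_gradient ?M p ?u (\<lambda>x. ennreal \<bar>f x\<bar>)"
    by (rule is_minimal_weak_upper_gradient_of_primitive[OF E f fin])
  then have g_min: "is_minimal_weak_upper_gradient ?M p ?u (min_weak_upper_gradient ?M p ?u)"
    unfolding min_weak_upper_gradient_def
    by (rule someI[where P = "is_minimal_weak_upper_gradient ?M p ?u"])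
  then show "min_weak_upper_gradient ?M p ?u \<in> borel_measurable ?M"
    by (simp add: is_minimal_weak_upper_gradient_def weak_upper_gradient_def)
  have "AE x in ?M. min_weak_upper_gradient ?M p ?u x \<le> ennreal \<bar>f x\<bar>"
    "AE x in ?M. ennreal \<bar>f x\<bar> \<le> min_weak_upper_gradient ?M p ?u x"
    using f_min g_min unfolding is_minimal_weak_upper_gradient_def by blast+
  then have "AE x in ?M. min_weak_upper_gradient ?M p ?u x = ennreal \<bar>f x\<bar>"
    by eventually_elim auto
  then show "AE x in lborel. x \<in> E \<longrightarrow> min_weak_upper_gradient ?M p ?u x = ennreal \<bar>f x\<bar>"
    unfolding AE_restrict_\<mu>[OF Eb] .
qed

lemma nn_integral_min_weak_upper_gradient:
  assumes E: "open E" and f: "primitive_on E u f"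
    and fin: "\<And>a b. a < b \<Longrightarrow> {a..b} \<subseteq> E \<Longrightarrow> energy f {a..b} < top"
    and A [measurable]: "A \<in> sets borel"
  shows "(\<integral>\<^sup>+ x\<in>A. epowr (min_weak_upper_gradient (restrict_space \<mu> E) p (\<lambda>x. ereal (u x)) x) p \<partial>restrict_space \<mu> E)
     = energy f (A \<inter> E)"
proof -
  let ?M = "restrict_space \<mu> E"
  let ?g = "min_weak_upper_gradient ?M p (\<lambda>x. ereal (u x))"
  have Eb: "E \<in> sets borel" using E by (rule borel_open)
  have g: "AE x in lborel. x \<in> E \<longrightarrow> ?g x = ennreal \<bar>f x\<bar>" "?g \<in> borel_measurable ?M"
    by (rule AE_min_weak_upper_gradient_eq[OF E f]; rule fin; assumption)+
  have "(indicator A :: real \<Rightarrow> ennreal) \<in> borel_measurable ?M"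
    by (rule measurable_restrict_space1, rule borel_measurable_indicator) simp
  then have "(\<lambda>x. epowr (?g x) p * indicator A x) \<in> borel_measurable ?M"
    using g(2) by measurable
  from nn_integral_restrict_\<mu>[OF Eb this]
  have "(\<integral>\<^sup>+ x\<in>A. epowr (?g x) p \<partial>?M) = (\<integral>\<^sup>+ x\<in>E. ennreal (w x) * (epowr (?g x) p * indicator A x) \<partial>lborel)" .
  also have "\<dots> = energy f (A \<inter> E)"
    unfolding energy_def
  proof (rule nn_integral_cong_AE)
    show "AE x in lborel. ennreal (w x) * (epowr (?g x) p * indicator A x) * indicator E x
        = ennreal (w x * \<bar>f x\<bar> powr p) * indicator (A \<inter> E) x"
      using g(1) by eventually_elim (auto simp: weighted_epowr_abs split: split_indicator)
  qed
  finally show ?thesis .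
qed

end

section \<open>Energies\<close>

lemma newtonian_gradient:
  assumes "u \<in> newtonian M p"
  obtains g where "weak_upper_gradient M p u g" "Lp_integral M p g < top"
proof -
  define I where "I = (INF g\<in>{g. weak_upper_gradient M p u g}. Lp_integral M p g)"
  have "newtonian_norm M p u < top" using assms by (simp add: newtonian_def)
  then have "I < top"
    unfolding newtonian_norm_def epowr_def I_def[symmetric] by (auto split: if_splits simp: less_top)
  then show thesis using that unfolding I_def by (auto simp: INF_less_iff)
qed

lemma newtonianI:
  assumes "u \<in> borel_measurable M" "Lp_integral M p (\<lambda>x. e2ennreal \<bar>u x\<bar>) < top"
    "weak_upper_gradient M p u g" "Lp_integral M p g < top"
  shows "u \<in> newtonian M p"
proof -
  define I where "I = (INF g\<in>{g. weak_upper_gradient M p u g}. Lp_integral M p g)"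
  have "I \<le> Lp_integral M p g"
    unfolding I_def using assms(3) by (intro INF_lower) simp
  also note assms(4)
  finally have "Lp_integral M p (\<lambda>x. e2ennreal \<bar>u x\<bar>) + I < top" using assms(2) by simp
  then have "epowr (Lp_integral M p (\<lambda>x. e2ennreal \<bar>u x\<bar>) + I) (1 / p) < top"
    by (simp add: epowr_def less_top[symmetric])
  then show ?thesis
    using assms(1) unfolding newtonian_def newtonian_norm_def I_def by blast
qed

context weighted_line
begin

lemma energy_mono: "A \<subseteq> B \<Longrightarrow> energy f A \<le> energy f B"
  unfolding energy_def by (intro nn_integral_mono) (auto split: split_indicator)

lemma energy_Un:
  assumes [measurable]: "f \<in> borel_measurable borel" "A \<in> sets borel" "B \<in> sets borel"
    and "AE x in lborel. x \<notin> A \<inter> B"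
  shows "energy f (A \<union> B) = energy f A + energy f B"
proof -
  have "energy f A + energy f B
      = (\<integral>\<^sup>+ x. ennreal (w x * \<bar>f x\<bar> powr p) * indicator A x + ennreal (w x * \<bar>f x\<bar> powr p) * indicator B x \<partial>lborel)"
    unfolding energy_def by (rule nn_integral_add[symmetric]) measurable
  also have "\<dots> = energy f (A \<union> B)"
    unfolding energy_def
    by (rule nn_integral_cong_AE) (use assms(4) in \<open>auto elim!: eventually_mono split: split_indicator\<close>)
  finally show ?thesis by simp
qed

lemma energy_Icc_split:
  assumes [measurable]: "f \<in> borel_measurable borel" and "c \<le> d" "d \<le> e"
  shows "energy f {c..e} = energy f {c..d} + energy f {d..e}"
proof -
  have "{c..e} = {c..d} \<union> {d..e}" using assms by auto
  moreover have "AE x in lborel. x \<notin> {c..d} \<inter> {d..e}"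
    using AE_lborel_singleton[of d] by eventually_elim auto
  ultimately show ?thesis using energy_Un[of f "{c..d}" "{d..e}"] by simp
qed

lemma energy_cong_AE:
  assumes "AE x in lborel. x \<in> A \<longrightarrow> \<bar>f x\<bar> = \<bar>k x\<bar>"
  shows "energy f A = energy k A"
  unfolding energy_def
  by (rule nn_integral_cong_AE) (use assms in \<open>auto elim!: eventually_mono split: split_indicator\<close>)

lemma energy_scale:
  assumes [measurable]: "f \<in> borel_measurable borel" "A \<in> sets borel"
  shows "energy (\<lambda>x. K * f x) A = ennreal (\<bar>K\<bar> powr p) * energy f A"
proof -
  have "ennreal (w x * \<bar>K * f x\<bar> powr p) = ennreal (\<bar>K\<bar> powr p) * ennreal (w x * \<bar>f x\<bar> powr p)" for x
    using w_pos[of x] by (simp add: abs_mult powr_mult ennreal_mult'[symmetric] mult_ac)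
  then show ?thesis
    unfolding energy_def by (subst nn_integral_cmult[symmetric]) (auto simp: mult.assoc)
qed

lemma powr_sum_le:
  assumes "0 \<le> s" "0 \<le> t"
  shows "(s + t) powr p \<le> 2 powr p * (s powr p + t powr p)"
proof -
  have "(s + t) powr p \<le> (2 * max s t) powr p"
    using assms p by (intro powr_mono2) auto
  also have "\<dots> = 2 powr p * max s t powr p" by (rule powr_mult)
  also have "\<dots> \<le> 2 powr p * (s powr p + t powr p)" by (intro mult_left_mono) (auto simp: max_def)
  finally show ?thesis .
qed

lemma energy_add_le:
  assumes [measurable]: "f \<in> borel_measurable borel" "k \<in> borel_measurable borel" "A \<in> sets borel"
  shows "energy (\<lambda>x. f x + k x) A \<le> ennreal (2 powr p) * (energy f A + energy k A)"
proof -
  have le: "ennreal (w x * \<bar>f x + k x\<bar> powr p)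
      \<le> ennreal (2 powr p) * (ennreal (w x * \<bar>f x\<bar> powr p) + ennreal (w x * \<bar>k x\<bar> powr p))" for x
  proof -
    have "w x * \<bar>f x + k x\<bar> powr p \<le> w x * (\<bar>f x\<bar> + \<bar>k x\<bar>) powr p"
      using w_pos[of x] p by (intro mult_left_mono powr_mono2) auto
    also have "\<dots> \<le> w x * (2 powr p * (\<bar>f x\<bar> powr p + \<bar>k x\<bar> powr p))"
      using w_pos[of x] by (intro mult_left_mono powr_sum_le) auto
    also have "\<dots> = 2 powr p * (w x * \<bar>f x\<bar> powr p + w x * \<bar>k x\<bar> powr p)" by (simp add: algebra_simps)
    finally have "w x * \<bar>f x + k x\<bar> powr p \<le> 2 powr p * (w x * \<bar>f x\<bar> powr p + w x * \<bar>k x\<bar> powr p)" .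
    then have "ennreal (w x * \<bar>f x + k x\<bar> powr p) \<le> ennreal (2 powr p * (w x * \<bar>f x\<bar> powr p + w x * \<bar>k x\<bar> powr p))"
      by (rule ennreal_leI)
    also have "\<dots> = ennreal (2 powr p) * (ennreal (w x * \<bar>f x\<bar> powr p) + ennreal (w x * \<bar>k x\<bar> powr p))"
      using w_pos[of x] by (simp add: ennreal_mult')
    finally show ?thesis .
  qed
  have "energy (\<lambda>x. f x + k x) A \<le> (\<integral>\<^sup>+ x. ennreal (2 powr p) *
      (ennreal (w x * \<bar>f x\<bar> powr p) * indicator A x + ennreal (w x * \<bar>k x\<bar> powr p) * indicator A x) \<partial>lborel)"
    unfolding energy_def by (intro nn_integral_mono) (use le in \<open>auto split: split_indicator\<close>)
  also have "\<dots> = ennreal (2 powr p) * (energy f A + energy k A)"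
    unfolding energy_def by (simp add: nn_integral_cmult nn_integral_add)
  finally show ?thesis .
qed

text \<open>Since \<open>w \<sigma>\<^sup>p = \<sigma>\<close>, the integral of \<open>\<sigma>\<close> is itself an energy, and the
  monotonicity and additivity of energies apply to it.\<close>

lemma energy_dual: "energy \<sigma> A = (\<integral>\<^sup>+ x\<in>A. ennreal (\<sigma> x) \<partial>lborel)"
  unfolding energy_def using \<sigma>_pos w_mult_\<sigma>_powr by (simp add: abs_of_pos)

lemma energy_dual_finite: "energy \<sigma> {c..d} < top"
  using dual_int[of c d] unfolding energy_dual \<sigma>_def .

lemma dual_integrable: "set_integrable lborel {c..d} \<sigma>"
  and dual_integral: "energy \<sigma> {c..d} = ennreal (LBINT x:{c..d}. \<sigma> x)"
proof -
  have e: "energy \<sigma> {c..d} = (\<integral>\<^sup>+ x. ennreal (indicator {c..d} x *\<^sub>R \<sigma> x) \<partial>lborel)"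
    unfolding energy_dual by (intro nn_integral_cong) (auto split: split_indicator)
  show *: "set_integrable lborel {c..d} \<sigma>"
    unfolding set_integrable_def
    by (rule integrableI_nonneg) (use energy_dual_finite[of c d] \<sigma>_pos in \<open>auto simp: e less_imp_le\<close>)
  show "energy \<sigma> {c..d} = ennreal (LBINT x:{c..d}. \<sigma> x)"
    unfolding e set_lebesgue_integral_def
    by (rule nn_integral_eq_integral) (use * \<sigma>_pos in \<open>auto simp: set_integrable_def less_imp_le\<close>)
qed

lemma energy_dual_pos: "c < d \<Longrightarrow> 0 < energy \<sigma> {c..d}"
proof -
  assume "c < d"
  have "energy \<sigma> {c..d} \<noteq> 0"
  proof
    assume "energy \<sigma> {c..d} = 0"
    then have "AE x in lborel. ennreal (\<sigma> x) * indicator {c..d} x = 0"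
      unfolding energy_dual by (subst (asm) nn_integral_0_iff_AE) auto
    then have "AE x in lborel. x \<notin> {c..d}"
    proof eventually_elim
      case (elim x)
      then show ?case using \<sigma>_pos[of x] by (auto split: split_indicator_asm)
    qed
    then have "emeasure lborel {c..d} = 0"
      by (subst (asm) AE_iff_measurable[of "{c..d}"]) auto
    then show False using \<open>c < d\<close> by simp
  qed
  then show ?thesis by (simp add: zero_less_iff_neq_zero)
qed

text \<open>Choosing \<open>\<theta>\<close> as a multiple of the \<open>p\<close>-th root of the dual mass, with the multiple depending
  on the energy, recovers Hoelder's inequality up to a constant.\<close>

lemma increment_le_energy_add_dual:
  assumes f: "primitive_on I u f" and cd: "c \<le> d" "{c..d} \<subseteq> I" and \<theta>: "0 < \<theta>"
  shows "ennreal \<bar>u d - u c\<bar> \<le> ennreal (\<theta> powr (p - 1)) * energy f {c..d} + ennreal (1 / \<theta>) * energy \<sigma> {c..d}"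
proof (cases "c = d")
  case False
  have [measurable]: "f \<in> borel_measurable borel" using f by (simp add: primitive_on_def)
  have "ennreal \<bar>u d - u c\<bar> \<le> (\<integral>\<^sup>+ x\<in>{c..d}. ennreal \<bar>f x\<bar> \<partial>lborel)"
    using primitive_on_gradient[OF f] cd False by (simp add: interval_gradient_def nn_integral_completion)
  also have "\<dots> \<le> (\<integral>\<^sup>+ x. ennreal (\<theta> powr (p - 1)) * (ennreal (w x * \<bar>f x\<bar> powr p) * indicator {c..d} x)
       + ennreal (1 / \<theta>) * (ennreal (\<sigma> x) * indicator {c..d} x) \<partial>lborel)"
  proof (rule nn_integral_mono)
    fix x
    have "ennreal \<bar>f x\<bar> \<le> ennreal (\<theta> powr (p - 1) * (w x * \<bar>f x\<bar> powr p) + 1 / \<theta> * \<sigma> x)"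
      using le_weighted_powr_add_dual[of "\<bar>f x\<bar>" \<theta> x] \<theta> by (intro ennreal_leI) simp
    also have "\<dots> = ennreal (\<theta> powr (p - 1)) * ennreal (w x * \<bar>f x\<bar> powr p) + ennreal (1 / \<theta>) * ennreal (\<sigma> x)"
      using w_pos[of x] \<sigma>_pos[of x] \<theta> by (simp add: ennreal_mult'[symmetric])
    finally show "ennreal \<bar>f x\<bar> * indicator {c..d} x \<le> ennreal (\<theta> powr (p - 1)) * (ennreal (w x * \<bar>f x\<bar> powr p) * indicator {c..d} x)
       + ennreal (1 / \<theta>) * (ennreal (\<sigma> x) * indicator {c..d} x)"
      by (auto split: split_indicator)
  qed
  also have "\<dots> = ennreal (\<theta> powr (p - 1)) * energy f {c..d} + ennreal (1 / \<theta>) * energy \<sigma> {c..d}"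
    unfolding energy_dual unfolding energy_def by (simp add: nn_integral_add nn_integral_cmult)
  finally show ?thesis .
qed simp

lemma restrict_\<mu>_UNIV [simp]: "restrict_space \<mu> UNIV = \<mu>"
  by (rule measure_eqI) (auto simp: sets_restrict_space emeasure_restrict_space)

end

section \<open>Newtonian functions on an exhausted interval\<close>

text \<open>The line and the half-line enter the proof only through such an exhaustion.\<close>

locale exhausted_line = weighted_line +
  fixes \<Omega> :: "real set" and a b :: "nat \<Rightarrow> real"
  assumes a_less_b: "\<And>n. a n < b n" and a_Suc: "\<And>n. a (Suc n) < a n" and b_Suc: "\<And>n. b n < b (Suc n)"
    and Icc_subset: "\<And>n. {a n..b n} \<subseteq> \<Omega>"
    and Ioo_G_dist: "\<And>n. {a n<..<b n} \<in> G_dist \<Omega>"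
    and ex_Icc: "\<And>x. x \<in> \<Omega> \<Longrightarrow> \<exists>n. x \<in> {a n..b n}"
begin

lemma a_antimono: "m \<le> n \<Longrightarrow> a n \<le> a m"
  using a_Suc by (metis decseqD decseq_SucI less_imp_le)

lemma b_mono: "m \<le> n \<Longrightarrow> b m \<le> b n"
  using b_Suc by (metis incseqD incseq_SucI less_imp_le)

lemma ex_Icc_superset:
  assumes "{c..d} \<subseteq> \<Omega>" "c \<le> d"
  obtains n where "{c..d} \<subseteq> {a n..b n}" "n \<ge> N"
proof -
  have "c \<in> \<Omega>" "d \<in> \<Omega>" using assms by (force simp: subset_eq)+
  then obtain i j where i: "c \<in> {a i..b i}" and j: "d \<in> {a j..b j}" using ex_Icc by blast
  define n where "n = max N (max i j)"
  have "i \<le> n" "j \<le> n" "N \<le> n" by (simp_all add: n_def)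
  have "a n \<le> c" using a_antimono[OF \<open>i \<le> n\<close>] i by simp
  moreover have "d \<le> b n" using b_mono[OF \<open>j \<le> n\<close>] j by simp
  ultimately show thesis using \<open>N \<le> n\<close> by (intro that[of n]) auto
qed

lemma open_\<Omega>: "open \<Omega>"
proof -
  have \<Omega>_eq: "\<Omega> = (\<Union>n. {a n<..<b n})"
  proof
    show "\<Omega> \<subseteq> (\<Union>n. {a n<..<b n})"
    proof
      fix x assume "x \<in> \<Omega>"
      then obtain n where "x \<in> {a n..b n}" using ex_Icc by blast
      then have "x \<in> {a (Suc n)<..<b (Suc n)}" using a_Suc[of n] b_Suc[of n] by auto
      then show "x \<in> (\<Union>n. {a n<..<b n})" by blast
    qed
    show "(\<Union>n. {a n<..<b n}) \<subseteq> \<Omega>"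
    proof
      fix x assume "x \<in> (\<Union>n. {a n<..<b n})"
      then obtain n where "x \<in> {a n<..<b n}" by blast
      then have "x \<in> {a n..b n}" by simp
      then show "x \<in> \<Omega>" using Icc_subset by blast
    qed
  qed
  show ?thesis unfolding \<Omega>_eq by (intro open_UN ballI open_greaterThanLessThan)
qed

lemma energy_\<Omega>_eq_SUP:
  assumes [measurable]: "f \<in> borel_measurable borel"
  shows "energy f \<Omega> = (SUP n. energy f {a n..b n})"
proof -
  let ?F = "\<lambda>n x. ennreal (w x * \<bar>f x\<bar> powr p) * indicator {a n..b n} x"
  have inc: "incseq ?F"
  proof (intro incseq_SucI le_funI mult_left_mono)
    show "indicator {a n..b n} x \<le> (indicator {a (Suc n)..b (Suc n)} x :: ennreal)" for n x
      using a_Suc[of n] b_Suc[of n] by (auto split: split_indicator)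
  qed simp
  have "energy f \<Omega> = (\<integral>\<^sup>+ x. (SUP n. ?F n x) \<partial>lborel)"
    unfolding energy_def
  proof (rule nn_integral_cong)
    fix x
    show "ennreal (w x * \<bar>f x\<bar> powr p) * indicator \<Omega> x = (SUP n. ?F n x)"
    proof (cases "x \<in> \<Omega>")
      case True
      then obtain n where n: "x \<in> {a n..b n}" using ex_Icc by blast
      show ?thesis
      proof (rule antisym)
        show "ennreal (w x * \<bar>f x\<bar> powr p) * indicator \<Omega> x \<le> (SUP n. ?F n x)"
          using n True by (intro SUP_upper2[of n]) auto
        show "(SUP n. ?F n x) \<le> ennreal (w x * \<bar>f x\<bar> powr p) * indicator \<Omega> x"
          using True by (intro SUP_least) (auto split: split_indicator)
      qed
    next
      case False
      have "x \<notin> {a n..b n}" for n using False Icc_subset[of n] by blast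
      then have i0: "indicator {a n..b n} x = (0::ennreal)" for n by (rule indicator_simps(2))
      have "?F n x = 0" for n by (simp only: i0 mult_zero_right)
      then have "(SUP n. ?F n x) = (SUP n::nat. 0)" by (intro SUP_cong) auto
      then show ?thesis using False by simp
    qed
  qed
  also have "\<dots> = (SUP n. \<integral>\<^sup>+ x. ?F n x \<partial>lborel)"
    by (rule nn_integral_monotone_convergence_SUP[OF inc]) measurable
  finally show ?thesis by (simp add: energy_def)
qed

text \<open>On each \<open>[a\<^sub>n,b\<^sub>n]\<close> there is a derivative; by uniqueness these agree almost everywhere on overlaps,
  so they can be glued by using at \<open>x\<close> the first interval that contains \<open>x\<close>.\<close>

lemma newtonian_loc_dist_primitive:
  assumes v: "(\<lambda>x. ereal (v x)) \<in> newtonian_loc_dist \<mu> p \<Omega>"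
  obtains f where "primitive_on \<Omega> v f" "\<And>c d. c < d \<Longrightarrow> {c..d} \<subseteq> \<Omega> \<Longrightarrow> energy f {c..d} < top"
proof -
  have "\<exists>f. primitive_on {a n..b n} v f \<and> energy f {a n..b n} < top" for n
  proof -
    let ?G = "{a (Suc n)<..<b (Suc n)}"
    have sub: "{a n..b n} \<subseteq> ?G" using a_Suc[of n] b_Suc[of n] by auto
    have "(\<lambda>x. ereal (v x)) \<in> newtonian (restrict_space \<mu> ?G) p"
      using v Ioo_G_dist by (simp add: newtonian_loc_dist_def)
    then obtain g where g: "weak_upper_gradient (restrict_space \<mu> ?G) p (\<lambda>x. ereal (v x)) g"
      and fin: "Lp_integral (restrict_space \<mu> ?G) p g < top"
      by (rule newtonian_gradient)
    have gm: "g \<in> borel_measurable (restrict_space \<mu> ?G)" using g by (simp add: weak_upper_gradient_def)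
    have "(\<lambda>x. g x * indicator ?G x) \<in> borel_measurable lebesgue"
      using gm measurable_restrict_\<mu>[of ?G g] by simp
    from borel_measurable_times_ennreal[OF this borel_measurable_indicator[of "{a n..b n}" lebesgue]]
    have gI: "(\<lambda>x. g x * indicator ?G x * indicator {a n..b n} x) \<in> borel_measurable lebesgue" by simp
    also have "(\<lambda>x. g x * indicator ?G x * indicator {a n..b n} x) = (\<lambda>x. g x * indicator {a n..b n} x)"
      using sub by (auto simp: fun_eq_iff split: split_indicator)
    finally have gI: "(\<lambda>x. g x * indicator {a n..b n} x) \<in> borel_measurable lebesgue" .
    have "(\<integral>\<^sup>+ x\<in>{a n..b n}. ennreal (w x) * epowr (g x) p \<partial>lborel)
        \<le> (\<integral>\<^sup>+ x\<in>?G. ennreal (w x) * epowr (g x) p \<partial>lborel)"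
      using sub by (intro nn_integral_mono) (auto split: split_indicator)
    also have "\<dots> = Lp_integral (restrict_space \<mu> ?G) p g"
      by (rule Lp_integral_restrict_\<mu>[symmetric, OF _ gm]) simp
    also note fin
    finally have g_fin: "(\<integral>\<^sup>+ x\<in>{a n..b n}. ennreal (w x) * epowr (g x) p \<partial>lborel) < top" .
    have "interval_gradient ?G v g" by (rule interval_gradient_of_weak_upper_gradient[OF _ g]) simp
    then have "interval_gradient {a n..b n} v g" using sub unfolding interval_gradient_def by blast
    then obtain f where f: "primitive_on {a n..b n} v f"
      and le: "AE x in lborel. x \<in> {a n..b n} \<longrightarrow> ennreal \<bar>f x\<bar> \<le> g x"
      using interval_gradient_derivative[OF gI nn_integral_Icc_finite_of_Lp[OF gI g_fin]] by blast
    have "energy f {a n..b n} \<le> (\<integral>\<^sup>+ x\<in>{a n..b n}. ennreal (w x) * epowr (g x) p \<partial>lborel)"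
      unfolding energy_def
    proof (rule nn_integral_mono_AE)
      show "AE x in lborel. ennreal (w x * \<bar>f x\<bar> powr p) * indicator {a n..b n} x
          \<le> ennreal (w x) * epowr (g x) p * indicator {a n..b n} x"
        using le
      proof eventually_elim
        case (elim x)
        then have "epowr (ennreal \<bar>f x\<bar>) p \<le> epowr (g x) p" if "x \<in> {a n..b n}"
          using that p by (intro epowr_mono) auto
        then show ?case
          by (auto simp: weighted_epowr_abs[symmetric] intro!: mult_left_mono split: split_indicator)
      qed
    qed
    with g_fin f show ?thesis by (blast intro: order.strict_trans1)
  qed
  then obtain F where F: "\<And>n. primitive_on {a n..b n} v (F n)" and F_fin: "\<And>n. energy (F n) {a n..b n} < top"
    by metis
  have [measurable]: "F n \<in> borel_measurable borel" for n using F[of n] by (simp add: primitive_on_def)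
  define N where "N x = (LEAST n. x \<in> {a n..b n})" for x
  have [measurable]: "N \<in> measurable borel (count_space UNIV)" unfolding N_def by measurable
  define f where "f x = F (N x) x" for x
  have f_meas [measurable]: "f \<in> borel_measurable borel"
    unfolding f_def by (rule measurable_compose_countable[of F]) measurable
  have "AE x in lborel. \<forall>m n. m \<le> n \<longrightarrow> x \<in> {a m..b m} \<longrightarrow> F m x = F n x"
  proof (intro AE_all_countable[THEN iffD2] allI)
    fix m n
    show "AE x in lborel. m \<le> n \<longrightarrow> x \<in> {a m..b m} \<longrightarrow> F m x = F n x"
    proof (cases "m \<le> n")
      case True
      then have "{a m..b m} \<subseteq> {a n..b n}" using a_antimono b_mono by auto
      then show ?thesis using AE_primitive_unique[OF F primitive_on_subset[OF F]] True by simp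
    qed simp
  qed
  then have f_eq: "AE x in lborel. x \<in> {a m..b m} \<longrightarrow> F m x = f x" for m
  proof eventually_elim
    case (elim x)
    show ?case
    proof
      assume x: "x \<in> {a m..b m}"
      have "x \<in> {a (N x)..b (N x)}" unfolding N_def by (rule LeastI[of _ m]) (rule x)
      moreover have "N x \<le> m" unfolding N_def by (rule Least_le) (rule x)
      ultimately show "F m x = f x" using elim unfolding f_def by metis
    qed
  qed
  have prim: "primitive_on {a m..b m} v f" for m
    by (rule primitive_on_cong_AE[OF F f_meas f_eq])
  have fin: "energy f {a m..b m} < top" for m
  proof -
    have "energy (F m) {a m..b m} = energy f {a m..b m}"
      by (rule energy_cong_AE) (use f_eq[of m] in eventually_elim, auto)
    then show ?thesis using F_fin[of m] by simp
  qed
  show thesis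
  proof (rule that[of f])
    show "primitive_on \<Omega> v f"
      unfolding primitive_on_def
    proof (intro conjI f_meas allI impI)
      fix c d :: real assume cd: "c < d \<and> {c..d} \<subseteq> \<Omega>"
      then obtain n where "{c..d} \<subseteq> {a n..b n}" using ex_Icc_superset[of c d 0] by auto
      then show "set_integrable lborel {c..d} f" "v d - v c = (LBINT x:{c..d}. f x)"
        using primitive_onD[OF prim, of c d n] cd by auto
    qed
    show "energy f {c..d} < top" if cd: "c < d" "{c..d} \<subseteq> \<Omega>" for c d
    proof -
      obtain n where "{c..d} \<subseteq> {a n..b n}" using ex_Icc_superset[of c d 0] cd by auto
      from energy_mono[OF this, of f] fin[of n] show ?thesis by (rule order.strict_trans1)
    qed
  qed
qed

end

section \<open>The energy of a quasiminimizer on an interval\<close>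

lemma primitive_on_UNIV_measurable:
  assumes "primitive_on UNIV u f"
  shows "u \<in> borel_measurable borel"
proof -
  have "isCont u x" for x
  proof -
    have "continuous_on {x-1..x+1} u"
      by (rule primitive_on_continuous[OF primitive_on_subset[OF assms subset_UNIV]])
    then show ?thesis by (rule continuous_on_interior) simp
  qed
  then have "continuous_on UNIV u" by (simp add: continuous_at_imp_continuous_on)
  then show ?thesis by (rule borel_measurable_continuous_onI)
qed

lemma epowr_zero: "epowr 0 q = 0"
  by (simp add: epowr_def)

context weighted_line
begin

lemma newtonian_norm_zero: "newtonian_norm \<mu> p (\<lambda>x. ereal 0) = 0"
proof -
  have prim: "primitive_on UNIV (\<lambda>x. 0) (\<lambda>x. 0)"
    by (simp add: primitive_on_def set_integrable_def set_lebesgue_integral_def)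
  have "weak_upper_gradient \<mu> p (\<lambda>x. ereal 0) (\<lambda>x. ennreal \<bar>0\<bar>)"
    using weak_upper_gradient_of_primitive[OF _ prim] by simp
  then have "weak_upper_gradient \<mu> p (\<lambda>x. ereal 0) (\<lambda>x. 0)" by simp
  then have "(INF g\<in>{g. weak_upper_gradient \<mu> p (\<lambda>x. ereal 0) g}. Lp_integral \<mu> p g) \<le> Lp_integral \<mu> p (\<lambda>x. 0)"
    by (intro INF_lower) simp
  moreover have "Lp_integral \<mu> p (\<lambda>x. 0) = 0" by (simp add: Lp_integral_def epowr_zero)
  moreover have "Lp_integral \<mu> p (\<lambda>x. e2ennreal \<bar>ereal 0\<bar>) = 0"
    by (simp only: Lp_integral_def abs_ereal.simps abs_zero e2ennreal_ereal ennreal_0 epowr_zero nn_integral_const mult_zero_left)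
  ultimately show ?thesis by (simp add: newtonian_norm_def epowr_zero)
qed

definition dual_mass :: "real \<Rightarrow> real \<Rightarrow> real" where
  "dual_mass c d = (LBINT x:{c..d}. \<sigma> x)"

lemma dual_mass_pos: "c < d \<Longrightarrow> 0 < dual_mass c d"
  using energy_dual_pos[of c d] by (simp add: dual_integral dual_mass_def)

lemma dual_mass_nonneg: "0 \<le> dual_mass c d"
  unfolding dual_mass_def set_lebesgue_integral_def
  by (intro integral_nonneg_AE AE_I2) (use \<sigma>_pos in \<open>auto simp: indicator_def less_imp_le\<close>)

lemma energy_dual_eq: "energy \<sigma> {c..d} = ennreal (dual_mass c d)"
  by (simp add: dual_integral dual_mass_def)

lemma dual_mass_mono: "{c..d} \<subseteq> {c'..d'} \<Longrightarrow> dual_mass c d \<le> dual_mass c' d'"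
  using energy_mono[of "{c..d}" "{c'..d'}" \<sigma>] dual_mass_nonneg by (simp add: energy_dual_eq)

lemma dual_mass_split: "c \<le> d \<Longrightarrow> d \<le> e \<Longrightarrow> dual_mass c e = dual_mass c d + dual_mass d e"
  using energy_Icc_split[of \<sigma> c d e] dual_mass_nonneg
  by (simp add: energy_dual_eq ennreal_plus[symmetric] del: ennreal_plus)

end

context exhausted_line
begin

text \<open>Such a function vanishes outside some \<open>(a\<^sub>n,b\<^sub>n)\<close>, so it is its own approximation in the closure
  that defines the test functions.\<close>

lemma primitive_bump_in_newtonian_zero_dist:
  assumes k: "primitive_on UNIV \<phi> k" and k_fin: "energy k UNIV < top"
    and cd: "c < d" "{c..d} \<subseteq> \<Omega>" and zero: "\<And>x. x \<notin> {c<..<d} \<Longrightarrow> \<phi> x = 0"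
  shows "(\<lambda>x. ereal (\<phi> x)) \<in> newtonian_zero_dist \<mu> p \<Omega>"
proof -
  have \<phi>_meas [measurable]: "\<phi> \<in> borel_measurable borel" by (rule primitive_on_UNIV_measurable[OF k])
  have "continuous_on {c..d} \<phi>"
    by (rule primitive_on_continuous[OF primitive_on_subset[OF k subset_UNIV]])
  then have "bounded (\<phi> ` {c..d})" using compact_continuous_image compact_imp_bounded by blast
  then obtain B where "\<forall>y\<in>\<phi> ` {c..d}. norm y \<le> B" unfolding bounded_iff by blast
  then have B: "\<bar>\<phi> x\<bar> \<le> B" if "x \<in> {c..d}" for x using that by simp
  have B0: "0 \<le> B" using B[of c] cd by simp
  have meas: "f \<in> borel_measurable \<mu>" if "f \<in> borel_measurable borel" for f :: "real \<Rightarrow> 'x::topological_space"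
  proof -
    have "f \<in> borel_measurable lebesgue" using that by (simp add: measurable_completion)
    then show ?thesis by (simp add: \<mu>)
  qed
  have newt: "(\<lambda>x. ereal (\<phi> x)) \<in> newtonian \<mu> p"
  proof (rule newtonianI)
    show "(\<lambda>x. ereal (\<phi> x)) \<in> borel_measurable \<mu>" by (rule meas) measurable
    show "weak_upper_gradient \<mu> p (\<lambda>x. ereal (\<phi> x)) (\<lambda>x. ennreal \<bar>k x\<bar>)"
      using weak_upper_gradient_of_primitive[OF _ k] by simp
    have [measurable]: "k \<in> borel_measurable borel" using k by (simp add: primitive_on_def)
    have "Lp_integral (restrict_space \<mu> UNIV) p (\<lambda>x. ennreal \<bar>k x\<bar>) = energy k UNIV"
      unfolding energy_def
      by (subst Lp_integral_restrict_\<mu>) (auto simp: weighted_epowr_abs intro!: meas)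
    then show "Lp_integral \<mu> p (\<lambda>x. ennreal \<bar>k x\<bar>) < top" using k_fin by simp
    have "Lp_integral \<mu> p (\<lambda>x. e2ennreal \<bar>ereal (\<phi> x)\<bar>) = (\<integral>\<^sup>+ x. ennreal (\<bar>\<phi> x\<bar> powr p) \<partial>\<mu>)"
      by (simp add: Lp_integral_def e2ennreal_ereal epowr_ennreal)
    also have "\<dots> = (\<integral>\<^sup>+ x. ennreal (w x) * ennreal (\<bar>\<phi> x\<bar> powr p) \<partial>lborel)"
      by (rule nn_integral_\<mu>) (rule measurable_completion, measurable)
    also have "\<dots> \<le> (\<integral>\<^sup>+ x. ennreal (B powr p) * (ennreal (w x) * indicator {c..d} x) \<partial>lborel)"
    proof (rule nn_integral_mono)
      fix x
      show "ennreal (w x) * ennreal (\<bar>\<phi> x\<bar> powr p) \<le> ennreal (B powr p) * (ennreal (w x) * indicator {c..d} x)"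
      proof (cases "x \<in> {c..d}")
        case True
        then have "\<bar>\<phi> x\<bar> powr p \<le> B powr p" using B p by (intro powr_mono2) auto
        then have "ennreal (w x) * ennreal (\<bar>\<phi> x\<bar> powr p) \<le> ennreal (w x) * ennreal (B powr p)"
          by (intro mult_left_mono ennreal_leI) auto
        then show ?thesis using True by (simp add: mult.commute)
      next
        case False
        then have "\<phi> x = 0" using zero[of x] by auto
        then show ?thesis by simp
      qed
    qed
    also have "\<dots> = ennreal (B powr p) * (\<integral>\<^sup>+ x\<in>{c..d}. ennreal (w x) \<partial>lborel)"
      by (rule nn_integral_cmult) measurable
    also have "\<dots> < top" using w_int[of c d] by (simp add: ennreal_mult_less_top)
    finally show "Lp_integral \<mu> p (\<lambda>x. e2ennreal \<bar>ereal (\<phi> x)\<bar>) < top" .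
  qed
  obtain n where n: "{c..d} \<subseteq> {a n..b n}" using ex_Icc_superset[of c d 0] cd by auto
  have "{c<..<d} \<subseteq> {a n<..<b n}" using n cd(1) by auto
  then have "(\<lambda>x. ereal (\<phi> x)) \<in> newtonian_zero \<mu> p {a n<..<b n}"
    using newt zero by (auto simp: newtonian_zero_def zero_ereal_def subset_eq)
  then have "(\<lambda>x. ereal (\<phi> x)) \<in> (\<Union>G\<in>G_dist \<Omega>. newtonian_zero \<mu> p G)"
    using Ioo_G_dist by blast
  moreover have "newtonian_norm \<mu> p (\<lambda>x. ereal (\<phi> x) - ereal (\<phi> x)) = 0"
  proof -
    have "(\<lambda>x. ereal (\<phi> x) - ereal (\<phi> x)) = (\<lambda>x. ereal 0)" by (simp add: zero_ereal_def)
    then show ?thesis using newtonian_norm_zero by (simp only:)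
  qed
  ultimately show ?thesis
    using newt unfolding newtonian_zero_dist_def by force
qed

lemma quasiminimizer_energy_le:
  assumes qm: "quasiminimizer \<mu> p \<Omega> (\<lambda>x. ereal (v x))"
    and f: "primitive_on \<Omega> v f" and f_fin: "\<And>c d. c < d \<Longrightarrow> {c..d} \<subseteq> \<Omega> \<Longrightarrow> energy f {c..d} < top"
  shows "\<exists>Q\<ge>1. \<forall>\<phi> k c d. primitive_on UNIV \<phi> k \<and> energy k UNIV < top \<and> c < d \<and> {c..d} \<subseteq> \<Omega> \<and>
       (\<forall>x. x \<notin> {c<..<d} \<longrightarrow> \<phi> x = 0) \<longrightarrow>
       energy f {x. \<phi> x \<noteq> 0} \<le> ennreal Q * energy (\<lambda>x. f x + k x) {x. \<phi> x \<noteq> 0}"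
proof -
  obtain Q where Q: "1 \<le> Q" and qmin: "\<And>\<phi>. \<phi> \<in> newtonian_zero_dist \<mu> p \<Omega> \<Longrightarrow>
      (\<integral>\<^sup>+ x\<in>{x. \<phi> x \<noteq> 0}. epowr (min_weak_upper_gradient (restrict_space \<mu> \<Omega>) p (\<lambda>x. ereal (v x)) x) p \<partial>restrict_space \<mu> \<Omega>)
      \<le> ennreal Q * (\<integral>\<^sup>+ x\<in>{x. \<phi> x \<noteq> 0}. epowr (min_weak_upper_gradient (restrict_space \<mu> \<Omega>) p (\<lambda>y. ereal (v y) + \<phi> y) x) p \<partial>restrict_space \<mu> \<Omega>)"
    using qm unfolding quasiminimizer_def Let_def by blast
  show ?thesis
  proof (rule exI[of _ Q], intro conjI Q allI impI, elim conjE)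
    fix \<phi> k :: "real \<Rightarrow> real" and c d :: real
    assume k: "primitive_on UNIV \<phi> k" and k_fin: "energy k UNIV < top"
      and cd: "c < d" "{c..d} \<subseteq> \<Omega>" and zero': "\<forall>x. x \<notin> {c<..<d} \<longrightarrow> \<phi> x = 0"
    have zero: "\<And>x. x \<notin> {c<..<d} \<Longrightarrow> \<phi> x = 0" using zero' by blast
    have [measurable]: "f \<in> borel_measurable borel" "k \<in> borel_measurable borel"
      using f k by (auto simp: primitive_on_def)
    have [measurable]: "\<phi> \<in> borel_measurable borel" by (rule primitive_on_UNIV_measurable[OF k])
    define U where "U = {x. \<phi> x \<noteq> 0}"
    have U [measurable]: "U \<in> sets borel" unfolding U_def by measurable
    have "U \<subseteq> {c<..<d}" using zero unfolding U_def by blast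
    also have "\<dots> \<subseteq> {c..d}" by auto
    also note cd(2)
    finally have U\<Omega>: "U \<inter> \<Omega> = U" by blast
    have fk: "primitive_on \<Omega> (\<lambda>x. v x + \<phi> x) (\<lambda>x. f x + k x)"
      by (rule primitive_on_add[OF f primitive_on_subset[OF k subset_UNIV]])
    have fk_fin: "energy (\<lambda>x. f x + k x) {r..s} < top" if "r < s" "{r..s} \<subseteq> \<Omega>" for r s
    proof -
      have "energy k {r..s} < top" using energy_mono[of "{r..s}" UNIV k] k_fin by (auto intro: order.strict_trans1)
      then have "ennreal (2 powr p) * (energy f {r..s} + energy k {r..s}) < top"
        using f_fin[OF that] by (simp add: ennreal_mult_less_top)
      moreover have "energy (\<lambda>x. f x + k x) {r..s} \<le> ennreal (2 powr p) * (energy f {r..s} + energy k {r..s})"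
        by (rule energy_add_le) simp_all
      ultimately show ?thesis by (rule order.strict_trans1[rotated])
    qed
    have A: "(\<integral>\<^sup>+ x\<in>U. epowr (min_weak_upper_gradient (restrict_space \<mu> \<Omega>) p (\<lambda>x. ereal (v x)) x) p \<partial>restrict_space \<mu> \<Omega>) = energy f (U \<inter> \<Omega>)"
      by (rule nn_integral_min_weak_upper_gradient[OF open_\<Omega> f f_fin U])
    have B: "(\<integral>\<^sup>+ x\<in>U. epowr (min_weak_upper_gradient (restrict_space \<mu> \<Omega>) p (\<lambda>x. ereal (v x + \<phi> x)) x) p \<partial>restrict_space \<mu> \<Omega>)
        = energy (\<lambda>x. f x + k x) (U \<inter> \<Omega>)"
      by (rule nn_integral_min_weak_upper_gradient[OF open_\<Omega> fk fk_fin U])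
    have "{x. ereal (\<phi> x) \<noteq> 0} = U" by (simp add: U_def zero_ereal_def)
    then show "energy f {x. \<phi> x \<noteq> 0} \<le> ennreal Q * energy (\<lambda>x. f x + k x) {x. \<phi> x \<noteq> 0}"
      using qmin[OF primitive_bump_in_newtonian_zero_dist[OF k k_fin cd zero]] A B
      by (simp add: U\<Omega> U_def[symmetric])
  qed
qed

text \<open>The competitor on \<open>[c,d]\<close> is \<open>v + \<phi>\<close> with derivative \<open>K \<sigma>\<close>, where \<open>K\<close> is chosen such that the end
  values are those of \<open>v\<close>; its energy is \<open>|K|\<^sup>p S = |v(d) - v(c)|\<^sup>p S\<^sup>1\<^sup>-\<^sup>p\<close>.  Quasiminimality
  compares the energies only where \<open>\<phi> \<noteq> 0\<close>, but on the remaining set the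
  derivatives of \<open>v\<close> and of the competitor coincide almost everywhere.\<close>

lemma quasiminimizer_energy_bound:
  assumes qm: "quasiminimizer \<mu> p \<Omega> (\<lambda>x. ereal (v x))"
    and f: "primitive_on \<Omega> v f" and f_fin: "\<And>c d. c < d \<Longrightarrow> {c..d} \<subseteq> \<Omega> \<Longrightarrow> energy f {c..d} < top"
  obtains Q where "1 \<le> Q"
    "\<And>c d. c < d \<Longrightarrow> {c..d} \<subseteq> \<Omega> \<Longrightarrow>
       energy f {c..d} \<le> ennreal (Q * \<bar>v d - v c\<bar> powr p * dual_mass c d powr (1 - p))"
proof -
  obtain Q where Q: "1 \<le> Q" and qmin:
    "\<And>\<phi> k c d. primitive_on UNIV \<phi> k \<Longrightarrow> energy k UNIV < top \<Longrightarrow> c < d \<Longrightarrow> {c..d} \<subseteq> \<Omega> \<Longrightarrow>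
       (\<And>x. x \<notin> {c<..<d} \<Longrightarrow> \<phi> x = 0) \<Longrightarrow>
       energy f {x. \<phi> x \<noteq> 0} \<le> ennreal Q * energy (\<lambda>x. f x + k x) {x. \<phi> x \<noteq> 0}"
    using quasiminimizer_energy_le[OF qm f f_fin] by blast
  show thesis
  proof (rule that[OF Q])
    fix c d assume cd: "c < d" "{c..d} \<subseteq> \<Omega>"
    have [measurable]: "f \<in> borel_measurable borel" using f by (simp add: primitive_on_def)
    define S where "S = dual_mass c d"
    have S: "0 < S" unfolding S_def by (rule dual_mass_pos[OF cd(1)])
    define K where "K = (v d - v c) / S"
    \<comment> \<open>With the open interval the primitive is \<open>0\<close> up to and including \<open>c\<close> by its definition alone.\<close>
    define k where "k x = indicator {c<..<d} x * (K * \<sigma> x - f x)" for x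
    have [measurable]: "k \<in> borel_measurable borel" unfolding k_def by measurable
    have fi: "set_integrable lborel {c..d} f" and f_eq: "v d - v c = (LBINT x:{c..d}. f x)"
      using primitive_onD[OF f, of c d] cd by auto
    have Ks_i: "set_integrable lborel {c..d} (\<lambda>x. K * \<sigma> x)"
      using dual_integrable by (rule set_integrable_mult_right)
    have i0: "set_integrable lborel {c..d} (\<lambda>x. K * \<sigma> x - f x)"
      by (rule set_integral_diff(1)[OF Ks_i fi])
    then have "set_integrable lborel {c<..<d} (\<lambda>x. K * \<sigma> x - f x)"
      by (rule set_integrable_subset) auto
    then have ki: "integrable lborel k" by (simp add: k_def[abs_def] set_integrable_def)
    have "(LBINT x. k x) = (LBINT x:{c<..<d}. K * \<sigma> x - f x)"
      by (simp add: k_def[abs_def] set_lebesgue_integral_def)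
    also have "\<dots> = (LBINT x:{c..d}. K * \<sigma> x - f x)"
      using cd(1) interval_integral_Ioo[of c d "\<lambda>x. K * \<sigma> x - f x"] interval_integral_Icc[of c d "\<lambda>x. K * \<sigma> x - f x"] by simp
    also have "\<dots> = K * S - (v d - v c)"
      by (simp add: set_integral_diff(2)[OF Ks_i fi] f_eq S_def dual_mass_def)
    also have "\<dots> = 0" using S by (simp add: K_def)
    finally have k0: "(LBINT x. k x) = 0" .
    define \<phi> where "\<phi> x = (LBINT y:{..x}. k y)" for x
    have prim: "primitive_on UNIV \<phi> k" unfolding \<phi>_def by (rule primitive_on_integral[OF ki]) simp
    have zero: "\<phi> x = 0" if "x \<notin> {c<..<d}" for x
    proof (cases "x \<le> c")
      case True
      then have "(LBINT y:{..x}. k y) = (LBINT y:{..x}. 0)"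
        by (intro set_lebesgue_integral_cong) (auto simp: k_def)
      then show ?thesis by (simp add: \<phi>_def set_lebesgue_integral_def)
    next
      case False
      with that have "d \<le> x" by auto
      then have "\<phi> x = (LBINT y. k y)"
        unfolding \<phi>_def set_lebesgue_integral_def
        by (intro Bochner_Integration.integral_cong) (auto simp: k_def split: split_indicator)
      then show ?thesis by (simp add: k0)
    qed
    have k_fin: "energy k UNIV < top"
    proof -
      have "energy k UNIV \<le> energy (\<lambda>x. K * \<sigma> x + - 1 * f x) {c..d}"
        unfolding energy_def using p
        by (intro nn_integral_mono) (auto simp: k_def split: split_indicator)
      also have "\<dots> \<le> ennreal (2 powr p) * (energy (\<lambda>x. K * \<sigma> x) {c..d} + energy (\<lambda>x. - 1 * f x) {c..d})"
        by (rule energy_add_le) simp_all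
      also have "\<dots> = ennreal (2 powr p) * (ennreal (\<bar>K\<bar> powr p) * energy \<sigma> {c..d} + ennreal (\<bar>- 1\<bar> powr p) * energy f {c..d})"
        by (subst energy_scale, simp_all del: mult_minus1, subst energy_scale, simp_all)
      also have "\<dots> < top"
        using energy_dual_finite[of c d] f_fin[OF cd] by (simp add: ennreal_mult_less_top)
      finally show ?thesis .
    qed
    define U where "U = {x. \<phi> x \<noteq> 0}"
    have Ucd: "U \<subseteq> {c<..<d}" using zero unfolding U_def by blast
    have [measurable]: "\<phi> \<in> borel_measurable borel" by (rule primitive_on_UNIV_measurable[OF prim])
    have U [measurable]: "U \<in> sets borel" unfolding U_def by measurable
    define V where "V = {c<..<d} - U"
    have V [measurable]: "V \<in> sets borel" unfolding V_def by measurable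
    have "energy f U \<le> ennreal Q * energy (\<lambda>x. f x + k x) U"
      unfolding U_def by (rule qmin[OF prim k_fin cd zero])
    also have "energy (\<lambda>x. f x + k x) U = energy (\<lambda>x. K * \<sigma> x) U"
    proof (rule energy_cong_AE, rule AE_I2, rule impI)
      fix x assume "x \<in> U"
      then have "x \<in> {c<..<d}" using Ucd by blast
      then show "\<bar>f x + k x\<bar> = \<bar>K * \<sigma> x\<bar>" by (simp add: k_def)
    qed
    finally have EU: "energy f U \<le> ennreal Q * energy (\<lambda>x. K * \<sigma> x) U" .
    have "AE x in lborel. x \<in> {c..d} \<longrightarrow> \<phi> x = 0 \<longrightarrow> k x = 0"
      by (rule AE_derivative_zero_on_zeros[OF primitive_on_subset[OF prim subset_UNIV]])
    then have "AE x in lborel. x \<in> V \<longrightarrow> \<bar>f x\<bar> = \<bar>K * \<sigma> x\<bar>"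
      by eventually_elim (auto simp: V_def U_def k_def)
    then have "energy f V = energy (\<lambda>x. K * \<sigma> x) V" by (rule energy_cong_AE)
    also have "\<dots> \<le> ennreal Q * energy (\<lambda>x. K * \<sigma> x) V"
      using mult_right_mono[of 1 "ennreal Q" "energy (\<lambda>x. K * \<sigma> x) V"] Q by simp
    finally have EV: "energy f V \<le> ennreal Q * energy (\<lambda>x. K * \<sigma> x) V" .
    have Icc: "energy h {c..d} = energy h U + energy h V" if [measurable]: "h \<in> borel_measurable borel" for h
    proof -
      have "energy h {c..d} = energy h {c<..<d}"
        unfolding energy_def
        by (rule nn_integral_cong_AE, use AE_lborel_singleton[of c] AE_lborel_singleton[of d] in eventually_elim)
          (auto split: split_indicator)
      also have "{c<..<d} = U \<union> V" using Ucd by (auto simp: V_def)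
      also have "energy h (U \<union> V) = energy h U + energy h V"
        by (rule energy_Un) (auto simp: V_def)
      finally show ?thesis .
    qed
    have "energy f {c..d} \<le> ennreal Q * energy (\<lambda>x. K * \<sigma> x) {c..d}"
      using add_mono[OF EU EV] by (simp add: Icc distrib_left)
    also have "energy (\<lambda>x. K * \<sigma> x) {c..d} = ennreal (\<bar>K\<bar> powr p) * ennreal S"
      by (simp add: energy_scale dual_integral S_def dual_mass_def)
    also have "ennreal Q * (ennreal (\<bar>K\<bar> powr p) * ennreal S) = ennreal (Q * (\<bar>K\<bar> powr p * S))"
      using Q S by (simp add: ennreal_mult')
    also have "\<bar>K\<bar> powr p * S = \<bar>v d - v c\<bar> powr p * S powr (1 - p)"
      using S by (simp add: K_def powr_divide powr_diff)
    finally show "energy f {c..d} \<le> ennreal (Q * \<bar>v d - v c\<bar> powr p * dual_mass c d powr (1 - p))"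
      by (simp add: S_def mult.assoc)
  qed
qed

end

section \<open>Finite energy and boundedness\<close>

context exhausted_line
begin

text \<open>In the last case, with finite energy \<open>T\<close> and unbounded dual mass \<open>S n\<close>, write
  \<open>r n = (S n)\<^sup>1\<^sup>-\<^sup>1\<^sup>/\<^sup>p\<close>.  If \<open>T\<close> were positive, the increments \<open>D n\<close> of \<open>v\<close> over \<open>[a\<^sub>n,b\<^sub>n]\<close>
  would be at least \<open>c0 * r n\<close> by the reverse estimate.  The increments over the two outer
  pieces of \<open>[a\<^sub>n,b\<^sub>n]\<close>, however, amount to a small multiple of \<open>r n\<close>.\<close>

theorem quasiharmonic_finite_energy_iff_bounded:
  assumes v: "quasiharmonic \<mu> p \<Omega> v"
  shows "finite_energy \<mu> p \<Omega> v \<longleftrightarrow> bounded (v ` \<Omega>)"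
proof -
  have qm: "quasiminimizer \<mu> p \<Omega> (\<lambda>x. ereal (v x))" using v by (simp add: quasiharmonic_def)
  then have "(\<lambda>x. ereal (v x)) \<in> newtonian_loc_dist \<mu> p \<Omega>" by (simp add: quasiminimizer_def)
  then obtain f where f: "primitive_on \<Omega> v f"
    and f_fin: "\<And>c d. c < d \<Longrightarrow> {c..d} \<subseteq> \<Omega> \<Longrightarrow> energy f {c..d} < top"
    by (rule newtonian_loc_dist_primitive) blast
  have [measurable]: "f \<in> borel_measurable borel" using f by (simp add: primitive_on_def)
  obtain Q where Q: "1 \<le> Q" and E_le: "\<And>c d. c < d \<Longrightarrow> {c..d} \<subseteq> \<Omega> \<Longrightarrow>
       energy f {c..d} \<le> ennreal (Q * \<bar>v d - v c\<bar> powr p * dual_mass c d powr (1 - p))"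
    using quasiminimizer_energy_bound[OF qm f f_fin] by blast
  have "(\<integral>\<^sup>+ x\<in>UNIV. epowr (min_weak_upper_gradient (restrict_space \<mu> \<Omega>) p (\<lambda>x. ereal (v x)) x) p
      \<partial>restrict_space \<mu> \<Omega>) = energy f (UNIV \<inter> \<Omega>)"
    by (rule nn_integral_min_weak_upper_gradient[OF open_\<Omega> f f_fin]) simp_all
  then have FE: "finite_energy \<mu> p \<Omega> v \<longleftrightarrow> energy f \<Omega> < top"
    by (simp add: finite_energy_def Lp_integral_def)
  define S where "S n = dual_mass (a n) (b n)" for n
  have S_pos: "0 < S n" for n unfolding S_def by (rule dual_mass_pos[OF a_less_b])
  have sub: "{a m..b m} \<subseteq> {a n..b n}" if "m \<le> n" for m n
    using a_antimono[OF that] b_mono[OF that] by auto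
  have S_mono: "S m \<le> S n" if "m \<le> n" for m n
    unfolding S_def by (rule dual_mass_mono[OF sub[OF that]])
  show ?thesis
    unfolding FE
  proof
    assume "bounded (v ` \<Omega>)"
    then obtain B where "\<forall>y\<in>v ` \<Omega>. norm y \<le> B" unfolding bounded_iff by blast
    then have B: "\<bar>v x\<bar> \<le> B" if "x \<in> \<Omega>" for x using that by simp
    have "energy f {a n..b n} \<le> ennreal (Q * (2 * B) powr p * S 0 powr (1 - p))" for n
    proof -
      have "a n \<in> {a n..b n}" "b n \<in> {a n..b n}" using a_less_b[of n] by auto
      then have "a n \<in> \<Omega>" "b n \<in> \<Omega>" using Icc_subset[of n] by blast+
      then have le: "\<bar>v (b n) - v (a n)\<bar> \<le> 2 * B" using B[of "a n"] B[of "b n"] by linarith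
      have "Q * \<bar>v (b n) - v (a n)\<bar> powr p * S n powr (1 - p) \<le> Q * (2 * B) powr p * S 0 powr (1 - p)"
        using Q p le S_pos[of 0] S_mono[of 0 n]
        by (intro mult_mono powr_mono2 powr_mono2' mult_nonneg_nonneg) auto
      then show ?thesis
        using E_le[OF a_less_b[of n] Icc_subset[of n]] unfolding S_def
        by (meson ennreal_leI order_trans)
    qed
    then have "energy f \<Omega> \<le> ennreal (Q * (2 * B) powr p * S 0 powr (1 - p))"
      unfolding energy_\<Omega>_eq_SUP[OF \<open>f \<in> borel_measurable borel\<close>] by (intro SUP_least)
    then show "energy f \<Omega> < top" by (rule order.strict_trans1) simp
  next
    assume "energy f \<Omega> < top"
    then obtain T where T: "energy f \<Omega> = ennreal T" "0 \<le> T" by (cases "energy f \<Omega>") auto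
    define e where "e c d = enn2real (energy f {c..d})" for c d
    have e: "energy f {c..d} = ennreal (e c d)" "0 \<le> e c d" "e c d \<le> T" if "{c..d} \<subseteq> \<Omega>" for c d
    proof -
      have le: "energy f {c..d} \<le> ennreal T" using energy_mono[OF that, of f] T by simp
      then have "energy f {c..d} < top" by (rule order.strict_trans1) simp
      then show 1: "energy f {c..d} = ennreal (e c d)" by (simp add: e_def)
      show "0 \<le> e c d" by (simp add: e_def)
      show "e c d \<le> T" using le T(2) unfolding 1 by simp
    qed
    have incr: "\<bar>v d - v c\<bar> \<le> \<theta> powr (p - 1) * e c d + dual_mass c d / \<theta>"
      if "c \<le> d" "{c..d} \<subseteq> \<Omega>" "0 < \<theta>" for c d \<theta>
    proof -
      have "ennreal \<bar>v d - v c\<bar> \<le> ennreal (\<theta> powr (p - 1)) * ennreal (e c d) + ennreal (1 / \<theta>) * ennreal (dual_mass c d)"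
        using increment_le_energy_add_dual[OF f that] e(1)[OF that(2)] by (simp add: energy_dual_eq)
      also have "\<dots> = ennreal (\<theta> powr (p - 1) * e c d + dual_mass c d / \<theta>)"
        using e(2)[OF that(2)] dual_mass_nonneg[of c d] that(3)
        by (simp add: ennreal_mult'[symmetric] ennreal_plus[symmetric] del: ennreal_plus)
      finally show ?thesis
        using e(2)[OF that(2)] dual_mass_nonneg[of c d] that(3) by (subst (asm) ennreal_le_iff) auto
    qed
    have osc: "\<exists>n. \<bar>v x - v (a 0)\<bar> \<le> \<theta> powr (p - 1) * T + S n / \<theta>" if x: "x \<in> \<Omega>" and \<theta>: "0 < \<theta>" for x \<theta>
    proof -
      obtain n where n: "x \<in> {a n..b n}" using ex_Icc[OF x] by blast
      define c d where "c = min x (a 0)" and "d = max x (a 0)"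
      have "a 0 \<in> {a n..b n}" using a_antimono[of 0 n] b_mono[of 0 n] a_less_b[of 0] by auto
      then have cd: "c \<le> d" "{c..d} \<subseteq> {a n..b n}" using n by (auto simp: c_def d_def)
      then have cd\<Omega>: "{c..d} \<subseteq> \<Omega>" using Icc_subset[of n] by blast
      have "\<bar>v x - v (a 0)\<bar> = \<bar>v d - v c\<bar>" by (auto simp: c_def d_def min_def max_def abs_minus_commute)
      also have "\<dots> \<le> \<theta> powr (p - 1) * e c d + dual_mass c d / \<theta>"
        by (rule incr[OF cd(1) cd\<Omega> \<theta>])
      also have "\<dots> \<le> \<theta> powr (p - 1) * T + S n / \<theta>"
        unfolding S_def using e(3)[OF cd\<Omega>] dual_mass_mono[OF cd(2)] \<theta>
        by (intro add_mono mult_left_mono divide_right_mono) auto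
      finally show ?thesis by blast
    qed
    show "bounded (v ` \<Omega>)"
    proof (cases "\<exists>B. \<forall>n. S n \<le> B")
      case True
      then obtain B where B: "\<And>n. S n \<le> B" by blast
      have "\<bar>v x\<bar> \<le> \<bar>v (a 0)\<bar> + (T + B)" if x: "x \<in> \<Omega>" for x
      proof -
        obtain n where "\<bar>v x - v (a 0)\<bar> \<le> 1 powr (p - 1) * T + S n / 1" using osc[OF x, of 1] by auto
        then show ?thesis using B[of n] by simp
      qed
      then show ?thesis by (auto simp: bounded_iff)
    next
      case False
      then have S_unbounded: "\<exists>n. B < S n" for B by (meson not_le)
      have "T = 0"
      proof (rule ccontr)
        assume "T \<noteq> 0"
        with T have T_pos: "0 < T" by simp
        define D where "D n = \<bar>v (b n) - v (a n)\<bar>" for n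
        define E where "E n = e (a n) (b n)" for n
        have E: "energy f {a n..b n} = ennreal (E n)" "0 \<le> E n" "E n \<le> T" for n
          unfolding E_def by (rule e[OF Icc_subset])+
        have E_near: "\<exists>n. T - \<delta> < E n" if "0 < \<delta>" for \<delta>
        proof -
          have "ennreal (T - \<delta>) < (SUP n. energy f {a n..b n})"
            unfolding energy_\<Omega>_eq_SUP[OF \<open>f \<in> borel_measurable borel\<close>, symmetric] T(1)
            using T_pos that by (simp add: ennreal_lessI)
          then obtain n where "ennreal (T - \<delta>) < ennreal (E n)"
            unfolding less_SUP_iff E(1) by blast
          then have "T - \<delta> < E n" using E(2)[of n] by (metis ennreal_leI not_less)
          then show ?thesis by blast
        qed
        have E_mono: "E m \<le> E n" if "m \<le> n" for m n
          using energy_mono[OF sub[OF that], of f] E(2)[of n] unfolding E(1) by simp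
        obtain m where m: "0 < E m" using E_near[OF T_pos] by auto
        define c0 where "c0 = (E m / Q) powr (1 / p)"
        have c0: "0 < c0" using m Q by (simp add: c0_def)
        define r where "r n = S n powr ((p - 1) / p)" for n
        have r_pos: "0 < r n" for n using S_pos[of n] by (simp add: r_def)
        have lower: "c0 * r n \<le> D n" if "m \<le> n" for n
        proof -
          have "ennreal (E n) \<le> ennreal (Q * (D n powr p * S n powr (1 - p)))"
            using E_le[OF a_less_b Icc_subset, of n] by (simp add: E D_def S_def mult.assoc)
          then have "E n \<le> Q * (D n powr p * S n powr (1 - p))"
            using Q by (simp add: ennreal_le_iff)
          then have "E m \<le> Q * (D n powr p * S n powr (1 - p))" using E_mono[OF that] by simp
          then have "E m / Q \<le> D n powr p * S n powr (1 - p)" using Q by (simp add: divide_le_eq mult.commute)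
          then have "c0 \<le> (D n powr p * S n powr (1 - p)) powr (1 / p)"
            unfolding c0_def using m Q p by (intro powr_mono2) auto
          also have "\<dots> = D n * S n powr ((1 - p) / p)"
            using p by (simp add: powr_mult powr_powr D_def)
          finally have "c0 * r n \<le> D n * S n powr ((1 - p) / p) * r n"
            using r_pos[of n] by (intro mult_right_mono) auto
          also have "\<dots> = D n * (S n powr ((1 - p) / p + (p - 1) / p))"
            by (simp add: r_def powr_add)
          also have "(1 - p) / p + (p - 1) / p = 0" by (simp add: add_divide_distrib[symmetric])
          finally show ?thesis using S_pos[of n] by simp
        qed
        have upper: "D n \<le> D N + \<theta> powr (p - 1) * (T - E N) + S n / \<theta>" if "N \<le> n" "0 < \<theta>" for N n \<theta>
        proof -
          have ord: "a n \<le> a N" "a N \<le> b N" "b N \<le> b n" "a N \<le> b n"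
            using a_antimono[OF that(1)] b_mono[OF that(1)] a_less_b[of N] by auto
          have subs: "{b N..b n} \<subseteq> \<Omega>" "{a n..a N} \<subseteq> \<Omega>" "{a N..b n} \<subseteq> \<Omega>"
            using ord Icc_subset[of n] by (meson Icc_subset atLeastatMost_subset_iff order_trans order_refl)+
          have "energy f {a n..b n} = energy f {a n..a N} + (energy f {a N..b N} + energy f {b N..b n})"
            using ord energy_Icc_split[of f "a n" "a N" "b n"] energy_Icc_split[of f "a N" "b N" "b n"] by simp
          then have "ennreal (E n) = ennreal (e (a n) (a N) + (E N + e (b N) (b n)))"
            using E e(2)[OF subs(1)] e(2)[OF subs(2)] by (simp add: E(1) e(1)[OF subs(1)] e(1)[OF subs(2)])
          then have "E n = e (a n) (a N) + (E N + e (b N) (b n))"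
            using E(2)[of n] E(2)[of N] e(2)[OF subs(1)] e(2)[OF subs(2)] by (subst (asm) ennreal_inj) auto
          then have eT: "e (a n) (a N) + e (b N) (b n) \<le> T - E N" using E(3)[of n] by simp
          have sS: "dual_mass (a n) (a N) + dual_mass (b N) (b n) \<le> S n"
            unfolding S_def
            using ord dual_mass_split[of "a n" "a N" "b n"] dual_mass_split[of "a N" "b N" "b n"] dual_mass_nonneg[of "a N" "b N"]
            by simp
          have "D n \<le> D N + \<bar>v (b n) - v (b N)\<bar> + \<bar>v (a N) - v (a n)\<bar>" by (simp add: D_def)
          also have "\<dots> \<le> D N + (\<theta> powr (p - 1) * e (b N) (b n) + dual_mass (b N) (b n) / \<theta>)
               + (\<theta> powr (p - 1) * e (a n) (a N) + dual_mass (a n) (a N) / \<theta>)"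
            by (intro add_mono order_refl incr ord subs that)
          also have "\<dots> = D N + \<theta> powr (p - 1) * (e (a n) (a N) + e (b N) (b n))
               + (dual_mass (a n) (a N) + dual_mass (b N) (b n)) / \<theta>"
            by (simp add: algebra_simps add_divide_distrib)
          also have "\<dots> \<le> D N + \<theta> powr (p - 1) * (T - E N) + S n / \<theta>"
            using eT sS that(2) by (intro add_mono mult_left_mono divide_right_mono) auto
          finally show ?thesis .
        qed
        \<comment> \<open>\<open>\<theta> = \<kappa> (S n)\<^sup>1\<^sup>/\<^sup>p\<close> makes both error terms in \<open>upper\<close> multiples of \<open>r n\<close>.  Each of
          them, and \<open>D N\<close> too, shall be at most a quarter of \<open>c0 * r n\<close>.\<close>
        define \<kappa> where "\<kappa> = 4 / c0"
        have \<kappa>: "0 < \<kappa>" using c0 by (simp add: \<kappa>_def)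
        obtain N0 where N0: "T - c0 / 4 / \<kappa> powr (p - 1) < E N0"
          using E_near[of "c0 / 4 / \<kappa> powr (p - 1)"] c0 \<kappa> by auto
        define N where "N = max N0 m"
        have "T - c0 / 4 / \<kappa> powr (p - 1) < E N" using N0 E_mono[of N0 N] by (simp add: N_def)
        then have N: "\<kappa> powr (p - 1) * (T - E N) \<le> c0 / 4"
          using \<kappa> by (simp add: field_simps)
        obtain n0 where n0: "(4 * D N / c0) powr (p / (p - 1)) < S n0" using S_unbounded by blast
        define n where "n = max n0 N"
        have n: "N \<le> n" "m \<le> n" by (auto simp: n_def N_def)
        define X where "X = 4 * D N / c0"
        have "X \<le> r n"
        proof -
          have "0 \<le> X" using c0 by (simp add: X_def D_def)
          then have "X = X powr (p / (p - 1) * ((p - 1) / p))" using p by simp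
          also have "\<dots> = (X powr (p / (p - 1))) powr ((p - 1) / p)" by (rule powr_powr[symmetric])
          also have "\<dots> \<le> S n powr ((p - 1) / p)"
            using n0 S_mono[of n0 n] p by (intro powr_mono2) (auto simp: n_def X_def)
          finally show ?thesis by (simp add: r_def)
        qed
        then have DN: "D N \<le> c0 / 4 * r n" using c0 by (simp add: X_def field_simps)
        define \<theta> where "\<theta> = \<kappa> * S n powr (1 / p)"
        have \<theta>: "0 < \<theta>" using \<kappa> S_pos[of n] by (simp add: \<theta>_def)
        have \<theta>1: "\<theta> powr (p - 1) = \<kappa> powr (p - 1) * r n"
          using \<kappa> by (simp add: \<theta>_def powr_mult powr_powr r_def)
        have \<theta>2: "S n / \<theta> = r n / \<kappa>"
        proof -
          have "S n / S n powr (1 / p) = S n powr (1 - 1 / p)"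
            using S_pos[of n] by (simp add: powr_diff)
          also have "1 - 1 / p = (p - 1) / p" using p by (simp add: field_simps)
          finally have "S n / S n powr (1 / p) = r n" by (simp add: r_def)
          moreover have "S n / \<theta> = S n / S n powr (1 / p) / \<kappa>" by (simp add: \<theta>_def mult.commute)
          ultimately show ?thesis by simp
        qed
        have "c0 * r n \<le> D n" by (rule lower[OF n(2)])
        also have "\<dots> \<le> D N + \<theta> powr (p - 1) * (T - E N) + S n / \<theta>" by (rule upper[OF n(1) \<theta>])
        also have "\<dots> = D N + (\<kappa> powr (p - 1) * (T - E N)) * r n + c0 / 4 * r n"
          using c0 by (simp add: \<theta>1 \<theta>2 \<kappa>_def field_simps)
        also have "\<dots> \<le> c0 / 4 * r n + c0 / 4 * r n + c0 / 4 * r n"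
          using DN N r_pos[of n] by (intro add_mono mult_right_mono) auto
        finally have "c0 * r n \<le> 0" using mult_pos_pos[OF c0 r_pos[of n]] by linarith
        then show False using mult_pos_pos[OF c0 r_pos[of n]] by linarith
      qed
      have "v x = v (a 0)" if x: "x \<in> \<Omega>" for x
      proof -
        obtain n where n: "x \<in> {a n..b n}" using ex_Icc[OF x] by blast
        define c d where "c = min x (a 0)" and "d = max x (a 0)"
        have "a 0 \<in> {a n..b n}" using a_antimono[of 0 n] b_mono[of 0 n] a_less_b[of 0] by auto
        then have "c \<le> d" "{c..d} \<subseteq> {a n..b n}" using n by (auto simp: c_def d_def)
        then have cd: "c \<le> d" "{c..d} \<subseteq> \<Omega>" using Icc_subset[of n] by blast+
        have e0: "e c d = 0" using e(2,3)[OF cd(2)] \<open>T = 0\<close> by simp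
        have "\<bar>v d - v c\<bar> \<le> 0 + \<epsilon>" if \<epsilon>: "0 < \<epsilon>" for \<epsilon>
        proof -
          define \<theta> where "\<theta> = (dual_mass c d + 1) / \<epsilon>"
          have \<theta>: "0 < \<theta>" using \<epsilon> dual_mass_nonneg[of c d] by (simp add: \<theta>_def add_nonneg_pos)
          have "\<bar>v d - v c\<bar> \<le> dual_mass c d / \<theta>" using incr[OF cd \<theta>] by (simp add: e0)
          also have "\<dots> = \<epsilon> * (dual_mass c d / (dual_mass c d + 1))" by (simp add: \<theta>_def)
          also have "\<dots> \<le> \<epsilon> * 1"
            using \<epsilon> dual_mass_nonneg[of c d] by (intro mult_left_mono) (auto simp: divide_le_eq)
          finally show ?thesis by simp
        qed
        then have "\<bar>v d - v c\<bar> \<le> 0" by (rule field_le_epsilon)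
        then show ?thesis by (auto simp: c_def d_def min_def max_def split: if_splits)
      qed
      then show ?thesis by (auto simp: bounded_iff)
    qed
  qed
qed

end

lemma exhausted_line_of_weighted_line:
  assumes "weighted_line p w \<mu>" and \<Omega>: "\<Omega> = UNIV \<or> \<Omega> = {0<..}"
  obtains a b where "exhausted_line p w \<mu> \<Omega> a b"
  using \<Omega>
proof
  assume U: "\<Omega> = UNIV"
  show thesis
  proof (rule that, rule exhausted_line.intro[OF assms(1)], unfold_locales)
    fix n :: nat and x :: real
    show "- (real n + 1) < real n + 1" "- (real (Suc n) + 1) < - (real n + 1)" "real n + 1 < real (Suc n) + 1"
      by auto
    show "{- (real n + 1)..real n + 1} \<subseteq> \<Omega>" using U by simp
    show "{- (real n + 1)<..<real n + 1} \<in> G_dist \<Omega>" using U by (simp add: G_dist_def)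
    obtain k :: nat where "\<bar>x\<bar> \<le> real k" using real_arch_simple by blast
    then show "\<exists>n. x \<in> {- (real n + 1)..real n + 1}" by (intro exI[of _ k]) auto
  qed
next
  assume P: "\<Omega> = {0<..}"
  show thesis
  proof (rule that, rule exhausted_line.intro[OF assms(1)], unfold_locales)
    fix n :: nat and x :: real
    show "1 / (real n + 2) < real n + 2"
      by (simp add: divide_less_eq) (smt (verit) mult_less_cancel_left1 of_nat_0_le_iff)
    show "1 / (real (Suc n) + 2) < 1 / (real n + 2)" "real n + 2 < real (Suc n) + 2"
      by (auto simp: frac_less2)
    show "{1 / (real n + 2)..real n + 2} \<subseteq> \<Omega>"
      unfolding P using less_le_trans[of 0 "1 / (real n + 2)"] by (auto simp: add_nonneg_pos)
    define \<delta> where "\<delta> = 1 / (real n + 2)"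
    have pos: "0 < \<delta>" by (simp add: \<delta>_def)
    have "0 < setdist {\<delta><..<real n + 2} (- {0<..})" if ne: "{\<delta><..<real n + 2} \<noteq> {}"
    proof -
      have "\<delta> \<le> setdist {\<delta><..<real n + 2} (- {0<..})"
      proof (rule le_setdistI[OF ne])
        have "(0::real) \<in> - {0<..}" by simp
        then show "- {0::real<..} \<noteq> {}" by blast
        show "\<delta> \<le> dist x y" if "x \<in> {\<delta><..<real n + 2}" "y \<in> - {0<..}" for x y
        proof -
          have "\<delta> < x" "y \<le> 0" using that by auto
          then show ?thesis unfolding dist_real_def by linarith
        qed
      qed
      with pos show ?thesis by linarith
    qed
    moreover have "{\<delta><..<real n + 2} \<subseteq> {0<..}" using pos by auto
    moreover have "bounded {\<delta><..<real n + 2}"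
      by (rule bounded_subset[of "{\<delta>..real n + 2}"]) auto
    ultimately have "{\<delta><..<real n + 2} \<in> G_dist \<Omega>"
      unfolding P G_dist_def by auto
    then show "{1 / (real n + 2)<..<real n + 2} \<in> G_dist \<Omega>" by (simp only: \<delta>_def)
    show "\<exists>n. x \<in> {1 / (real n + 2)..real n + 2}" if "x \<in> \<Omega>"
    proof -
      have x: "0 < x" using that P by simp
      obtain k :: nat where k: "max x (1 / x) \<le> real k" using real_arch_simple by blast
      have "1 / (real k + 2) \<le> x"
      proof -
        have "1 \<le> real k * x" using k x by (simp add: field_simps)
        also have "\<dots> \<le> x * (real k + 2)" using x by (simp add: algebra_simps)
        finally show ?thesis by (simp add: divide_le_eq)
      qed
      then show ?thesis using k by (intro exI[of _ k]) auto
    qed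
  qed
qed

theorem proposition6p5:
  fixes p :: real and w v :: "real \<Rightarrow> real" and \<mu> :: "real measure" and \<Omega> :: "real set"
  assumes "1 < p"
    and "weight w"
    and "\<mu> = weighted_measure w"
    and "positive_finite_on_balls \<mu>"
    and "locally_doubling \<mu>"
    and "local_poincare \<mu> p"
    and "\<Omega> = UNIV \<or> \<Omega> = {0<..}"
    and "quasiharmonic \<mu> p \<Omega> v"
  shows "finite_energy \<mu> p \<Omega> v \<longleftrightarrow> bounded (v ` \<Omega>)"
proof -
  obtain w' where "weighted_line p w' \<mu>"
    using weighted_line_of_poincare[OF assms(1-4,6)] .
  then obtain a b where "exhausted_line p w' \<mu> \<Omega> a b"
    using exhausted_line_of_weighted_line[OF _ assms(7)] by blast
  then interpret exhausted_line p w' \<mu> \<Omega> a b .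
  show ?thesis by (rule quasiharmonic_finite_energy_iff_bounded[OF assms(8)])
qed

end
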